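(* Let $(X,g)$ be a complex hyper-K\"ahler four-manifold. If $X$ admits a hyper-Lagrangian foliation $\mathcal B$ such that for every $\alpha$-plane foliation $\mathcal D_\alpha$ (in the $\mathbb{CP}^1$-family of such foliations determined by the hyper-K\"ahler structure) $$[\mathcal B,\mathcal D_\alpha]\subseteq\mathcal B+\mathcal D_\alpha ,$$ then there exist local coordinates $(u^1,u^2,\tilde u^1,\tilde u^2)$ on $X$ such that $$g=A\,du^1d\tilde u^2+\frac1A\,du^2d\tilde u^1+\Big(u^1\frac{\partial A}{\partial u^2}-\tilde u^1A^{-2}\frac{\partial A}{\partial\tilde u^2}+D\Big)du^2d\tilde u^2,$$ where $A(u^2,\tilde u^2)$ (nowhere zero) and $D(u^2,\tilde u^2)$ are holomorphic functions. The functions $A$ and $D$ are arbitrary: each choice yields a complex hyper-K\"ahler metric admitting such a foliation.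
   Context: Everything is holomorphic and local. A complex hyper-K\"ahler four-manifold is a complex manifold $X$, $\dim_{\mathbb C}X=4$, with a holomorphic metric $g$ and holomorphic endomorphisms $I,J,K$ of $TX$ with $I^2=J^2=K^2=IJK=-\mathrm{Id}$, Hermitian for $g$ and parallel for its Levi-Civita connection. A hyper-Lagrangian foliation is an integrable rank-2 distribution $\mathcal B\subset TX$ that is Lagrangian for each of the symplectic forms $g(I\cdot,\cdot),g(J\cdot,\cdot),g(K\cdot,\cdot)$. The $\alpha$-plane foliations $\mathcal D_\alpha$ are the integrable rank-2 totally null distributions $\ker(\alpha I+\beta J+\gamma K)$, where $(\alpha,\beta,\gamma)\in\mathbb C^3\setminus\{0\}$ satisfies $\alpha^2+\beta^2+\gamma^2=0$ (constants); they are parametrised by $\mathbb{CP}^1$. Products of one-forms denote symmetric products. $[\mathcal B,\mathcal D]\subseteq\mathcal B+\mathcal D$ means that Lie brackets of local sections of $\mathcal B$ with local sections of $\mathcal D$ are sections of $\mathcal B+\mathcal D$. *)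

theory Defs
  imports "HOL-Analysis.Analysis"
begin

text \<open>All geometry is local and holomorphic: a complex four-manifold is an open subset \<open>U\<close> of
  \<open>\<complex>\<^sup>4\<close>, tensor fields are given by their components in the standard coordinates, and vectors are
  elements of the holomorphic tangent space \<open>\<complex>\<^sup>4\<close>. Only the values of fields on \<open>U\<close> matter.\<close>

type_synonym cvec = "complex ^ 4"
type_synonym cmat = "complex ^ 4 ^ 4"


section \<open>Holomorphic functions of several variables\<close>

definition holo_on :: "(complex ^ 'n \<Rightarrow> complex) \<Rightarrow> (complex ^ 'n) set \<Rightarrow> bool" where
  "holo_on f S \<longleftrightarrow>
     (\<forall>x\<in>S. \<exists>f'. (f has_derivative f') (at x) \<and> (\<forall>c v. f' (c *s v) = c * f' v))"

definition pd :: "'n \<Rightarrow> (complex ^ 'n \<Rightarrow> complex) \<Rightarrow> complex ^ 'n \<Rightarrow> complex" where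
  "pd i f x = deriv (\<lambda>t. f (x + axis i t)) 0"

definition holo_vec :: "cvec set \<Rightarrow> (cvec \<Rightarrow> cvec) \<Rightarrow> bool" where
  "holo_vec U X \<longleftrightarrow> (\<forall>i. holo_on (\<lambda>x. X x $ i) U)"

definition holo_mat :: "cvec set \<Rightarrow> (cvec \<Rightarrow> cmat) \<Rightarrow> bool" where
  "holo_mat U T \<longleftrightarrow> (\<forall>i j. holo_on (\<lambda>x. T x $ i $ j) U)"

definition differential :: "(cvec \<Rightarrow> cvec) \<Rightarrow> cvec \<Rightarrow> cvec \<Rightarrow> cvec" where
  "differential \<phi> x v = (\<chi> i. \<Sum>j\<in>UNIV. pd j (\<lambda>y. \<phi> y $ i) x * v $ j)"

definition local_coordinates :: "cvec set \<Rightarrow> (cvec \<Rightarrow> cvec) \<Rightarrow> bool" where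
  "local_coordinates V \<phi> \<longleftrightarrow>
     open V \<and> open (\<phi> ` V) \<and> inj_on \<phi> V \<and>
     holo_vec V \<phi> \<and> holo_vec (\<phi> ` V) (the_inv_into V \<phi>)"


section \<open>Holomorphic metrics and hyper-Kaehler structures\<close>

definition bil :: "cmat \<Rightarrow> cvec \<Rightarrow> cvec \<Rightarrow> complex" where
  "bil G v w = (\<Sum>i\<in>UNIV. \<Sum>j\<in>UNIV. G $ i $ j * v $ i * w $ j)"

definition holo_metric :: "cvec set \<Rightarrow> (cvec \<Rightarrow> cmat) \<Rightarrow> bool" where
  "holo_metric U g \<longleftrightarrow>
     holo_mat U g \<and> (\<forall>x\<in>U. transpose (g x) = g x \<and> invertible (g x))"

text \<open>\<open>christoffel g x i j k\<close> is \<open>\<Gamma>\<^sup>i\<^sub>j\<^sub>k\<close> of the Levi-Civita connection.\<close>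

definition christoffel :: "(cvec \<Rightarrow> cmat) \<Rightarrow> cvec \<Rightarrow> 4 \<Rightarrow> 4 \<Rightarrow> 4 \<Rightarrow> complex" where
  "christoffel g x i j k =
     (\<Sum>l\<in>UNIV. matrix_inv (g x) $ i $ l *
        (pd j (\<lambda>y. g y $ l $ k) x + pd k (\<lambda>y. g y $ l $ j) x - pd l (\<lambda>y. g y $ j $ k) x)) / 2"

text \<open>\<open>cov_deriv g T x k i j\<close> is \<open>(\<nabla>\<^sub>k T)\<^sup>i\<^sub>j\<close> for the endomorphism field
  \<open>v \<mapsto> T x *v v\<close>, whose matrix has upper index first.\<close>

definition cov_deriv ::
  "(cvec \<Rightarrow> cmat) \<Rightarrow> (cvec \<Rightarrow> cmat) \<Rightarrow> cvec \<Rightarrow> 4 \<Rightarrow> 4 \<Rightarrow> 4 \<Rightarrow> complex" where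
  "cov_deriv g T x k i j =
     pd k (\<lambda>y. T y $ i $ j) x
     + (\<Sum>l\<in>UNIV. christoffel g x i k l * T x $ l $ j)
     - (\<Sum>l\<in>UNIV. christoffel g x l k j * T x $ i $ l)"

definition parallel :: "cvec set \<Rightarrow> (cvec \<Rightarrow> cmat) \<Rightarrow> (cvec \<Rightarrow> cmat) \<Rightarrow> bool" where
  "parallel U g T \<longleftrightarrow> (\<forall>x\<in>U. \<forall>k i j. cov_deriv g T x k i j = 0)"

definition hermitian :: "cvec set \<Rightarrow> (cvec \<Rightarrow> cmat) \<Rightarrow> (cvec \<Rightarrow> cmat) \<Rightarrow> bool" where
  "hermitian U g T \<longleftrightarrow> (\<forall>x\<in>U. \<forall>v w. bil (g x) (T x *v v) (T x *v w) = bil (g x) v w)"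

definition hyper_kaehler ::
  "cvec set \<Rightarrow> (cvec \<Rightarrow> cmat) \<Rightarrow> (cvec \<Rightarrow> cmat) \<Rightarrow> (cvec \<Rightarrow> cmat) \<Rightarrow> (cvec \<Rightarrow> cmat) \<Rightarrow> bool" where
  "hyper_kaehler U g I J K \<longleftrightarrow>
     open U \<and> holo_metric U g \<and>
     (\<forall>T\<in>{I, J, K}. holo_mat U T \<and> hermitian U g T \<and> parallel U g T) \<and>
     (\<forall>x\<in>U. I x ** I x = - mat 1 \<and> J x ** J x = - mat 1 \<and> K x ** K x = - mat 1 \<and>
             I x ** J x ** K x = - mat 1)"


section \<open>Distributions and foliations\<close>

definition lie_bracket :: "(cvec \<Rightarrow> cvec) \<Rightarrow> (cvec \<Rightarrow> cvec) \<Rightarrow> cvec \<Rightarrow> cvec" where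
  "lie_bracket X Y x =
     (\<chi> i. \<Sum>j\<in>UNIV. X x $ j * pd j (\<lambda>y. Y y $ i) x - Y x $ j * pd j (\<lambda>y. X y $ i) x)"

definition rank2_distribution :: "cvec set \<Rightarrow> (cvec \<Rightarrow> cvec set) \<Rightarrow> bool" where
  "rank2_distribution U B \<longleftrightarrow>
     (\<forall>p\<in>U. \<exists>V X Y. open V \<and> p \<in> V \<and> V \<subseteq> U \<and> holo_vec V X \<and> holo_vec V Y \<and>
        (\<forall>x\<in>V. B x = vec.span {X x, Y x} \<and> vec.dim (B x) = 2))"

definition local_section ::
  "cvec set \<Rightarrow> (cvec \<Rightarrow> cvec set) \<Rightarrow> cvec set \<Rightarrow> (cvec \<Rightarrow> cvec) \<Rightarrow> bool" where
  "local_section U B V X \<longleftrightarrow> open V \<and> V \<subseteq> U \<and> holo_vec V X \<and> (\<forall>x\<in>V. X x \<in> B x)"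

definition brackets_within ::
  "cvec set \<Rightarrow> (cvec \<Rightarrow> cvec set) \<Rightarrow> (cvec \<Rightarrow> cvec set) \<Rightarrow> (cvec \<Rightarrow> cvec set) \<Rightarrow> bool" where
  "brackets_within U B D E \<longleftrightarrow>
     (\<forall>V X Y. local_section U B V X \<longrightarrow> local_section U D V Y \<longrightarrow>
        (\<forall>x\<in>V. lie_bracket X Y x \<in> E x))"

definition dist_sum :: "(cvec \<Rightarrow> cvec set) \<Rightarrow> (cvec \<Rightarrow> cvec set) \<Rightarrow> cvec \<Rightarrow> cvec set" where
  "dist_sum B D x = {v + w | v w. v \<in> B x \<and> w \<in> D x}"

text \<open>Integrability is understood in the sense of Frobenius: closure under Lie brackets.\<close>

definition integrable_distribution :: "cvec set \<Rightarrow> (cvec \<Rightarrow> cvec set) \<Rightarrow> bool" where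
  "integrable_distribution U B \<longleftrightarrow> brackets_within U B B B"

text \<open>A rank-2 distribution in dimension 4 is Lagrangian for \<open>g(T\<cdot>,\<cdot>)\<close> iff the form vanishes on it.\<close>

definition lagrangian ::
  "cvec set \<Rightarrow> (cvec \<Rightarrow> cmat) \<Rightarrow> (cvec \<Rightarrow> cmat) \<Rightarrow> (cvec \<Rightarrow> cvec set) \<Rightarrow> bool" where
  "lagrangian U g T B \<longleftrightarrow> (\<forall>x\<in>U. \<forall>v\<in>B x. \<forall>w\<in>B x. bil (g x) (T x *v v) w = 0)"

definition hyper_lagrangian_foliation ::
  "cvec set \<Rightarrow> (cvec \<Rightarrow> cmat) \<Rightarrow> (cvec \<Rightarrow> cmat) \<Rightarrow> (cvec \<Rightarrow> cmat) \<Rightarrow> (cvec \<Rightarrow> cmat) \<Rightarrow>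
   (cvec \<Rightarrow> cvec set) \<Rightarrow> bool" where
  "hyper_lagrangian_foliation U g I J K B \<longleftrightarrow>
     rank2_distribution U B \<and> integrable_distribution U B \<and>
     (\<forall>T\<in>{I, J, K}. lagrangian U g T B)"

definition alpha_distribution ::
  "(cvec \<Rightarrow> cmat) \<Rightarrow> (cvec \<Rightarrow> cmat) \<Rightarrow> (cvec \<Rightarrow> cmat) \<Rightarrow> complex \<Rightarrow> complex \<Rightarrow> complex \<Rightarrow>
   cvec \<Rightarrow> cvec set" where
  "alpha_distribution I J K a b c x =
     {v. a *s (I x *v v) + b *s (J x *v v) + c *s (K x *v v) = 0}"

definition alpha_compatible ::
  "cvec set \<Rightarrow> (cvec \<Rightarrow> cmat) \<Rightarrow> (cvec \<Rightarrow> cmat) \<Rightarrow> (cvec \<Rightarrow> cmat) \<Rightarrow> (cvec \<Rightarrow> cvec set) \<Rightarrow> bool" where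
  "alpha_compatible U I J K B \<longleftrightarrow>
     (\<forall>a b c. (a, b, c) \<noteq> (0, 0, 0) \<and> a\<^sup>2 + b\<^sup>2 + c\<^sup>2 = 0 \<longrightarrow>
        brackets_within U B (alpha_distribution I J K a b c)
          (dist_sum B (alpha_distribution I J K a b c)))"


section \<open>The normal form\<close>

text \<open>Write \<open>v\<^sup>i\<close> for u-tilde. The coordinates \<open>(u\<^sup>1, u\<^sup>2, v\<^sup>1, v\<^sup>2)\<close> are the components 1, 2, 3, 4
  of a point \<open>u\<close> of \<open>\<complex>\<^sup>4\<close>; \<open>base u\<close> is \<open>(u\<^sup>2, v\<^sup>2)\<close>, so that \<open>pd 1 A\<close>, \<open>pd 2 A\<close> are
  the derivatives of \<open>A\<close> by \<open>u\<^sup>2\<close> and \<open>v\<^sup>2\<close>. (In the index type \<open>4\<close>, the numeral \<open>4\<close>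
  denotes the element \<open>0\<close>; the elements 1, 2, 3, 4 are pairwise distinct.)\<close>

definition base :: "cvec \<Rightarrow> complex ^ 2" where
  "base u = vector [u $ 2, u $ 4]"

text \<open>Component \<open>i j\<close> of the symmetric product of the coordinate one-forms with indices \<open>a\<close> and
  \<open>b\<close>, normalised so that \<open>\<theta>\<theta> = \<theta> \<otimes> \<theta>\<close>, as usual for line elements.\<close>

definition sym_prod :: "4 \<Rightarrow> 4 \<Rightarrow> 4 \<Rightarrow> 4 \<Rightarrow> complex" where
  "sym_prod a b i j =
     (of_bool (i = a) * of_bool (j = b) + of_bool (i = b) * of_bool (j = a)) / 2"

definition normal_metric :: "(complex ^ 2 \<Rightarrow> complex) \<Rightarrow> (complex ^ 2 \<Rightarrow> complex) \<Rightarrow> cvec \<Rightarrow> cmat" where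
  "normal_metric A D u = (\<chi> i j.
     A (base u) * sym_prod 1 4 i j
     + 1 / A (base u) * sym_prod 2 3 i j
     + (u $ 1 * pd 1 A (base u) - u $ 3 * pd 2 A (base u) / (A (base u))\<^sup>2 + D (base u))
         * sym_prod 2 4 i j)"

definition admissible ::
  "(complex ^ 2) set \<Rightarrow> (complex ^ 2 \<Rightarrow> complex) \<Rightarrow> (complex ^ 2 \<Rightarrow> complex) \<Rightarrow> bool" where
  "admissible W A D \<longleftrightarrow> open W \<and> holo_on A W \<and> holo_on D W \<and> (\<forall>z\<in>W. A z \<noteq> 0)"

end

(* Forward direction. Locally B is spanned by s and J s with I s = -i s; complete the isotropic
   frame s, J s by t, J t with I t = -i t. Let theta0 = g(s, .), theta1 = g(J s, .) and let
   kappa0, kappa1 be g(t, .), g(J t, .) divided by g(s, J t). Then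
     g = 2 (kappa1 theta0 - kappa0 theta1),
   while the parallel forms kappa0 ^ theta0, kappa1 ^ theta1 and kappa1 ^ theta0 + kappa0 ^ theta1
   are closed. The sum of B and an alpha-plane distribution is the kernel of some
   a theta0 + b theta1 with constant (a : b), and the bracket condition says that this kernel is
   integrable. Three values of (a : b) give theta0 = a du and theta1 = b dv with a/b a function of
   u and v. The first two closed forms then yield the remaining coordinates by the relative Poincare
   lemma, and closedness of the third one forces the du dv coefficient of g to be affine in them,
   with linear part determined by a/b.

   Conversely, for a normal metric the complex structures can be written down with B spanned by the
   coordinate fields of u^1 and v^1. *)

theory Submission
  imports Defs "HOL-Complex_Analysis.Cauchy_Integral_Formula"
begin

section \<open>Calculus of partial derivatives\<close>

text \<open>The bracket condition can be exploited one point of the conic at a time because null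
  triples are parametrised by (a : b) in such a way that \<alpha>I + \<beta>J + \<gamma>K sends both
  m and J m to multiples of a m + b J m, with factors that do not depend on the eigenvector m of I
  for -\<i>. Its kernel is therefore spanned by a s + b J s and a t + b J t, and the form to be
  integrated is g(a s + b J s, .) with constant a and b. Two of the three instances only provide
  integrating factors, whose common scale depends on the choice of s; the third compares them, which
  makes their ratio a function of u and v.

  The definition of holomorphy asks for no more than a complex-linear derivative at each point.
  Continuity of partial derivatives, second derivatives and limits are all drawn from Cauchy's
  formula on a circle in one coordinate direction. The Frobenius theorem and the Poincare lemma are
  reduced to integrals along rays that keep one distinguished coordinate fixed, so that the results
  stay holomorphic in that coordinate too.\<close>

lemma has_derivative_axis: "((\<lambda>t. x + axis i t :: complex ^ 'n) has_derivative (\<lambda>t. axis i t)) F"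
proof -
  have "linear (axis i :: complex \<Rightarrow> complex ^ 'n)"
    by (rule linearI) (auto simp: axis_def vec_eq_iff)
  then have "bounded_linear (axis i :: complex \<Rightarrow> complex ^ 'n)"
    by (rule linear_conv_bounded_linear[THEN iffD1])
  then show ?thesis
    by (auto intro!: derivative_eq_intros bounded_linear.has_derivative[of "axis i"])
qed

lemma norm_axis [simp]: "norm (axis i z :: complex ^ 'n) = norm z"
  by (simp add: norm_eq_sqrt_inner inner_axis_axis)

lemma axis_0 [simp]: "axis i 0 = (0 :: complex ^ 'n)"
  by (simp add: axis_def vec_eq_iff)

lemma continuous_on_axis [continuous_intros]:
  assumes "continuous_on S f" shows "continuous_on S (\<lambda>x. axis i (f x) :: complex ^ 'n)"
  unfolding axis_def by (rule continuous_on_vec_lambda, rename_tac j, case_tac "j = i") (auto intro: assms)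

lemma sum_axis: "(\<Sum>j\<in>UNIV. c j * (axis i t :: complex ^ 'n) $ j) = c i * t"
proof -
  have "(\<Sum>j\<in>UNIV. c j * (axis i t :: complex ^ 'n) $ j) = (\<Sum>j\<in>UNIV. if j = i then c j * t else 0)"
    by (rule sum.cong) (auto simp: axis_def)
  then show ?thesis by simp
qed

lemma field_derivative_along_axis:
  fixes f :: "complex ^ 'n \<Rightarrow> complex"
  assumes "(f has_derivative (\<lambda>v. \<Sum>j\<in>UNIV. c j * v $ j)) (at (x + axis i z))"
  shows "((\<lambda>t. f (x + axis i t)) has_field_derivative c i) (at z)"
proof -
  have "((\<lambda>t. f (x + axis i t)) has_derivative (\<lambda>t. \<Sum>j\<in>UNIV. c j * axis i t $ j)) (at z)"
    by (rule has_derivative_compose[OF has_derivative_axis]) (use assms in simp)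
  then show ?thesis by (simp add: sum_axis has_field_derivative_def)
qed

lemma pd_eqI:
  fixes f :: "complex ^ 'n \<Rightarrow> complex"
  assumes "(f has_derivative (\<lambda>v. \<Sum>j\<in>UNIV. c j * v $ j)) (at x)"
  shows "pd i f x = c i"
  unfolding pd_def using field_derivative_along_axis[of f c x i 0] assms
  by (auto intro: DERIV_imp_deriv)

text \<open>A derivative that commutes with complex scalars is determined by its values on the
  vectors \<open>axis j 1\<close>, and restriction to the coordinate lines identifies these values
  with \<open>pd j f x\<close>.\<close>

lemma holo_onD:
  fixes f :: "complex ^ 'n \<Rightarrow> complex"
  assumes "holo_on f S" "x \<in> S"
  shows "(f has_derivative (\<lambda>v. \<Sum>j\<in>UNIV. pd j f x * v $ j)) (at x)"
proof -
  obtain f' where f': "(f has_derivative f') (at x)" "\<And>c v. f' (c *s v) = c * f' v"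
    using assms unfolding holo_on_def by blast
  have eq: "f' = (\<lambda>v. \<Sum>j\<in>UNIV. f' (axis j 1) * v $ j)"
  proof
    fix v
    have "f' v = f' (\<Sum>j\<in>UNIV. v $ j *s axis j 1)" by (simp add: basis_expansion)
    also have "\<dots> = (\<Sum>j\<in>UNIV. f' (v $ j *s axis j 1))"
      using has_derivative_linear[OF f'(1)] by (rule linear_sum)
    finally show "f' v = (\<Sum>j\<in>UNIV. f' (axis j 1) * v $ j)" by (simp add: f'(2) mult.commute)
  qed
  from f'(1) have *: "(f has_derivative (\<lambda>v. \<Sum>j\<in>UNIV. f' (axis j 1) * v $ j)) (at x)"
    by (subst (asm) eq)
  show ?thesis using pd_eqI[OF *] * by simp
qed

lemma holo_onI:
  fixes f :: "complex ^ 'n \<Rightarrow> complex"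
  assumes "\<And>x. x \<in> S \<Longrightarrow> (f has_derivative (\<lambda>v. \<Sum>j\<in>UNIV. c x j * v $ j)) (at x)"
  shows "holo_on f S"
  unfolding holo_on_def
proof
  fix x assume "x \<in> S"
  from assms[OF this] show "\<exists>f'. (f has_derivative f') (at x) \<and> (\<forall>c v. f' (c *s v) = c * f' v)"
    by (intro exI[of _ "\<lambda>v. \<Sum>j\<in>UNIV. c x j * v $ j"])
       (auto simp: sum_distrib_left algebra_simps)
qed

lemma holo_on_subset: "holo_on f S \<Longrightarrow> T \<subseteq> S \<Longrightarrow> holo_on f T"
  unfolding holo_on_def by blast

lemma holo_on_cong:
  assumes "holo_on f S" "open S" "\<And>x. x \<in> S \<Longrightarrow> f x = g x"
  shows "holo_on g S"
proof (rule holo_onI)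
  fix x assume x: "x \<in> S"
  from holo_onD[OF assms(1) x]
  show "(g has_derivative (\<lambda>v. \<Sum>j\<in>UNIV. pd j f x * v $ j)) (at x)"
    by (rule has_derivative_transform_within_open[OF _ assms(2) x]) (use assms in auto)
qed

lemma pd_cong:
  assumes "open S" "x \<in> S" "\<And>y. y \<in> S \<Longrightarrow> f y = g y"
  shows "pd i f x = pd i g x"
  unfolding pd_def
proof (rule deriv_cong_ev)
  have "isCont (\<lambda>t::complex. x + axis i t) 0"
    by (rule has_derivative_continuous[OF has_derivative_axis])
  then have "\<forall>\<^sub>F t in nhds 0. x + axis i t \<in> S"
    using assms(1,2) by (auto simp: continuous_at_open eventually_nhds)
  then show "\<forall>\<^sub>F t in nhds 0. f (x + axis i t) = g (x + axis i t)"
    by eventually_elim (use assms in auto)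
qed auto

lemma holo_on_imp_continuous_on: "holo_on f S \<Longrightarrow> continuous_on S f"
  by (blast intro: continuous_at_imp_continuous_on has_derivative_continuous[OF holo_onD])

lemma holo_on_const [simp]: "holo_on (\<lambda>x. c) S" and pd_const [simp]: "pd i (\<lambda>x. c) x = 0"
proof -
  have "((\<lambda>x. c) has_derivative (\<lambda>v. \<Sum>j\<in>UNIV. 0 * v $ j)) (at x)" for x :: "complex ^ 'n"
    by simp
  then show "holo_on (\<lambda>x. c) S" by (rule holo_onI[where c="\<lambda>_ _. 0"])
  show "pd i (\<lambda>x. c) x = 0" by (simp add: pd_def)
qed

lemma holo_on_nth [simp]: "holo_on (\<lambda>x::complex ^ 'n. x $ k) S"
  and pd_nth: "pd i (\<lambda>x::complex ^ 'n. x $ k) x = of_bool (i = k)"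
proof -
  have *: "((\<lambda>x::complex ^ 'n. x $ k) has_derivative (\<lambda>v. \<Sum>j\<in>UNIV. of_bool (j = k) * v $ j)) (at x)" for x
    by (rule has_derivative_eq_rhs[OF bounded_linear.has_derivative[OF bounded_linear_vec_nth has_derivative_ident]]) auto
  then show "holo_on (\<lambda>x::complex ^ 'n. x $ k) S" by (rule holo_onI)
  show "pd i (\<lambda>x::complex ^ 'n. x $ k) x = of_bool (i = k)" by (rule pd_eqI[OF *])
qed

lemma
  assumes "holo_on f S" "holo_on g S"
  shows holo_on_add: "holo_on (\<lambda>x. f x + g x) S"
    and pd_add: "x \<in> S \<Longrightarrow> pd i (\<lambda>x. f x + g x) x = pd i f x + pd i g x"
    and holo_on_diff: "holo_on (\<lambda>x. f x - g x) S"
    and pd_diff: "x \<in> S \<Longrightarrow> pd i (\<lambda>x. f x - g x) x = pd i f x - pd i g x"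
    and holo_on_mult: "holo_on (\<lambda>x. f x * g x) S"
    and pd_mult: "x \<in> S \<Longrightarrow> pd i (\<lambda>x. f x * g x) x = f x * pd i g x + pd i f x * g x"
proof -
  have 1: "((\<lambda>x. f x + g x) has_derivative (\<lambda>v. \<Sum>j\<in>UNIV. (pd j f x + pd j g x) * v $ j)) (at x)"
    if "x \<in> S" for x
    using has_derivative_add[OF holo_onD[OF assms(1) that] holo_onD[OF assms(2) that]]
    by (simp add: sum.distrib algebra_simps)
  have 2: "((\<lambda>x. f x - g x) has_derivative (\<lambda>v. \<Sum>j\<in>UNIV. (pd j f x - pd j g x) * v $ j)) (at x)"
    if "x \<in> S" for x
    using has_derivative_diff[OF holo_onD[OF assms(1) that] holo_onD[OF assms(2) that]]
    by (simp add: sum_subtractf algebra_simps)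
  have 3: "((\<lambda>x. f x * g x) has_derivative (\<lambda>v. \<Sum>j\<in>UNIV. (f x * pd j g x + pd j f x * g x) * v $ j)) (at x)"
    if "x \<in> S" for x
    by (rule has_derivative_eq_rhs[OF has_derivative_mult[OF holo_onD[OF assms(1) that] holo_onD[OF assms(2) that]]])
       (simp add: sum.distrib sum_distrib_left sum_distrib_right algebra_simps)
  show "holo_on (\<lambda>x. f x + g x) S" by (rule holo_onI[OF 1])
  show "holo_on (\<lambda>x. f x - g x) S" by (rule holo_onI[OF 2])
  show "holo_on (\<lambda>x. f x * g x) S" by (rule holo_onI[OF 3])
  show "x \<in> S \<Longrightarrow> pd i (\<lambda>x. f x + g x) x = pd i f x + pd i g x" by (rule pd_eqI[OF 1])
  show "x \<in> S \<Longrightarrow> pd i (\<lambda>x. f x - g x) x = pd i f x - pd i g x" by (rule pd_eqI[OF 2])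
  show "x \<in> S \<Longrightarrow> pd i (\<lambda>x. f x * g x) x = f x * pd i g x + pd i f x * g x" by (rule pd_eqI[OF 3])
qed

lemma holo_on_minus: "holo_on f S \<Longrightarrow> holo_on (\<lambda>x. - f x) S"
  and pd_minus: "holo_on f S \<Longrightarrow> x \<in> S \<Longrightarrow> pd i (\<lambda>x. - f x) x = - pd i f x"
  using holo_on_diff[of "\<lambda>x. 0" S f] pd_diff[of "\<lambda>x. 0" S f x i] by auto

lemma
  assumes "holo_on f S"
  shows holo_on_cmult: "holo_on (\<lambda>x. c * f x) S"
    and pd_cmult: "x \<in> S \<Longrightarrow> pd i (\<lambda>x. c * f x) x = c * pd i f x"
  using holo_on_mult[of "\<lambda>x. c" S f] pd_mult[of "\<lambda>x. c" S f x i] assms by auto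

lemma
  assumes "\<And>a. a \<in> T \<Longrightarrow> holo_on (f a) S"
  shows holo_on_sum: "holo_on (\<lambda>x. \<Sum>a\<in>T. f a x) S"
    and pd_sum: "x \<in> S \<Longrightarrow> pd i (\<lambda>x. \<Sum>a\<in>T. f a x) x = (\<Sum>a\<in>T. pd i (f a) x)"
proof -
  have *: "((\<lambda>x. \<Sum>a\<in>T. f a x) has_derivative (\<lambda>v. \<Sum>j\<in>UNIV. (\<Sum>a\<in>T. pd j (f a) x) * v $ j)) (at x)"
    if "x \<in> S" for x
    by (rule has_derivative_eq_rhs[OF has_derivative_sum[of T f, OF holo_onD[OF assms that]]])
       (auto simp: sum_distrib_right intro: sum.swap)
  show "holo_on (\<lambda>x. \<Sum>a\<in>T. f a x) S" by (rule holo_onI[OF *])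
  show "x \<in> S \<Longrightarrow> pd i (\<lambda>x. \<Sum>a\<in>T. f a x) x = (\<Sum>a\<in>T. pd i (f a) x)" by (rule pd_eqI[OF *])
qed

lemma
  assumes "holo_on f S" "holo_on g S" "\<And>x. x \<in> S \<Longrightarrow> g x \<noteq> 0"
  shows holo_on_divide: "holo_on (\<lambda>x. f x / g x) S"
    and pd_divide: "x \<in> S \<Longrightarrow> pd i (\<lambda>x. f x / g x) x = (pd i f x * g x - f x * pd i g x) / (g x)\<^sup>2"
proof -
  have *: "((\<lambda>x. f x / g x) has_derivative
      (\<lambda>v. \<Sum>j\<in>UNIV. ((pd j f x * g x - f x * pd j g x) / (g x)\<^sup>2) * v $ j)) (at x)"
    if "x \<in> S" for x
    by (rule has_derivative_eq_rhs[OF has_derivative_divide'[OF holo_onD[OF assms(1) that] holo_onD[OF assms(2) that]]])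
       (use assms(3) that in \<open>auto simp: fun_eq_iff sum_distrib_left sum_distrib_right sum_divide_distrib sum_subtractf
          algebra_simps power2_eq_square diff_divide_distrib\<close>)
  show "holo_on (\<lambda>x. f x / g x) S" by (rule holo_onI[OF *])
  show "x \<in> S \<Longrightarrow> pd i (\<lambda>x. f x / g x) x = (pd i f x * g x - f x * pd i g x) / (g x)\<^sup>2"
    by (rule pd_eqI[OF *])
qed

lemma has_derivative_vecI:
  fixes f :: "'a::real_normed_vector \<Rightarrow> complex ^ 'n"
  assumes "\<And>k. ((\<lambda>x. f x $ k) has_derivative (\<lambda>v. f' v $ k)) (at x within S)"
  shows "(f has_derivative f') (at x within S)"
proof -
  have "((\<lambda>x. f x \<bullet> b) has_derivative (\<lambda>v. f' v \<bullet> b)) (at x within S)" if b: "b \<in> Basis" for b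
  proof -
    obtain k e where "b = axis k e" using b unfolding Basis_vec_def by auto
    then show ?thesis
      using bounded_linear.has_derivative[OF bounded_linear_inner_left assms] by (simp add: inner_axis)
  qed
  then show ?thesis using has_derivative_componentwise_within[of f] by blast
qed

lemma has_derivative_vec_holo:
  fixes \<phi> :: "complex ^ 'm \<Rightarrow> complex ^ 'n"
  assumes "\<And>k. holo_on (\<lambda>x. \<phi> x $ k) S" "x \<in> S"
  shows "(\<phi> has_derivative (\<lambda>v. \<chi> k. \<Sum>j\<in>UNIV. pd j (\<lambda>x. \<phi> x $ k) x * v $ j)) (at x)"
  by (rule has_derivative_vecI) (simp add: holo_onD[OF assms])

lemma
  fixes \<phi> :: "complex ^ 'm \<Rightarrow> complex ^ 'n"
  assumes f: "holo_on f T" and \<phi>: "\<And>k. holo_on (\<lambda>x. \<phi> x $ k) S" and sub: "\<And>x. x \<in> S \<Longrightarrow> \<phi> x \<in> T"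
  shows holo_on_compose: "holo_on (\<lambda>x. f (\<phi> x)) S"
    and pd_compose: "x \<in> S \<Longrightarrow>
      pd i (\<lambda>x. f (\<phi> x)) x = (\<Sum>k\<in>UNIV. pd k f (\<phi> x) * pd i (\<lambda>x. \<phi> x $ k) x)"
proof -
  have *: "((\<lambda>x. f (\<phi> x)) has_derivative
      (\<lambda>v. \<Sum>j\<in>UNIV. (\<Sum>k\<in>UNIV. pd k f (\<phi> x) * pd j (\<lambda>x. \<phi> x $ k) x) * v $ j)) (at x)" if x: "x \<in> S" for x
  proof (rule has_derivative_eq_rhs)
    show "((\<lambda>x. f (\<phi> x)) has_derivative (\<lambda>v. \<Sum>k\<in>UNIV. pd k f (\<phi> x) *
        (\<chi> k. \<Sum>j\<in>UNIV. pd j (\<lambda>x. \<phi> x $ k) x * v $ j) $ k)) (at x)"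
      by (rule has_derivative_compose[OF has_derivative_vec_holo[OF \<phi> x] holo_onD[OF f sub[OF x]]])
  qed (auto simp: fun_eq_iff sum_distrib_left sum_distrib_right mult.assoc intro: sum.swap)
  show "holo_on (\<lambda>x. f (\<phi> x)) S" by (rule holo_onI[OF *])
  show "x \<in> S \<Longrightarrow>
      pd i (\<lambda>x. f (\<phi> x)) x = (\<Sum>k\<in>UNIV. pd k f (\<phi> x) * pd i (\<lambda>x. \<phi> x $ k) x)" by (rule pd_eqI[OF *])
qed

section \<open>Cauchy integral for partial derivatives\<close>

text \<open>Cauchy's kernel 1 / (2 pi \<i> z^2) times dz/dt on the circle z = r e^(\<i>t):
  integrating boundary values against it gives the first derivative at the centre.\<close>

abbreviation cauchy_weight :: "real \<Rightarrow> real \<Rightarrow> complex" where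
  "cauchy_weight r t \<equiv> 1 / (2 * of_real pi * of_real r * cis t)"

text \<open>Cauchy's formula on the disc of radius \<open>r\<close> in direction \<open>i\<close>. A
  derivative becomes an average of values, so continuity, holomorphy and bounds of \<open>f\<close>
  pass on to its partial derivatives.\<close>

lemma pd_eq_circle_integral:
  fixes f :: "complex ^ 'n \<Rightarrow> complex"
  assumes f: "holo_on f V" and r: "r > 0" "cball x r \<subseteq> V"
  shows "pd i f x = integral {0..2 * pi} (\<lambda>t. f (x + axis i (of_real r * cis t)) * cauchy_weight r t)"
proof -
  define h where "h = (\<lambda>t. f (x + axis i t))"
  have h: "(h has_field_derivative pd i f (x + axis i z)) (at z)" if "z \<in> cball 0 r" for z
    unfolding h_def using that r(2)
    by (intro field_derivative_along_axis holo_onD[OF f] subsetD[OF r(2)]) (simp add: dist_norm)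
  have "h holomorphic_on cball 0 r" using h holomorphic_onI
    by (metis field_differentiable_at_within field_differentiable_def)
  then have *: "continuous_on (cball 0 r) h" "h holomorphic_on ball 0 r"
    by (rule holomorphic_on_imp_continuous_on, rule holomorphic_on_subset) auto
  have "pd i f x = 1 / (2 * of_real pi * \<i>) * contour_integral (circlepath 0 r) (\<lambda>u. h u / u\<^sup>2)"
    using Cauchy_derivative_integral_circlepath(2)[OF *, of 0] h[of 0] r(1)
    by (auto intro: DERIV_unique)
  also have "contour_integral (circlepath 0 r) (\<lambda>u. h u / u\<^sup>2) =
      integral {0..2 * pi} (\<lambda>t. h (of_real r * cis t) / (of_real r * cis t)\<^sup>2 * r * \<i> * cis t)"
    unfolding circlepath_def by (subst contour_integral_part_circlepath_eq) auto
  also have "1 / (2 * of_real pi * \<i>) * \<dots> = integral {0..2 * pi} (\<lambda>t. 1 / (2 * of_real pi * \<i>) *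
      (h (of_real r * cis t) / (of_real r * cis t)\<^sup>2 * r * \<i> * cis t))"
    by (rule integral_mult_right[symmetric])
  also have "\<dots> = integral {0..2 * pi} (\<lambda>t. h (of_real r * cis t) * cauchy_weight r t)"
    using r(1) by (intro Henstock_Kurzweil_Integration.integral_cong) (simp add: power2_eq_square field_simps)
  finally show ?thesis by (simp add: h_def)
qed

lemma continuous_on_cis_compose [continuous_intros]:
  "continuous_on S f \<Longrightarrow> continuous_on S (\<lambda>x. cis (f x))"
  unfolding cis_conv_exp by (intro continuous_intros)

lemma continuous_on_locally:
  fixes f :: "'a::t2_space \<Rightarrow> 'b::topological_space"
  assumes "\<And>x. x \<in> S \<Longrightarrow> \<exists>U. open U \<and> x \<in> U \<and> continuous_on (S \<inter> U) f"
  shows "continuous_on S f"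
  unfolding continuous_on_eq_continuous_within
proof
  fix x assume x: "x \<in> S"
  then obtain U where U: "open U" "x \<in> U" "continuous_on (S \<inter> U) f" using assms by blast
  have "continuous (at x within S \<inter> U) f" using U x by (simp add: continuous_on_eq_continuous_within)
  moreover have "at x within S \<inter> U = at x within S"
    by (rule at_within_nhd[of _ U]) (use U in auto)
  ultimately show "continuous (at x within S) f" by simp
qed

text \<open>With the radius fixed near a point, the integrand of the circle integral is jointly
  continuous in parameter, centre and angle. The parameter \<tau> is there for differentiation under
  the integral sign.\<close>

lemma continuous_on_pd_param:
  fixes k :: "'a::t2_space \<Rightarrow> complex ^ 'n \<Rightarrow> complex"
  assumes "open V" and cont: "continuous_on (T \<times> V) (\<lambda>(\<tau>, x). k \<tau> x)"
    and holo: "\<And>\<tau>. \<tau> \<in> T \<Longrightarrow> holo_on (k \<tau>) V"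
  shows "continuous_on (T \<times> V) (\<lambda>(\<tau>, x). pd i (k \<tau>) x)"
proof (rule continuous_on_locally)
  fix q assume "q \<in> T \<times> V"
  then obtain \<tau>0 x0 where q: "q = (\<tau>0, x0)" "\<tau>0 \<in> T" "x0 \<in> V" by auto
  obtain e where e: "e > 0" "cball x0 e \<subseteq> V"
    using \<open>open V\<close> q(3) open_contains_cball by blast
  define r where "r = e / 2"
  have r: "r > 0" and sub: "cball x r \<subseteq> V" if "x \<in> ball x0 r" for x
  proof -
    show "cball x r \<subseteq> V"
    proof
      fix y assume "y \<in> cball x r"
      then have "dist x0 y \<le> e"
        using that dist_triangle[of x0 y x] by (simp add: r_def)
      then show "y \<in> V" using e by auto
    qed
  qed (use e in \<open>simp add: r_def\<close>)
  have r0: "r > 0" using e by (simp add: r_def)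
  have "continuous_on (T \<times> ball x0 r) (\<lambda>q. integral (cbox 0 (2 * pi))
      (\<lambda>t. k (fst q) (snd q + axis i (of_real r * cis t)) * cauchy_weight r t))"
  proof (rule integral_continuous_on_param)
    have "continuous_on ((T \<times> ball x0 r) \<times> cbox 0 (2 * pi))
        (\<lambda>z. (\<lambda>(\<tau>, x). k \<tau> x) (fst (fst z), snd (fst z) + axis i (of_real r * cis (snd z))))"
    proof (rule continuous_on_compose2[OF cont])
      show "(\<lambda>z. (fst (fst z), snd (fst z) + axis i (of_real r * cis (snd z)))) `
          ((T \<times> ball x0 r) \<times> cbox 0 (2 * pi)) \<subseteq> T \<times> V"
        using r0 by (auto intro!: subsetD[OF sub] simp: dist_norm norm_mult)
    qed (intro continuous_intros)
    then show "continuous_on ((T \<times> ball x0 r) \<times> cbox 0 (2 * pi))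
        (\<lambda>(q, t). k (fst q) (snd q + axis i (of_real r * cis t)) * cauchy_weight r t)"
      using r0 by (auto simp: case_prod_unfold intro!: continuous_intros)
  qed
  then have "continuous_on (T \<times> ball x0 r) (\<lambda>(\<tau>, x). pd i (k \<tau>) x)"
    by (rule continuous_on_cong[THEN iffD1, rotated -1])
       (use pd_eq_circle_integral[OF holo r sub] in \<open>auto simp: case_prod_unfold\<close>)
  moreover have "(T \<times> V) \<inter> (UNIV \<times> ball x0 r) \<subseteq> T \<times> ball x0 r" by auto
  ultimately show "\<exists>U. open U \<and> q \<in> U \<and> continuous_on ((T \<times> V) \<inter> U) (\<lambda>(\<tau>, x). pd i (k \<tau>) x)"
    using r0 q by (intro exI[of _ "UNIV \<times> ball x0 r"]) (auto intro: open_Times continuous_on_subset)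
qed

lemma continuous_on_pd:
  fixes f :: "complex ^ 'n \<Rightarrow> complex"
  assumes "open V" "holo_on f V" shows "continuous_on V (pd i f)"
proof -
  have "continuous_on ({0} \<times> V) (\<lambda>z :: real \<times> (complex ^ 'n). f (snd z))"
    by (rule continuous_on_compose2[OF holo_on_imp_continuous_on[OF assms(2)]]) (auto intro: continuous_intros)
  then have *: "continuous_on ({0} \<times> V) (\<lambda>(\<tau>::real, x). pd i f x)"
    using assms by (intro continuous_on_pd_param) (simp_all add: case_prod_unfold)
  have "continuous_on V (\<lambda>x. (\<lambda>(\<tau>::real, x). pd i f x) (0, x))"
    by (rule continuous_on_compose2[OF *]) (auto intro: continuous_intros)
  then show ?thesis by simp
qed

text \<open>Differentiation under the integral sign. The jointly continuous derivative required by
  the Leibniz rule is supplied by holomorphy, through \<open>continuous_on_pd_param\<close>.\<close>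

lemma
  fixes k :: "real \<Rightarrow> complex ^ 'n \<Rightarrow> complex"
  assumes V: "open V" and cont: "continuous_on ({a..b} \<times> V) (\<lambda>(\<tau>, x). k \<tau> x)"
    and holo: "\<And>\<tau>. \<tau> \<in> {a..b} \<Longrightarrow> holo_on (k \<tau>) V"
  shows holo_on_integral: "holo_on (\<lambda>x. integral {a..b} (\<lambda>\<tau>. k \<tau> x)) V"
    and pd_integral: "x \<in> V \<Longrightarrow>
      pd i (\<lambda>x. integral {a..b} (\<lambda>\<tau>. k \<tau> x)) x = integral {a..b} (\<lambda>\<tau>. pd i (k \<tau>) x)"
proof -
  \<comment> \<open>The covector v \<mapsto> c * v_j as a bounded linear map, the form in which the
    Leibniz rule expects a derivative.\<close>
  define L :: "complex \<Rightarrow> 'n \<Rightarrow> (complex ^ 'n) \<Rightarrow>\<^sub>L complex"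
    where "L c j = blinfun_mult_right c o\<^sub>L Blinfun (\<lambda>v. v $ j)" for c j
  have L: "blinfun_apply (L c j) v = c * v $ j" for c j v
    by (simp add: L_def bounded_linear_Blinfun_apply bounded_linear_vec_nth)
  have Lsum: "blinfun_apply (\<Sum>j\<in>UNIV. L (d j) j) = (\<lambda>v. \<Sum>j\<in>UNIV. d j * v $ j)" for d
    by (simp add: fun_eq_iff blinfun.sum_left L)
  have *: "((\<lambda>x. integral {a..b} (\<lambda>\<tau>. k \<tau> x)) has_derivative
      (\<lambda>v. \<Sum>j\<in>UNIV. integral {a..b} (\<lambda>\<tau>. pd j (k \<tau>) x) * v $ j)) (at x)" if x: "x \<in> V" for x
  proof -
    obtain e where e: "e > 0" "ball x e \<subseteq> V" using V x open_contains_ball by blast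
    have c1: "continuous_on (ball x e \<times> cbox a b) (\<lambda>(x, t). pd j (k t) x)" for j
    proof -
      have "continuous_on (ball x e \<times> cbox a b) (\<lambda>z. (\<lambda>(\<tau>, x). pd j (k \<tau>) x) (snd z, fst z))"
        by (rule continuous_on_compose2[OF continuous_on_pd_param[OF V cont holo]])
           (use e in \<open>auto intro!: continuous_intros\<close>)
      then show ?thesis by (simp add: case_prod_unfold)
    qed
    have c2: "continuous_on (ball x e \<times> cbox a b) (\<lambda>(x, t). \<Sum>j\<in>UNIV. L (pd j (k t) x) j)"
      by (rule continuous_on_blinfun_componentwise)
         (simp add: case_prod_unfold blinfun.sum_left L, intro continuous_intros,
          use c1 in \<open>simp add: case_prod_unfold\<close>)
    have d: "((\<lambda>x. integral (cbox a b) (\<lambda>\<tau>. k \<tau> x)) has_derivative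
        integral (cbox a b) (\<lambda>t. \<Sum>j\<in>UNIV. L (pd j (k t) x) j)) (at x within ball x e)"
    proof (rule leibniz_rule[where f="\<lambda>x t. k t x" and fx="\<lambda>x t. \<Sum>j\<in>UNIV. L (pd j (k t) x) j" and U="ball x e"])
      fix y t assume "y \<in> ball x e" "t \<in> cbox a b"
      then show "((\<lambda>x. k t x) has_derivative blinfun_apply (\<Sum>j\<in>UNIV. L (pd j (k t) y) j)) (at y within ball x e)"
        unfolding Lsum using e
        by (intro has_derivative_at_withinI[OF holo_onD[OF holo]]) auto
    next
      fix y assume y: "y \<in> ball x e"
      have "continuous_on (cbox a b) (\<lambda>t. (\<lambda>(\<tau>, x). k \<tau> x) (t, y))"
        by (rule continuous_on_compose2[OF cont]) (use y e in \<open>auto intro!: continuous_intros\<close>)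
      then show "(\<lambda>\<tau>. k \<tau> y) integrable_on cbox a b"
        using integrable_continuous[of a b] by simp
    next
      show "continuous_on (ball x e \<times> cbox a b) (\<lambda>(x, t). \<Sum>j\<in>UNIV. L (pd j (k t) x) j)"
        by (rule c2)
    qed (use e in auto)
    have i1: "(\<lambda>t. \<Sum>j\<in>UNIV. L (pd j (k t) x) j) integrable_on cbox a b"
    proof (rule integrable_continuous)
      have "continuous_on (cbox a b) (\<lambda>t. (\<lambda>(x, t). \<Sum>j\<in>UNIV. L (pd j (k t) x) j) (x, t))"
        by (rule continuous_on_compose2[OF c2]) (use e in \<open>auto intro!: continuous_intros\<close>)
      then show "continuous_on (cbox a b) (\<lambda>t. \<Sum>j\<in>UNIV. L (pd j (k t) x) j)" by simp
    qed
    have i2: "(\<lambda>t. pd j (k t) x) integrable_on cbox a b" for j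
    proof (rule integrable_continuous)
      have "continuous_on (cbox a b) (\<lambda>t. (\<lambda>(x, t). pd j (k t) x) (x, t))"
        by (rule continuous_on_compose2[OF c1]) (use e in \<open>auto intro!: continuous_intros\<close>)
      then show "continuous_on (cbox a b) (\<lambda>t. pd j (k t) x)" by simp
    qed
    have "blinfun_apply (integral (cbox a b) (\<lambda>t. \<Sum>j\<in>UNIV. L (pd j (k t) x) j)) v =
        (\<Sum>j\<in>UNIV. integral {a..b} (\<lambda>\<tau>. pd j (k \<tau>) x) * v $ j)" for v
    proof -
      have "blinfun_apply (integral (cbox a b) (\<lambda>t. \<Sum>j\<in>UNIV. L (pd j (k t) x) j)) v =
          integral (cbox a b) (\<lambda>t. blinfun_apply (\<Sum>j\<in>UNIV. L (pd j (k t) x) j) v)"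
        by (rule blinfun_apply_integral[OF i1])
      also have "\<dots> = integral (cbox a b) (\<lambda>t. \<Sum>j\<in>UNIV. pd j (k t) x * v $ j)"
        by (simp add: Lsum)
      also have "\<dots> = (\<Sum>j\<in>UNIV. integral (cbox a b) (\<lambda>t. pd j (k t) x * v $ j))"
        using i2 by (intro integral_sum) (auto intro: integrable_on_mult_left)
      finally show ?thesis by simp
    qed
    then have "blinfun_apply (integral (cbox a b) (\<lambda>t. \<Sum>j\<in>UNIV. L (pd j (k t) x) j)) =
        (\<lambda>v. \<Sum>j\<in>UNIV. integral {a..b} (\<lambda>\<tau>. pd j (k \<tau>) x) * v $ j)" by (rule ext)
    then show ?thesis using d e by (simp add: at_within_open[of x "ball x e"])
  qed
  show "holo_on (\<lambda>x. integral {a..b} (\<lambda>\<tau>. k \<tau> x)) V" by (rule holo_onI[OF *])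
  show "x \<in> V \<Longrightarrow>
      pd i (\<lambda>x. integral {a..b} (\<lambda>\<tau>. k \<tau> x)) x = integral {a..b} (\<lambda>\<tau>. pd i (k \<tau>) x)" by (rule pd_eqI[OF *])
qed

section \<open>Second derivatives, uniform limits and local inverses of holomorphic
  functions\<close>

lemma holo_on_locally:
  assumes "\<And>x. x \<in> S \<Longrightarrow> \<exists>U. x \<in> U \<and> holo_on f U"
  shows "holo_on f S"
  using assms unfolding holo_on_def by blast

lemma open_contains_uniform_cball:
  fixes x0 :: "'a::metric_space"
  assumes "open V" "x0 \<in> V"
  obtains r where "r > 0" "\<And>x. x \<in> ball x0 r \<Longrightarrow> cball x r \<subseteq> V"
proof -
  obtain e where e: "e > 0" "cball x0 e \<subseteq> V"
    using assms open_contains_cball by blast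
  have "cball x (e / 2) \<subseteq> V" if "x \<in> ball x0 (e / 2)" for x
  proof
    fix y assume "y \<in> cball x (e / 2)"
    then have "dist x0 y \<le> e"
      using that dist_triangle[of x0 y x] by simp
    then show "y \<in> V" using e by auto
  qed
  then show thesis using that[of "e / 2"] e by auto
qed

lemma continuous_on_cauchy_kernel:
  fixes f :: "complex ^ 'n \<Rightarrow> complex"
  assumes "continuous_on V f" "r > 0" "\<And>x. x \<in> B \<Longrightarrow> cball x r \<subseteq> V"
  shows "continuous_on (T \<times> B) (\<lambda>(t, x). f (x + axis i (of_real r * cis t)) * cauchy_weight r t)"
proof -
  have "continuous_on (T \<times> B) (\<lambda>z. f (snd z + axis i (of_real r * cis (fst z))))"
    by (rule continuous_on_compose2[OF assms(1)])
       (use assms(2) in \<open>auto intro!: subsetD[OF assms(3)] continuous_intros simp: dist_norm norm_mult\<close>)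
  then show ?thesis
    using assms(2) by (auto simp: case_prod_unfold intro!: continuous_intros)
qed

lemma
  shows holo_on_translate: "holo_on f V \<Longrightarrow> (\<And>x. x \<in> S \<Longrightarrow> x + a \<in> V) \<Longrightarrow> holo_on (\<lambda>x. f (x + a)) S"
    and pd_translate: "pd i (\<lambda>x. f (x + a)) x = pd i f (x + a)"
proof -
  assume f: "holo_on f V" and V: "\<And>x. x \<in> S \<Longrightarrow> x + a \<in> V"
  have "holo_on (\<lambda>x. (x + a) $ k) S" for k
    using holo_on_add[of "\<lambda>x. x $ k" S "\<lambda>x. a $ k"] by simp
  from holo_on_compose[OF f this V] show "holo_on (\<lambda>x. f (x + a)) S" .
next
  show "pd i (\<lambda>x. f (x + a)) x = pd i f (x + a)"
    unfolding pd_def by (simp add: add.assoc add.commute[of a])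
qed

text \<open>Locally \<open>pd i f\<close> is a circle integral of translates of \<open>f\<close>,
  which can be differentiated under the integral. For commutation, the integral representing
  \<open>pd j f\<close> is differentiated in direction \<open>i\<close>; the outcome is the circle
  integral that represents the \<open>j\<close>-derivative of \<open>pd i f\<close>.\<close>

lemma
  fixes f :: "complex ^ 'n \<Rightarrow> complex"
  assumes V: "open V" and f: "holo_on f V"
  shows holo_on_pd: "holo_on (pd i f) V"
    and pd_commute: "x \<in> V \<Longrightarrow> pd i (pd j f) x = pd j (pd i f) x"
proof -
  define k where "k i r t x = f (x + axis i (of_real r * cis t)) * cauchy_weight r t" for i :: 'n and r t x
  have mem: "x + axis i (of_real r * cis t) \<in> V" if "r > 0" "cball x r \<subseteq> V" for x i r t
    using that by (auto intro!: subsetD[OF that(2)] simp: dist_norm norm_mult)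
  have k: "holo_on (k i r t) (ball x0 r)" if "r > 0" "\<And>x. x \<in> ball x0 r \<Longrightarrow> cball x r \<subseteq> V" for i r t x0
    unfolding k_def by (rule holo_on_mult[OF holo_on_translate[OF f] holo_on_const]) (use that mem in blast)
  have cont: "continuous_on ({0..2 * pi} \<times> ball x0 r) (\<lambda>(t, x). k i r t x)"
    if "r > 0" "\<And>x. x \<in> ball x0 r \<Longrightarrow> cball x r \<subseteq> V" for i r x0
    unfolding k_def by (rule continuous_on_cauchy_kernel[OF holo_on_imp_continuous_on[OF f] that])
  have eq: "pd i f x = integral {0..2 * pi} (\<lambda>t. k i r t x)" if "r > 0" "cball x r \<subseteq> V" for i x r
    unfolding k_def by (rule pd_eq_circle_integral[OF f that])
  have holo: "holo_on (pd i f) V" for i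
  proof (rule holo_on_locally)
    fix x0 assume "x0 \<in> V"
    then obtain r where r: "r > 0" "\<And>x. x \<in> ball x0 r \<Longrightarrow> cball x r \<subseteq> V"
      using open_contains_uniform_cball[OF V] by blast
    have "holo_on (pd i f) (ball x0 r)"
      by (rule holo_on_cong[OF holo_on_integral[OF open_ball cont[where i=i, OF r] k[where i=i, OF r]]]) (use r in \<open>auto simp: eq\<close>)
    then show "\<exists>U. x0 \<in> U \<and> holo_on (pd i f) U" using r(1) by (metis centre_in_ball)
  qed
  then show "holo_on (pd i f) V" .
  show "pd i (pd j f) x0 = pd j (pd i f) x0" if "x0 \<in> V" for x0
  proof -
    obtain r where r: "r > 0" "\<And>x. x \<in> ball x0 r \<Longrightarrow> cball x r \<subseteq> V"
      using open_contains_uniform_cball[OF V \<open>x0 \<in> V\<close>] by blast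
    have x0: "x0 \<in> ball x0 r" using r by simp
    have pk: "pd i (k j r t) x0 = pd i f (x0 + axis j (of_real r * cis t)) * cauchy_weight r t" for t
    proof -
      have h: "holo_on (\<lambda>x. f (x + axis j (of_real r * cis t))) (ball x0 r)"
        by (rule holo_on_translate[OF f]) (use r mem in blast)
      show ?thesis
        unfolding k_def pd_mult[OF h holo_on_const x0] pd_translate pd_const
        by (simp only: mult_zero_right add_0_left)
    qed
    have "pd i (pd j f) x0 = pd i (\<lambda>x. integral {0..2 * pi} (\<lambda>t. k j r t x)) x0"
      by (rule pd_cong[of "ball x0 r"]) (use r eq in auto)
    also have "\<dots> = integral {0..2 * pi} (\<lambda>t. pd i (k j r t) x0)"
      by (rule pd_integral[OF open_ball cont[OF r] k[OF r] x0])
    also have "\<dots> = integral {0..2 * pi} (\<lambda>t. pd i f (x0 + axis j (of_real r * cis t)) * cauchy_weight r t)"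
      by (simp only: pk)
    also have "\<dots> = pd j (pd i f) x0"
      by (rule pd_eq_circle_integral[OF holo r(1) r(2)[OF x0], symmetric])
    finally show ?thesis .
  qed
qed

text \<open>Weierstrass's theorem in several variables. Cauchy's formula bounds derivatives on a
  smaller ball by values, so the partial derivatives converge uniformly there, and the theorem on
  sequences with converging derivatives yields a complex-linear derivative of the limit.\<close>

lemma holo_on_uniform_limit:
  fixes f :: "nat \<Rightarrow> complex ^ 'n \<Rightarrow> complex"
  assumes V: "open V" and f: "\<And>n. holo_on (f n) V" and lim: "uniform_limit V f g sequentially"
  shows "holo_on g V"
proof (rule holo_on_locally)
  fix x0 assume x0: "x0 \<in> V"
  obtain r where r: "r > 0" "\<And>x. x \<in> ball x0 r \<Longrightarrow> cball x r \<subseteq> V"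
    using open_contains_uniform_cball[OF V x0] by blast
  have cg: "continuous_on V g"
    by (rule uniform_limit_theorem[OF _ lim]) (use f in \<open>auto intro: always_eventually holo_on_imp_continuous_on\<close>)
  define K where "K h i x t = h (x + axis i (of_real r * cis t)) * cauchy_weight r t"
    for h :: "complex ^ 'n \<Rightarrow> complex" and i x t
  have cK: "continuous_on {0..2 * pi} (K h i x)" if "continuous_on V h" "x \<in> ball x0 r" for h i x
  proof -
    have "continuous_on ({0..2 * pi} \<times> ball x0 r) (\<lambda>(t, x). h (x + axis i (of_real r * cis t)) * cauchy_weight r t)"
      by (rule continuous_on_cauchy_kernel[OF that(1) r])
    then have "continuous_on {0..2 * pi}
        ((\<lambda>(t, x). h (x + axis i (of_real r * cis t)) * cauchy_weight r t) \<circ> (\<lambda>t. (t, x)))"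
      by (intro continuous_on_compose continuous_intros) (rule continuous_on_subset, use that(2) in auto)
    then show ?thesis by (simp add: K_def o_def)
  qed
  define G where "G i x = integral {0..2 * pi} (K g i x)" for i x
  have est: "norm (pd i (f n) x - G i x) \<le> e / r"
    if x: "x \<in> ball x0 r" and e: "\<And>y. y \<in> V \<Longrightarrow> norm (f n y - g y) \<le> e" for x i n e
  proof -
    have "pd i (f n) x = integral {0..2 * pi} (K (f n) i x)"
      unfolding K_def by (rule pd_eq_circle_integral[OF f r(1) r(2)[OF x]])
    then have "pd i (f n) x - G i x = integral {0..2 * pi} (\<lambda>t. K (f n) i x t - K g i x t)"
      unfolding G_def
      by (simp add: integral_diff[OF integrable_continuous_real[OF cK[OF holo_on_imp_continuous_on[OF f] x]]
          integrable_continuous_real[OF cK[OF cg x]]])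
    also have "norm \<dots> \<le> e / (2 * pi * r) * (2 * pi - 0)"
    proof (rule integral_bound)
      show "continuous_on {0..2 * pi} (\<lambda>t. K (f n) i x t - K g i x t)"
        by (intro continuous_intros cK x cg holo_on_imp_continuous_on[OF f])
      fix t :: real
      have "x + axis i (of_real r * cis t) \<in> V"
        using r(1) by (intro subsetD[OF r(2)[OF x]]) (simp add: dist_norm norm_mult)
      from e[OF this] have "norm (K (f n) i x t - K g i x t) \<le> e * norm (cauchy_weight r t)"
        unfolding K_def left_diff_distrib[symmetric] norm_mult by (rule mult_right_mono) simp
      then show "norm (K (f n) i x t - K g i x t) \<le> e / (2 * pi * r)"
        using r(1) by (simp add: norm_divide norm_mult)
    qed simp
    finally show ?thesis by simp
  qed
  have "\<exists>h. \<forall>x\<in>ball x0 r. (\<lambda>n. f n x) \<longlonglongrightarrow> h x \<and>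
      (h has_derivative (\<lambda>v. \<Sum>j\<in>UNIV. G j x * v $ j)) (at x within ball x0 r)"
   proof (rule has_derivative_sequence[where f'="\<lambda>n x v. \<Sum>j\<in>UNIV. pd j (f n) x * v $ j" and ?x0.0=x0])
    show "(f n has_derivative (\<lambda>v. \<Sum>j\<in>UNIV. pd j (f n) x * v $ j)) (at x within ball x0 r)"
      if "x \<in> ball x0 r" for n x
      using r(1) r(2)[OF that] by (intro has_derivative_at_withinI[OF holo_onD[OF f]]) auto
    show "(\<lambda>n. f n x0) \<longlonglongrightarrow> g x0"
      by (rule tendsto_uniform_limitI[OF lim x0])
    fix e :: real assume e: "e > 0"
    \<comment> \<open>The estimate \<open>est\<close> costs a factor 1/r, and summing over the
      coordinates costs a factor \<open>CARD('n)\<close>.\<close>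
    define d where "d = e * r / real CARD('n)"
    have d: "d > 0" using e r by (simp add: d_def)
    have "\<forall>\<^sub>F n in sequentially. \<forall>y\<in>V. norm (f n y - g y) < d"
      using uniform_limitD[OF lim d] by (simp add: dist_norm)
    then show "\<forall>\<^sub>F n in sequentially. \<forall>x\<in>ball x0 r. \<forall>h.
        norm ((\<Sum>j\<in>UNIV. pd j (f n) x * h $ j) - (\<Sum>j\<in>UNIV. G j x * h $ j)) \<le> e * norm h"
    proof (eventually_elim, intro ballI allI)
      fix n x and h :: "complex ^ 'n"
      assume n: "\<forall>y\<in>V. norm (f n y - g y) < d" and x: "x \<in> ball x0 r"
      have "norm ((\<Sum>j\<in>UNIV. pd j (f n) x * h $ j) - (\<Sum>j\<in>UNIV. G j x * h $ j))
          = norm (\<Sum>j\<in>UNIV. (pd j (f n) x - G j x) * h $ j)"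
        by (simp add: sum_subtractf left_diff_distrib)
      also have "\<dots> \<le> (\<Sum>j\<in>UNIV. norm ((pd j (f n) x - G j x) * h $ j))"
        by (rule norm_sum)
      also have "\<dots> \<le> (\<Sum>j\<in>(UNIV :: 'n set). d / r * norm h)"
        unfolding norm_mult using n d r(1)
        by (intro sum_mono mult_mono est[OF x] Finite_Cartesian_Product.norm_nth_le) (auto intro: less_imp_le)
      also have "\<dots> = e * norm h" using r(1) by (simp add: d_def)
      finally show "norm ((\<Sum>j\<in>UNIV. pd j (f n) x * h $ j) - (\<Sum>j\<in>UNIV. G j x * h $ j)) \<le> e * norm h" .
    qed
  qed (use r in auto)
  then obtain h where h: "\<And>x. x \<in> ball x0 r \<Longrightarrow> (\<lambda>n. f n x) \<longlonglongrightarrow> h x"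
    "\<And>x. x \<in> ball x0 r \<Longrightarrow> (h has_derivative (\<lambda>v. \<Sum>j\<in>UNIV. G j x * v $ j)) (at x within ball x0 r)"
    by blast
  have "holo_on h (ball x0 r)"
    by (rule holo_onI[where c="\<lambda>x j. G j x"]) (use h(2) in \<open>simp add: at_within_open[of _ "ball x0 r"]\<close>)
  moreover have "h x = g x" if "x \<in> ball x0 r" for x
  proof -
    have "x \<in> V" using r(1) r(2)[OF that] by auto
    then show ?thesis by (intro LIMSEQ_unique[OF h(1)[OF that] tendsto_uniform_limitI[OF lim]])
  qed
  ultimately have "holo_on g (ball x0 r)" by (auto intro: holo_on_cong)
  then show "\<exists>U. x0 \<in> U \<and> holo_on g U" using r by (auto intro!: exI[of _ "ball x0 r"])
qed

text \<open>The real inverse function theorem applies because partial derivatives are continuous.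
  The derivative of the inverse is the inverse of a complex-linear bijection, hence complex-linear,
  so the inverse is holomorphic.\<close>

lemma holo_inverse_function:
  fixes \<phi> :: "complex ^ 'n \<Rightarrow> complex ^ 'n"
  assumes U: "open U" "x0 \<in> U" and \<phi>: "\<And>k. holo_on (\<lambda>x. \<phi> x $ k) U"
    and inv: "invertible (\<chi> k j. pd j (\<lambda>x. \<phi> x $ k) x0)"
  obtains V W g where "open V" "x0 \<in> V" "V \<subseteq> U" "open W" "\<phi> ` V = W" "g ` W = V"
    "\<And>x. x \<in> V \<Longrightarrow> g (\<phi> x) = x" "\<And>y. y \<in> W \<Longrightarrow> \<phi> (g y) = y"
    "\<And>k. holo_on (\<lambda>y. g y $ k) W"
proof -
  define J where "J x = (\<chi> k j. pd j (\<lambda>x. \<phi> x $ k) x)" for x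
  define \<phi>' where "\<phi>' x = Blinfun (\<lambda>v. J x *v v)" for x
  have \<phi>': "blinfun_apply (\<phi>' x) v = J x *v v" for x v
    by (simp add: \<phi>'_def bounded_linear_Blinfun_apply matrix_vector_mul_bounded_linear)
  have d: "(\<phi> has_derivative blinfun_apply (\<phi>' x)) (at x)" if "x \<in> U" for x
  proof -
    have "blinfun_apply (\<phi>' x) = (\<lambda>v. \<chi> k. \<Sum>j\<in>UNIV. pd j (\<lambda>x. \<phi> x $ k) x * v $ j)"
      by (simp add: fun_eq_iff \<phi>' J_def matrix_vector_mult_def)
    then show ?thesis using has_derivative_vec_holo[OF \<phi> that] by simp
  qed
  have c: "continuous_on U \<phi>'"
    by (rule continuous_on_blinfun_componentwise)
       (simp add: \<phi>' J_def matrix_vector_mult_def, intro continuous_intros continuous_on_pd[OF U(1) \<phi>])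
  obtain Ji where Ji: "Ji ** J x0 = mat 1"
    using inv unfolding J_def[symmetric] invertible_def by blast
  define iv where "iv = Blinfun (\<lambda>v. Ji *v v)"
  have iv: "blinfun_apply iv v = Ji *v v" for v
    by (simp add: iv_def bounded_linear_Blinfun_apply matrix_vector_mul_bounded_linear)
  have "iv o\<^sub>L \<phi>' x0 = id_blinfun"
    by (rule blinfun_eqI) (simp add: iv \<phi>' matrix_vector_mul_assoc Ji)
  from inverse_function_theorem[OF U(1) d c U(2) this]
  obtain V W g g' where *: "open V" "V \<subseteq> U" "x0 \<in> V" "open W" "\<phi> x0 \<in> W" "homeomorphism V W \<phi> g"
    "\<And>y. y \<in> W \<Longrightarrow> (g has_derivative (g' y)) (at y)"
    "\<And>y. y \<in> W \<Longrightarrow> g' y = inv (blinfun_apply (\<phi>' (g y)))"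
    "\<And>y. y \<in> W \<Longrightarrow> bij (blinfun_apply (\<phi>' (g y)))" by metis
  have h: "\<phi> ` V = W" "g ` W = V" "\<And>x. x \<in> V \<Longrightarrow> g (\<phi> x) = x" "\<And>y. y \<in> W \<Longrightarrow> \<phi> (g y) = y"
    using *(6) by (auto simp: homeomorphism_def)
  have "holo_on (\<lambda>y. g y $ k) W" for k
    unfolding holo_on_def
  proof
    fix y assume y: "y \<in> W"
    have "((\<lambda>y. g y $ k) has_derivative (\<lambda>v. g' y v $ k)) (at y)"
      by (rule bounded_linear.has_derivative[OF bounded_linear_vec_nth *(7)[OF y]])
    moreover have "g' y (c *s v) = c *s g' y v" for c v
    proof -
      have b: "bij (\<lambda>v. J (g y) *v v)" and g': "g' y = inv (\<lambda>v. J (g y) *v v)"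
        using *(8,9)[OF y] by (simp_all add: \<phi>'[abs_def])
      have "J (g y) *v (c *s g' y v) = c *s v"
        using surj_f_inv_f[OF bij_is_surj[OF b]] by (simp add: g' vector_scalar_commute)
      then show ?thesis using inv_f_eq[OF bij_is_inj[OF b]] g' by metis
    qed
    ultimately show "\<exists>f'. ((\<lambda>y. g y $ k) has_derivative f') (at y) \<and> (\<forall>c v. f' (c *s v) = c * f' v)"
      by (intro exI[of _ "\<lambda>v. g' y v $ k"]) simp
  qed
  with *(1,2,3,4) h show thesis by (intro that)
qed

section \<open>Codimension-one Frobenius theorem\<close>

definition upd :: "'n \<Rightarrow> complex \<Rightarrow> complex ^ 'n \<Rightarrow> complex ^ 'n" where
  "upd m z x = (\<chi> k. if k = m then z else x $ k)"

text \<open>Contracts a ball towards the line through \<open>p\<close> in direction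
  \<open>m\<close>. Coordinate \<open>m\<close> stays put and acts as a parameter, while the others
  run along a segment from \<open>p\<close>.\<close>

definition ray :: "'n \<Rightarrow> complex ^ 'n \<Rightarrow> real \<Rightarrow> complex ^ 'n \<Rightarrow> complex ^ 'n" where
  "ray m p t x = (\<chi> k. if k = m then x $ m else p $ k + of_real t * (x $ k - p $ k))"

lemma upd_nth [simp]: "upd m z x $ k = (if k = m then z else x $ k)"
  by (simp add: upd_def)

lemma ray_nth [simp]: "ray m p t x $ k = (if k = m then x $ m else p $ k + of_real t * (x $ k - p $ k))"
  by (simp add: ray_def)

lemma upd_axis: "upd m z x = upd m 0 x + axis m z"
  by (simp add: vec_eq_iff axis_def)

lemma upd_upd [simp]: "upd m z (upd m w x) = upd m z x"
  by (simp add: vec_eq_iff)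

lemma upd_nth_self [simp]: "upd m (x $ m) x = x"
  by (simp add: vec_eq_iff)

lemma dist_upd: "dist p (upd m z x) \<le> dist p x + norm (z - x $ m)"
proof -
  have "upd m z x = x + axis m (z - x $ m)" by (simp add: vec_eq_iff axis_def)
  then show ?thesis using norm_triangle_ineq4[of "p - x" "axis m (z - x $ m)"]
    by (simp add: dist_norm algebra_simps)
qed

lemma ray_1 [simp]: "ray m p 1 x = x"
  by (simp add: vec_eq_iff)

lemma dist_ray:
  assumes "t \<in> {0..1}" shows "dist p (ray m p t x) \<le> dist p x"
proof -
  have "norm ((p - ray m p t x) $ k) \<le> norm ((p - x) $ k)" for k
  proof (cases "k = m")
    case False
    then have "(p - ray m p t x) $ k = of_real t * (p - x) $ k" by (simp add: algebra_simps)
    then have "norm ((p - ray m p t x) $ k) = t * norm ((p - x) $ k)" using assms by (simp add: norm_mult)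
    then show ?thesis using assms mult_right_mono[of t 1 "norm ((p - x) $ k)"] by simp
  qed simp
  then show ?thesis unfolding dist_norm by (rule norm_le_componentwise_cart)
qed

lemma continuous_on_ray [continuous_intros]:
  assumes "continuous_on S f" "continuous_on S g"
  shows "continuous_on S (\<lambda>x. ray m p (f x) (g x))"
  unfolding ray_def
  by (rule continuous_on_vec_lambda, rename_tac k, case_tac "k = m") (auto intro!: continuous_intros assms)

lemma continuous_on_upd [continuous_intros]:
  assumes "continuous_on S f" "continuous_on S g"
  shows "continuous_on S (\<lambda>x. upd m (f x) (g x))"
  unfolding upd_def
  by (rule continuous_on_vec_lambda, rename_tac k, case_tac "k = m") (auto intro!: continuous_intros assms)

lemma
  fixes f :: "complex ^ 'n \<Rightarrow> complex"
  assumes f: "holo_on f U" and Z: "holo_on Z V" and sub: "\<And>x. x \<in> V \<Longrightarrow> upd m (Z x) x \<in> U"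
  shows holo_on_upd: "holo_on (\<lambda>x. f (upd m (Z x) x)) V"
    and pd_upd: "x \<in> V \<Longrightarrow> pd i (\<lambda>x. f (upd m (Z x) x)) x =
      pd m f (upd m (Z x) x) * pd i Z x + of_bool (i \<noteq> m) * pd i f (upd m (Z x) x)"
proof -
  have c: "(\<lambda>x. upd m (Z x) x $ k) = (if k = m then Z else (\<lambda>x. x $ k))" for k by auto
  have h: "holo_on (\<lambda>x. upd m (Z x) x $ k) V" for k unfolding c using Z by simp
  show "holo_on (\<lambda>x. f (upd m (Z x) x)) V" by (rule holo_on_compose[OF f h sub])
  assume x: "x \<in> V"
  have "pd i (\<lambda>x. f (upd m (Z x) x)) x = (\<Sum>k\<in>UNIV. pd k f (upd m (Z x) x) * pd i (\<lambda>x. upd m (Z x) x $ k) x)"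
    by (rule pd_compose[OF f h sub x])
  also have "\<dots> = (\<Sum>k\<in>UNIV. (if k = m then pd k f (upd m (Z x) x) * pd i Z x else 0) +
      (if k = i then of_bool (i \<noteq> m) * pd k f (upd m (Z x) x) else 0))"
    unfolding c by (rule sum.cong) (auto simp: pd_nth)
  finally show "pd i (\<lambda>x. f (upd m (Z x) x)) x =
      pd m f (upd m (Z x) x) * pd i Z x + of_bool (i \<noteq> m) * pd i f (upd m (Z x) x)"
    by (simp add: sum.distrib)
qed

lemma
  fixes f :: "complex ^ 'n \<Rightarrow> complex"
  assumes f: "holo_on f (ball p r)" and t: "t \<in> {0..1}"
  shows holo_on_ray: "holo_on (\<lambda>x. f (ray m p t x)) (ball p r)"
    and pd_ray: "x \<in> ball p r \<Longrightarrow> pd i (\<lambda>x. f (ray m p t x)) x = (if i = m then 1 else of_real t) * pd i f (ray m p t x)"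
proof -
  have sub: "ray m p t x \<in> ball p r" if "x \<in> ball p r" for x
    using dist_ray[OF t, of p m x] that by simp
  have c: "(\<lambda>x. ray m p t x $ k) = (if k = m then (\<lambda>x. x $ m) else (\<lambda>x. p $ k + of_real t * (x $ k - p $ k)))" for k
    by auto
  have h1: "holo_on (\<lambda>x. p $ k + of_real t * (x $ k - p $ k)) (ball p r)" for k
    by (intro holo_on_add holo_on_mult holo_on_diff) simp_all
  have h: "holo_on (\<lambda>x. ray m p t x $ k) (ball p r)" for k unfolding c using h1 by simp
  show "holo_on (\<lambda>x. f (ray m p t x)) (ball p r)" by (rule holo_on_compose[OF f h sub])
  assume x: "x \<in> ball p r"
  have d: "pd i (\<lambda>x. p $ k + of_real t * (x $ k - p $ k)) x = of_real t * of_bool (i = k)" for i k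
    using x by (simp add: pd_add[where S="ball p r"] pd_cmult[where S="ball p r"] pd_diff[where S="ball p r"]
        holo_on_cmult holo_on_diff pd_nth)
  have "pd i (\<lambda>x. f (ray m p t x)) x = (\<Sum>k\<in>UNIV. pd k f (ray m p t x) * pd i (\<lambda>x. ray m p t x $ k) x)"
    by (rule pd_compose[OF f h sub x])
  also have "\<dots> = (\<Sum>k\<in>UNIV. (if k = i then (if i = m then 1 else of_real t) * pd k f (ray m p t x) else 0))"
    unfolding c by (rule sum.cong) (auto simp: pd_nth d)
  finally show "pd i (\<lambda>x. f (ray m p t x)) x = (if i = m then 1 else of_real t) * pd i f (ray m p t x)"
    by simp
qed

lemma has_vector_derivative_along_ray:
  fixes f :: "complex ^ 'n \<Rightarrow> complex"
  assumes f: "holo_on f (ball p r)" and x: "x \<in> ball p r" and t: "t \<in> {0..1}"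
  shows "((\<lambda>t. f (ray m p t x)) has_vector_derivative
    (\<Sum>j\<in>UNIV. of_bool (j \<noteq> m) * (x $ j - p $ j) * pd j f (ray m p t x))) (at t within S)"
proof -
  have mem: "ray m p t x \<in> ball p r" using dist_ray[OF t, of p m x] x by simp
  have "((\<lambda>t. ray m p t x $ k) has_derivative (\<lambda>s. s *\<^sub>R (of_bool (k \<noteq> m) * (x $ k - p $ k)))) (at t within S)" for k
    by (cases "k = m") (auto intro!: derivative_eq_intros simp: scaleR_conv_of_real)
  then have "((\<lambda>t. ray m p t x) has_derivative (\<lambda>s. \<chi> k. s *\<^sub>R (of_bool (k \<noteq> m) * (x $ k - p $ k)))) (at t within S)"
    by (intro has_derivative_vecI) simp
  from has_derivative_compose[OF this holo_onD[OF f mem]] show ?thesis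
    unfolding has_vector_derivative_def
    by (rule has_derivative_eq_rhs, intro ext, unfold scaleR_sum_right, intro sum.cong)
       (simp_all add: scaleR_conv_of_real)
qed

lemma integrable_along_ray:
  fixes f :: "complex ^ 'n \<Rightarrow> complex"
  assumes f: "continuous_on (ball p r) f" and x: "x \<in> ball p r"
  shows "continuous_on {0..1} (\<lambda>t. f (ray m p t x))"
  by (rule continuous_on_compose2[OF f]) (use dist_ray[of _ p m x] x in \<open>force intro!: continuous_intros\<close>)+

text \<open>The Picard operator of the total differential equation
  \<open>\<partial>\<^sub>j Z = a\<^sub>j(x, Z)\<close> (\<open>j \<noteq> m\<close>) along the rays towards the \<open>m\<close>-axis through \<open>p\<close>, started at \<open>Z = x\<^sub>m\<close>.\<close>

definition picard ::
  "'n \<Rightarrow> complex ^ 'n \<Rightarrow> ('n \<Rightarrow> complex ^ 'n \<Rightarrow> complex) \<Rightarrow> (complex ^ 'n \<Rightarrow> complex) \<Rightarrow> complex ^ 'n \<Rightarrow> complex" where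
  "picard m p a Z x = x $ m + integral {0..1}
     (\<lambda>t. \<Sum>j\<in>UNIV. a j (upd m (Z (ray m p t x)) (ray m p t x)) * (x $ j - p $ j))"

text \<open>The bounds hold on the ball of radius \<open>R\<close>, while solutions live on the ball
  of radius \<open>r\<close>. The conditions \<open>r \<le> R / 2\<close> and
  \<open>CARD('n) * M * r \<le> R / 2\<close> keep the points \<open>upd m (Z x) x\<close> inside
  the larger ball; \<open>CARD('n) * M * r \<le> 1 / 2\<close> gives contraction by 1/2 and, later,
  the vanishing of the defect.\<close>

locale picard_setup =
  fixes m :: "'n::finite" and p :: "complex ^ 'n" and a :: "'n \<Rightarrow> complex ^ 'n \<Rightarrow> complex" and U R M r
  assumes a: "\<And>j. holo_on (a j) U" and cb: "cball p R \<subseteq> U"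
    and M: "\<And>j x. x \<in> cball p R \<Longrightarrow> norm (a j x) \<le> M"
    and M': "\<And>j x. x \<in> cball p R \<Longrightarrow> norm (pd m (a j) x) \<le> M"
    and r: "0 < r" "r \<le> R / 2" "real CARD('n) * M * r \<le> R / 2" "real CARD('n) * M * r \<le> 1 / 2"
begin

abbreviation "B \<equiv> ball p r"
definition "adm Z \<longleftrightarrow> holo_on Z B \<and> (\<forall>x\<in>B. norm (Z x - x $ m) \<le> R / 2)"
abbreviation "F Z x \<equiv> upd m (Z x) x"

lemma M_nonneg: "0 \<le> M"
proof -
  have "p \<in> cball p R" using r by simp
  from order_trans[OF norm_ge_zero M[OF this, of m]] show ?thesis .
qed

lemma mem_cball: "x \<in> B \<Longrightarrow> norm (z - x $ m) \<le> R / 2 \<Longrightarrow> upd m z x \<in> cball p R"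
  using dist_upd[of p m z x] r by simp

lemma F_mem: "adm Z \<Longrightarrow> x \<in> B \<Longrightarrow> F Z x \<in> cball p R" "adm Z \<Longrightarrow> x \<in> B \<Longrightarrow> F Z x \<in> U"
  using mem_cball[of x "Z x"] cb by (auto simp: adm_def)

lemma ray_mem: "t \<in> {0..1} \<Longrightarrow> x \<in> B \<Longrightarrow> ray m p t x \<in> B"
  using dist_ray[of t p m x] by simp

lemma nth_bound: "x \<in> B \<Longrightarrow> norm (x $ j - p $ j) \<le> r"
  using Finite_Cartesian_Product.norm_nth_le[of "x - p" j] by (simp add: dist_norm norm_minus_commute)

lemma sum_bound:
  fixes c :: "'n \<Rightarrow> complex"
  assumes "x \<in> B" "\<And>j. norm (c j) \<le> M * e" "0 \<le> e"
  shows "norm (\<Sum>j\<in>UNIV. c j * (x $ j - p $ j)) \<le> real CARD('n) * M * r * e"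
proof -
  have "norm (\<Sum>j\<in>UNIV. c j * (x $ j - p $ j)) \<le> (\<Sum>j\<in>(UNIV :: 'n set). (M * e) * r)"
    by (rule order_trans[OF norm_sum sum_mono])
       (auto simp: norm_mult intro!: mult_mono assms nth_bound M_nonneg mult_nonneg_nonneg)
  then show ?thesis by (simp add: mult_ac)
qed

lemma adm_holo: "adm Z \<Longrightarrow> holo_on (\<lambda>x. a j (F Z x)) B"
  by (rule holo_on_upd[OF a]) (auto simp: adm_def intro: F_mem(2)[unfolded adm_def])

lemma integrand_continuous:
  assumes "adm Z" "x \<in> B"
  shows "continuous_on {0..1} (\<lambda>t. \<Sum>j\<in>UNIV. a j (F Z (ray m p t x)) * (x $ j - p $ j))"
  by (intro continuous_intros integrable_along_ray[of p r "\<lambda>y. a _ (F Z y)"]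
      holo_on_imp_continuous_on[OF adm_holo] assms)

lemma integrand_continuous2:
  assumes "adm Z"
  shows "continuous_on ({0..1} \<times> B) (\<lambda>(t, x). \<Sum>j\<in>UNIV. a j (F Z (ray m p t x)) * (x $ j - p $ j))"
proof -
  have "continuous_on ({0..1} \<times> B) (\<lambda>z. a j (F Z (ray m p (fst z) (snd z))))" for j
    by (rule continuous_on_compose2[OF holo_on_imp_continuous_on[OF adm_holo[OF assms, of j]], of _ "\<lambda>z. ray m p (fst z) (snd z)"])
       (auto intro!: continuous_intros simp del: mem_ball intro: ray_mem)
  then show ?thesis by (auto simp: case_prod_unfold intro!: continuous_intros)
qed

lemma adm_picard: assumes "adm Z" shows "adm (picard m p a Z)"
  unfolding adm_def
proof
  have "holo_on (\<lambda>x. \<Sum>j\<in>UNIV. a j (F Z (ray m p t x)) * (x $ j - p $ j)) B" if "t \<in> {0..1}" for t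
    using that by (intro holo_on_sum holo_on_mult holo_on_diff holo_on_ray[of "\<lambda>y. a _ (F Z y)"] adm_holo assms) auto
  from holo_on_integral[OF open_ball integrand_continuous2[OF assms] this]
  show "holo_on (picard m p a Z) B" unfolding picard_def
    by (intro holo_on_add) auto
  show "\<forall>x\<in>B. norm (picard m p a Z x - x $ m) \<le> R / 2"
  proof
    fix x assume x: "x \<in> B"
    have "norm (integral {0..1} (\<lambda>t. \<Sum>j\<in>UNIV. a j (F Z (ray m p t x)) * (x $ j - p $ j))) \<le> R / 2 * (1 - 0)"
    proof (rule integral_bound)
      fix t :: real assume t: "t \<in> {0..1}"
      have "norm (\<Sum>j\<in>UNIV. a j (F Z (ray m p t x)) * (x $ j - p $ j)) \<le> real CARD('n) * M * r * 1"
        by (rule sum_bound[OF x]) (use M F_mem(1)[OF assms ray_mem[OF t x]] in auto)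
      then show "norm (\<Sum>j\<in>UNIV. a j (F Z (ray m p t x)) * (x $ j - p $ j)) \<le> R / 2" using r by simp
    qed (auto intro: integrand_continuous assms x)
    then show "norm (picard m p a Z x - x $ m) \<le> R / 2" by (simp add: picard_def)
  qed
qed

lemma a_lipschitz:
  assumes "x \<in> B" "norm (z - x $ m) \<le> R / 2" "norm (w - x $ m) \<le> R / 2"
  shows "norm (a j (upd m z x) - a j (upd m w x)) \<le> M * norm (z - w)"
proof (rule field_differentiable_bound[where S="cball (x $ m) (R / 2)" and f'="\<lambda>z. pd m (a j) (upd m z x)"])
  fix z assume "z \<in> cball (x $ m) (R / 2)"
  then have *: "upd m z x \<in> cball p R" using assms(1) by (intro mem_cball) (auto simp: dist_norm norm_minus_commute)
  then show "norm (pd m (a j) (upd m z x)) \<le> M" by (rule M')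
  have "(a j has_derivative (\<lambda>v. \<Sum>k\<in>UNIV. pd k (a j) (upd m z x) * v $ k)) (at (upd m 0 x + axis m z))"
    unfolding upd_axis[of m z x, symmetric] using * cb by (intro holo_onD[OF a]) blast
  from field_derivative_along_axis[OF this]
  have "((\<lambda>t. a j (upd m 0 x + axis m t)) has_field_derivative pd m (a j) (upd m z x)) (at z)" .
  then show "((\<lambda>z. a j (upd m z x)) has_field_derivative pd m (a j) (upd m z x)) (at z within cball (x $ m) (R / 2))"
    unfolding upd_axis[of m _ x, symmetric] by (rule has_field_derivative_at_within)
qed (use assms in \<open>auto simp: dist_norm norm_minus_commute\<close>)

text \<open>The coefficients are Lipschitz in the replaced coordinate with constant
  \<open>M\<close>, the coordinate differences are at most \<open>r\<close>, and the path has
  parameter length 1.\<close>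

lemma picard_contraction:
  assumes Z: "adm Z" and Z': "adm Z'" and e: "\<And>x. x \<in> B \<Longrightarrow> norm (Z x - Z' x) \<le> e" and x: "x \<in> B"
  shows "norm (picard m p a Z x - picard m p a Z' x) \<le> e / 2"
proof -
  have e0: "0 \<le> e" using e[OF x] norm_ge_zero order_trans by blast
  have "picard m p a Z x - picard m p a Z' x = integral {0..1} (\<lambda>t.
      (\<Sum>j\<in>UNIV. a j (F Z (ray m p t x)) * (x $ j - p $ j)) - (\<Sum>j\<in>UNIV. a j (F Z' (ray m p t x)) * (x $ j - p $ j)))"
    unfolding picard_def
    by (subst Henstock_Kurzweil_Integration.integral_diff) (auto intro!: integrable_continuous_real integrand_continuous assms)
  also have "norm \<dots> \<le> e / 2 * (1 - 0)"
  proof (rule integral_bound)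
    fix t :: real assume t: "t \<in> {0..1}"
    let ?y = "ray m p t x"
    have y: "?y \<in> B" by (rule ray_mem[OF t x])
    have "norm (Z ?y - ?y $ m) \<le> R / 2" "norm (Z' ?y - ?y $ m) \<le> R / 2"
      using Z Z' y unfolding adm_def by blast+
    then have "norm (a j (F Z ?y) - a j (F Z' ?y)) \<le> M * e" for j
      by (rule order_trans[OF a_lipschitz[OF y] mult_left_mono[OF e[OF y] M_nonneg]])
    from sum_bound[OF x this e0]
    have "norm (\<Sum>j\<in>UNIV. (a j (F Z ?y) - a j (F Z' ?y)) * (x $ j - p $ j)) \<le> real CARD('n) * M * r * e" .
    also have "\<dots> \<le> 1 / 2 * e" using r e0 by (intro mult_right_mono) auto
    finally show "norm ((\<Sum>j\<in>UNIV. a j (F Z ?y) * (x $ j - p $ j)) - (\<Sum>j\<in>UNIV. a j (F Z' ?y) * (x $ j - p $ j))) \<le> e / 2"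
      by (simp add: left_diff_distrib sum_subtractf)
  next
    show "continuous_on {0..1} (\<lambda>t. (\<Sum>j\<in>UNIV. a j (F Z (ray m p t x)) * (x $ j - p $ j)) -
        (\<Sum>j\<in>UNIV. a j (F Z' (ray m p t x)) * (x $ j - p $ j)))"
      by (intro continuous_on_diff integrand_continuous assms)
  qed simp
  finally show ?thesis by simp
qed

text \<open>The iterates start from the coordinate function x_m. Their increments decay
  geometrically, so the telescoping series converges uniformly, and both holomorphy and the fixed
  point equation survive in the limit.\<close>

lemma picard_fixpoint:
  obtains Z where "adm Z" "\<And>x. x \<in> B \<Longrightarrow> picard m p a Z x = Z x"
proof -
  define z where "z n = (picard m p a ^^ n) (\<lambda>x. x $ m)" for n
  have z_Suc: "z (Suc n) = picard m p a (z n)" for n by (simp add: z_def)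
  have R: "R \<ge> 0" using r by simp
  have adm: "adm (z n)" for n
  proof (induction n)
    case 0 then show ?case using R by (simp add: z_def adm_def)
  next
    case (Suc n) then show ?case by (simp add: z_Suc adm_picard)
  qed
  have step: "norm (z (Suc n) x - z n x) \<le> R / 2 * (1 / 2) ^ n" if "x \<in> B" for n x
    using that
  proof (induction n arbitrary: x)
    case 0 then show ?case using adm[of 1] by (simp add: adm_def z_def)
  next
    case (Suc n)
    show ?case using picard_contraction[OF adm adm Suc.IH Suc.prems] by (simp add: z_Suc)
  qed
  have "uniform_limit B (\<lambda>n x. \<Sum>i<n. z (Suc i) x - z i x) (\<lambda>x. suminf (\<lambda>i. z (Suc i) x - z i x)) sequentially"
  proof (rule Weierstrass_m_test)
    show "norm (z (Suc n) x - z n x) \<le> R / 2 * (1 / 2) ^ n" if "x \<in> B" for n x using that by (rule step)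
    show "summable (\<lambda>n. R / 2 * (1 / 2) ^ n)" by (intro summable_mult summable_geometric) simp
  qed
  moreover have telescope: "(\<Sum>i<n. z (Suc i) x - z i x) = z n x - x $ m" for n x
    using sum_lessThan_telescope[of "\<lambda>i. z i x" n] by (simp add: z_def)
  ultimately have "uniform_limit B (\<lambda>n x. z n x - x $ m) (\<lambda>x. suminf (\<lambda>i. z (Suc i) x - z i x)) sequentially"
    by (simp add: telescope)
  moreover have "uniform_limit B (\<lambda>n x. x $ m) (\<lambda>x. x $ m) sequentially" by (simp add: uniform_limit_iff)
  ultimately have "uniform_limit B (\<lambda>n x. z n x - x $ m + x $ m)
      (\<lambda>x. suminf (\<lambda>i. z (Suc i) x - z i x) + x $ m) sequentially" by (rule uniform_limit_add)
  then
  obtain Z where lim: "uniform_limit B z Z sequentially" by simp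
  have conv: "(\<lambda>n. z n x) \<longlonglongrightarrow> Z x" if "x \<in> B" for x
    by (rule tendsto_uniform_limitI[OF lim that])
  have Z: "adm Z"
    unfolding adm_def
  proof
    show "holo_on Z B" by (rule holo_on_uniform_limit[OF open_ball _ lim]) (use adm in \<open>simp add: adm_def\<close>)
    show "\<forall>x\<in>B. norm (Z x - x $ m) \<le> R / 2"
    proof
      fix x assume x: "x \<in> B"
      have "(\<lambda>n. norm (z n x - x $ m)) \<longlonglongrightarrow> norm (Z x - x $ m)" by (intro tendsto_intros conv x)
      then show "norm (Z x - x $ m) \<le> R / 2"
        by (rule tendsto_upperbound) (use adm x in \<open>auto simp: adm_def\<close>)
    qed
  qed
  have "picard m p a Z x = Z x" if x: "x \<in> B" for x
  proof -
    have "(\<lambda>n. z (Suc n) x) \<longlonglongrightarrow> picard m p a Z x"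
    proof (rule LIMSEQ_I)
      fix e :: real assume "e > 0"
      then have "\<forall>\<^sub>F n in sequentially. \<forall>y\<in>B. dist (z n y) (Z y) < e" by (rule uniform_limitD[OF lim])
      then obtain N where N: "\<And>n y. n \<ge> N \<Longrightarrow> y \<in> B \<Longrightarrow> dist (z n y) (Z y) < e"
        unfolding eventually_sequentially by blast
      have "norm (z (Suc n) x - picard m p a Z x) \<le> e / 2" if "n \<ge> N" for n
        unfolding z_Suc
        by (rule picard_contraction[OF adm Z _ x]) (use N[OF that] in \<open>auto simp: dist_norm intro: less_imp_le\<close>)
      then show "\<exists>N. \<forall>n\<ge>N. norm (z (Suc n) x - picard m p a Z x) < e"
        using \<open>e > 0\<close> by (intro exI[of _ N]) force
    qed
    then show ?thesis using LIMSEQ_unique LIMSEQ_Suc[OF conv[OF x]] by blast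
  qed
  with Z show thesis by (rule that)
qed

end

context picard_setup
begin

text \<open>Writing the fixed point equation at the point of parameter s on the ray and substituting
  t s for t gives Z = x_m plus the integral of \<open>H\<close> from 0 to s. Differentiating at s =
  1 yields the differential equation contracted with the radial field; the single components take
  the integrability condition.\<close>

lemma radial_equation:
  assumes Z: "adm Z" and fp: "\<And>x. x \<in> B \<Longrightarrow> picard m p a Z x = Z x" and am: "a m = (\<lambda>x. 0)" and x: "x \<in> B"
  shows "(\<Sum>j\<in>UNIV. of_bool (j \<noteq> m) * (x $ j - p $ j) * pd j Z x) = (\<Sum>j\<in>UNIV. a j (F Z x) * (x $ j - p $ j))"
proof -
  define H where "H t = (\<Sum>j\<in>UNIV. a j (F Z (ray m p t x)) * (x $ j - p $ j))" for t
  have cH: "continuous_on {0..1} H" unfolding H_def by (rule integrand_continuous[OF Z x])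
  define P where "P s = integral {0..s} H" for s
  have dP: "(P has_vector_derivative H s) (at s within {0..1})" if "s \<in> {0..1}" for s
    unfolding P_def by (rule integral_has_vector_derivative[OF cH that])
  have ray_ray: "ray m p t (ray m p s x) = ray m p (t * s) x" for s t
    by (simp add: vec_eq_iff mult_ac)
  have Zs: "Z (ray m p s x) = x $ m + P s" if s: "s \<in> {0..1}" for s
  proof -
    have "((\<lambda>t. P (t * s)) has_vector_derivative s *\<^sub>R H (t * s)) (at t within {0..1})" if t: "t \<in> {0..1}" for t
    proof -
      have "t * s \<in> {0..1}" using s t by (auto intro: mult_le_one)
      have img: "(\<lambda>t. t * s) ` {0..1} \<subseteq> {0..1}" using s by (auto intro: mult_le_one)
      have "((\<lambda>t. t * s) has_vector_derivative s) (at t within {0..1})"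
        by (auto intro!: derivative_eq_intros simp: has_vector_derivative_def)
      moreover have "(P has_vector_derivative H (t * s)) (at (t * s) within (\<lambda>t. t * s) ` {0..1})"
        by (rule has_vector_derivative_within_subset[OF dP img]) fact
      ultimately show ?thesis
        using vector_diff_chain_within[of "\<lambda>t. t * s" s t "{0..1}" P "H (t * s)"] by (simp add: o_def)
    qed
    then have "((\<lambda>t. s *\<^sub>R H (t * s)) has_integral P (1 * s) - P (0 * s)) {0..1}"
      by (intro fundamental_theorem_of_calculus) auto
    \<comment> \<open>The differences of the coordinates other than \<open>m\<close> scale by s
      along the ray. The one for \<open>m\<close> does not, but its coefficient is zero by
      \<open>am\<close>.\<close>
    moreover have "s *\<^sub>R H (t * s) =
        (\<Sum>j\<in>UNIV. a j (F Z (ray m p t (ray m p s x))) * (ray m p s x $ j - p $ j))" for t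
      unfolding H_def ray_ray scaleR_sum_right by (rule sum.cong) (auto simp: am scaleR_conv_of_real)
    ultimately have "integral {0..1} (\<lambda>t. \<Sum>j\<in>UNIV. a j (F Z (ray m p t (ray m p s x))) * (ray m p s x $ j - p $ j)) = P s"
      by (simp add: integral_unique P_def)
    then show ?thesis using fp[OF ray_mem[OF s x]] by (simp add: picard_def)
  qed
  have one: "(1::real) \<in> {0..1}" by simp
  have "((\<lambda>s. Z (ray m p s x)) has_vector_derivative H 1) (at 1 within {0..1})"
  proof (rule has_vector_derivative_transform[OF one])
    show "((\<lambda>s. x $ m + P s) has_vector_derivative H 1) (at 1 within {0..1})"
      using has_vector_derivative_add[OF has_vector_derivative_const dP[OF one]] by simp
  qed (simp add: Zs)
  moreover have "((\<lambda>s. Z (ray m p s x)) has_vector_derivative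
      (\<Sum>j\<in>UNIV. of_bool (j \<noteq> m) * (x $ j - p $ j) * pd j Z (ray m p 1 x))) (at 1 within {0..1})"
    using Z x by (intro has_vector_derivative_along_ray) (auto simp: adm_def)
  ultimately have "H 1 = (\<Sum>j\<in>UNIV. of_bool (j \<noteq> m) * (x $ j - p $ j) * pd j Z (ray m p 1 x))"
    by (rule vector_derivative_unique_within[rotated]) (auto simp: at_within_Icc_at_left)
  then show ?thesis by (simp add: H_def)
qed

text \<open>The defect \<open>W\<^sub>i = \<partial>\<^sub>i Z - a\<^sub>i(x, Z)\<close> satisfies, by integrability, the linear equation
  \<open>d/dt (t W\<^sub>i) = c t W\<^sub>i\<close> along each ray, so it vanishes.\<close>

lemma total_differential:
  assumes Z: "adm Z" and fp: "\<And>x. x \<in> B \<Longrightarrow> picard m p a Z x = Z x" and am: "a m = (\<lambda>x. 0)"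
    and integrable: "\<And>x i j. x \<in> U \<Longrightarrow> i \<noteq> m \<Longrightarrow> j \<noteq> m \<Longrightarrow>
      pd i (a j) x + a i x * pd m (a j) x = pd j (a i) x + a j x * pd m (a i) x"
    and x: "x \<in> B" and i: "i \<noteq> m"
  shows "pd i Z x = a i (F Z x)"
proof -
  have hZ: "holo_on Z B" using Z by (simp add: adm_def)
  \<comment> \<open>The factor makes \<open>W m\<close> vanish, so that sums may run over all
    coordinates.\<close>
  define W where "W j y = of_bool (j \<noteq> m) * (pd j Z y - a j (F Z y))" for j y
  have hW: "holo_on (W j) B" for j
    unfolding W_def by (intro holo_on_mult holo_on_diff holo_on_pd[OF open_ball hZ] adm_holo[OF Z]) simp
  \<comment> \<open>The radial equation says that the defect annihilates the radial field.
    Differentiating this identity in \<open>pE\<close> relates the \<open>k\<close>-th defect to the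
    derivatives of the others.\<close>
  have E: "(\<Sum>j\<in>UNIV. (y $ j - p $ j) * W j y) = 0" if "y \<in> B" for y
  proof -
    have "(\<Sum>j\<in>UNIV. (y $ j - p $ j) * W j y) =
        (\<Sum>j\<in>UNIV. of_bool (j \<noteq> m) * (y $ j - p $ j) * pd j Z y) - (\<Sum>j\<in>UNIV. a j (F Z y) * (y $ j - p $ j))"
      unfolding sum_subtractf[symmetric] by (rule sum.cong) (auto simp: W_def am algebra_simps)
    with radial_equation[OF Z fp am that] show ?thesis by simp
  qed
  have pE: "W k y + (\<Sum>j\<in>UNIV. (y $ j - p $ j) * pd k (W j) y) = 0" if y: "y \<in> B" for k y
  proof -
    have "0 = pd k (\<lambda>y. \<Sum>j\<in>UNIV. (y $ j - p $ j) * W j y) y"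
      by (subst pd_cong[OF open_ball y E]) auto
    also have "\<dots> = (\<Sum>j\<in>UNIV. pd k (\<lambda>y. (y $ j - p $ j) * W j y) y)"
      by (rule pd_sum[OF _ y]) (intro holo_on_mult holo_on_diff hW holo_on_nth holo_on_const)
    also have "\<dots> = (\<Sum>j\<in>UNIV. (y $ j - p $ j) * pd k (W j) y + (if j = k then W j y else 0))"
      by (rule sum.cong)
        (auto simp: pd_mult[OF holo_on_diff[OF holo_on_nth holo_on_const] hW y] pd_diff[OF holo_on_nth holo_on_const y] pd_nth)
    finally show ?thesis by (simp add: sum.distrib add.commute)
  qed
  have pW: "pd k (W j) y = pd k (pd j Z) y - (pd m (a j) (F Z y) * pd k Z y + pd k (a j) (F Z y))"
    if "y \<in> B" "j \<noteq> m" "k \<noteq> m" for j k y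
  proof -
    have "pd k (W j) y = pd k (\<lambda>y. pd j Z y - a j (F Z y)) y"
      using that by (intro arg_cong[of _ _ "\<lambda>f. pd k f y"]) (simp add: W_def fun_eq_iff)
    also have "\<dots> = pd k (pd j Z) y - pd k (\<lambda>y. a j (F Z y)) y"
      by (rule pd_diff[OF holo_on_pd[OF open_ball hZ] adm_holo[OF Z] that(1)])
    finally show ?thesis using pd_upd[OF a hZ F_mem(2)[OF Z] that(1), of k j] that by simp
  qed
  define c where "c y = (\<Sum>j\<in>UNIV. (y $ j - p $ j) * (of_bool (j \<noteq> m) * pd m (a j) (F Z y)))" for y
  have RW: "W i y + (\<Sum>j\<in>UNIV. (y $ j - p $ j) * (of_bool (j \<noteq> m) * pd j (W i) y)) = c y * W i y" if y: "y \<in> B" for y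
  proof -
    \<comment> \<open>Substituting \<partial>_j Z = a_j + W_j, the integrability condition cancels
      all terms free of the defect in \<partial>_j W_i - \<partial>_i W_j. Together with
      \<open>pE\<close> this leaves a linear equation along the ray.\<close>
    have key: "of_bool (j \<noteq> m) * pd j (W i) y = of_bool (j \<noteq> m) * pd i (W j) y
        + of_bool (j \<noteq> m) * pd m (a j) (F Z y) * W i y - pd m (a i) (F Z y) * W j y" for j
    proof (cases "j = m")
      case False
      have h: "W i y = pd i Z y - a i (F Z y)" "W j y = pd j Z y - a j (F Z y)"
        using i False by (simp_all add: W_def)
      have "pd j (W i) y = pd i (W j) y + pd m (a j) (F Z y) * W i y - pd m (a i) (F Z y) * W j y"
        using integrable[OF F_mem(2)[OF Z y] i False] pd_commute[OF open_ball hZ y, of i j]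
        unfolding pW[OF y False i] pW[OF y i False] h by (simp add: algebra_simps)
      with False show ?thesis by simp
    qed (simp add: W_def)
    have "(\<Sum>j\<in>UNIV. (y $ j - p $ j) * (of_bool (j \<noteq> m) * pd j (W i) y)) =
        (\<Sum>j\<in>UNIV. (y $ j - p $ j) * (of_bool (j \<noteq> m) * pd i (W j) y)) + c y * W i y
        - pd m (a i) (F Z y) * (\<Sum>j\<in>UNIV. (y $ j - p $ j) * W j y)"
      unfolding key c_def sum_distrib_left sum_distrib_right sum.distrib[symmetric] sum_subtractf[symmetric]
      by (intro sum.cong) (simp_all add: algebra_simps)
    moreover have "of_bool (j \<noteq> m) * pd i (W j) y = pd i (W j) y" for j
    proof (cases "j = m")
      case True
      then have "W j = (\<lambda>y. 0)" by (simp add: W_def fun_eq_iff)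
      then show ?thesis by simp
    qed simp
    ultimately show ?thesis using pE[OF y, of i] E[OF y] by (simp add: add_eq_0_iff2)
  qed
  define w where "w t = of_real t * W i (ray m p t x)" for t :: real
  define c' where "c' t = (\<Sum>j\<in>UNIV. (of_bool (j \<noteq> m) * pd m (a j) (F Z (ray m p t x))) * (x $ j - p $ j))" for t :: real
  have dw: "(w has_vector_derivative c' t * w t) (at t within {0..1})" if t: "t \<in> {0..1}" for t
  proof -
    let ?y = "ray m p t x"
    have y: "?y \<in> B" by (rule ray_mem[OF t x])
    have "((\<lambda>t. of_real t :: complex) has_vector_derivative 1) (at t within {0..1})"
      by (auto intro!: derivative_eq_intros simp: has_vector_derivative_def scaleR_conv_of_real)
    from has_vector_derivative_mult[OF this has_vector_derivative_along_ray[OF hW x t]]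
    have "(w has_vector_derivative of_real t * (\<Sum>j\<in>UNIV. of_bool (j \<noteq> m) * (x $ j - p $ j) * pd j (W i) ?y) + 1 * W i ?y) (at t within {0..1})"
      unfolding w_def .
    moreover have "of_real t * (\<Sum>j\<in>UNIV. of_bool (j \<noteq> m) * (x $ j - p $ j) * pd j (W i) ?y) =
        (\<Sum>j\<in>UNIV. (?y $ j - p $ j) * (of_bool (j \<noteq> m) * pd j (W i) ?y))"
      unfolding sum_distrib_left by (rule sum.cong) auto
    moreover have "c ?y = of_real t * c' t"
      unfolding c_def c'_def sum_distrib_left by (rule sum.cong) auto
    ultimately show ?thesis using RW[OF y] by (simp add: w_def mult_ac add.commute)
  qed
  have c': "norm (c' t) \<le> 1 / 2" if t: "t \<in> {0..1}" for t
  proof -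
    have "norm (c' t) \<le> real CARD('n) * M * r * 1"
      unfolding c'_def using M_nonneg M' F_mem(1)[OF Z ray_mem[OF t x]]
      by (intro sum_bound[OF x]) (auto simp: norm_mult)
    then show ?thesis using r by simp
  qed
  have cw: "continuous_on {0..1} w"
    by (rule continuous_on_vector_derivative) (rule dw)
  \<comment> \<open>Uniqueness for the linear equation by a maximum argument: w(0) = 0 and |c'|
    \<le> 1/2 on the unit interval, so the mean value inequality bounds the maximum of |w| by half
    of itself.\<close>
  have "\<exists>s\<in>{0..1}. \<forall>t\<in>{0..1}. norm (w t) \<le> norm (w s)"
    by (rule continuous_attains_sup) (auto intro!: continuous_intros cw)
  then obtain s where s: "s \<in> {0..1}" "\<And>t. t \<in> {0..1} \<Longrightarrow> norm (w t) \<le> norm (w s)" by blast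
  have "norm (w s - w 0) \<le> (norm (w s) / 2) * norm (s - 0)"
  proof (rule differentiable_bound[where S="{0..1}" and f'="\<lambda>t h. h *\<^sub>R (c' t * w t)"])
    fix t :: real assume t: "t \<in> {0..1}"
    show "(w has_derivative (\<lambda>h. h *\<^sub>R (c' t * w t))) (at t within {0..1})"
      using dw[OF t] by (simp add: has_vector_derivative_def)
    have "norm (c' t * w t) \<le> 1 / 2 * norm (w s)"
      unfolding norm_mult by (rule mult_mono) (use c'[OF t] s(2)[OF t] in auto)
    then have "norm (h *\<^sub>R (c' t * w t)) \<le> norm (w s) / 2 * norm h" for h
      using mult_left_mono[of "norm (c' t * w t)" "norm (w s) / 2" "\<bar>h\<bar>"]
      by (simp only: norm_scaleR real_norm_def mult.commute[of _ "\<bar>h\<bar>"] abs_ge_zero)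
    then show "onorm (\<lambda>h. h *\<^sub>R (c' t * w t)) \<le> norm (w s) / 2" by (rule onorm_le)
  qed (use s in auto)
  also have "\<dots> \<le> norm (w s) / 2" using s(1) mult_left_mono[of "\<bar>s\<bar>" 1 "norm (w s) / 2"] by simp
  finally have "norm (w s) \<le> 0" by (simp add: w_def[of 0])
  with s(2)[of 1] have "w 1 = 0" by simp
  then show ?thesis using i by (simp add: w_def W_def)
qed

end

text \<open>For each value of x_m the function Z describes an integral hypersurface as a graph over
  the other coordinates. The normalisation \<open>pd m Z p = 1\<close> makes it possible to recover
  x_m, the label of the hypersurface, from a point on it.\<close>

lemma total_differential_equation:
  fixes a :: "'n::finite \<Rightarrow> complex ^ 'n \<Rightarrow> complex"
  assumes U: "open U" "p \<in> U" and a: "\<And>j. holo_on (a j) U" and am: "a m = (\<lambda>x. 0)"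
    and integrable: "\<And>x i j. x \<in> U \<Longrightarrow> i \<noteq> m \<Longrightarrow> j \<noteq> m \<Longrightarrow>
      pd i (a j) x + a i x * pd m (a j) x = pd j (a i) x + a j x * pd m (a i) x"
  obtains Z r where "r > 0" "holo_on Z (ball p r)" "\<And>x. x \<in> ball p r \<Longrightarrow> upd m (Z x) x \<in> U"
    "\<And>x i. x \<in> ball p r \<Longrightarrow> i \<noteq> m \<Longrightarrow> pd i Z x = a i (upd m (Z x) x)" "pd m Z p = 1" "Z p = p $ m"
proof -
  obtain R where R: "R > 0" "cball p R \<subseteq> U" using U open_contains_cball by blast
  have "\<exists>M. \<forall>x\<in>cball p R. norm (f x) \<le> M" if "continuous_on U f" for f :: "complex ^ 'n \<Rightarrow> complex"
  proof -
    have "compact (f ` cball p R)" using that R by (intro compact_continuous_image) (auto intro: continuous_on_subset)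
    then show ?thesis using compact_imp_bounded bounded_iff by (metis imageI)
  qed
  then have "\<exists>M. \<forall>x\<in>cball p R. norm (a j x) \<le> M" "\<exists>M. \<forall>x\<in>cball p R. norm (pd m (a j) x) \<le> M" for j
    using holo_on_imp_continuous_on[OF a] continuous_on_pd[OF U(1) a] by blast+
  then obtain M1 M2 where M12: "\<And>j x. x \<in> cball p R \<Longrightarrow> norm (a j x) \<le> M1 j"
    "\<And>j x. x \<in> cball p R \<Longrightarrow> norm (pd m (a j) x) \<le> M2 j" by metis
  define M where "M = Max (range M1 \<union> range M2)"
  have M: "norm (a j x) \<le> M" "norm (pd m (a j) x) \<le> M" if "x \<in> cball p R" for j x
    using M12[OF that, of j] unfolding M_def by (force intro: order_trans Max_ge)+
  \<comment> \<open>Using \<open>\<bar>M\<bar> + 1\<close> keeps the denominator positive; the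
    minimum in the numerator accommodates both smallness conditions on
    \<open>CARD('n) * M * r\<close>.\<close>
  define r where "r = min (R / 2) (min (R / 2) (1 / 2) / (real CARD('n) * (\<bar>M\<bar> + 1)))"
  have K: "real CARD('n) * (\<bar>M\<bar> + 1) > 0" by simp
  have r: "r > 0" "r \<le> R / 2" unfolding r_def using R by auto
  have "real CARD('n) * M * r \<le> real CARD('n) * (\<bar>M\<bar> + 1) * r"
    using r by (intro mult_right_mono mult_left_mono) auto
  also have "\<dots> \<le> min (R / 2) (1 / 2)"
    unfolding mult.commute[of _ r] pos_le_divide_eq[OF K, symmetric] by (simp add: r_def)
  finally have r': "real CARD('n) * M * r \<le> R / 2" "real CARD('n) * M * r \<le> 1 / 2" by auto
  interpret picard_setup m p a U R M r
    by unfold_locales (use a R M r r' in auto)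
  obtain Z where Z: "adm Z" "\<And>x. x \<in> B \<Longrightarrow> picard m p a Z x = Z x" using picard_fixpoint by blast
  \<comment> \<open>On the line through \<open>p\<close> in direction \<open>m\<close> the Picard
    integrand vanishes: every other coordinate difference is zero, and \<open>a m\<close> is
    zero.\<close>
  have axis: "Z (p + axis m t) = p $ m + t" if "norm t < r" for t
  proof -
    have "p + axis m t \<in> B" using that by (simp add: dist_norm)
    moreover have "(\<Sum>j\<in>UNIV. a j y * ((p + axis m t) $ j - p $ j)) = 0" for y
      by (rule sum.neutral) (auto simp: am axis_def)
    ultimately show ?thesis using Z(2)[of "p + axis m t"] by (simp add: picard_def)
  qed
  have "pd m Z p = deriv (\<lambda>t. p $ m + t) 0"
    unfolding pd_def
  proof (rule deriv_cong_ev)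
    show "\<forall>\<^sub>F t in nhds 0. Z (p + axis m t) = p $ m + t"
      unfolding eventually_nhds_metric using axis r by (auto simp: dist_norm)
  qed simp
  then have "pd m Z p = 1" by simp
  moreover have "Z p = p $ m" using axis[of 0] r by simp
  ultimately show thesis
    using that[of r Z] r Z F_mem(2)[OF Z(1)] total_differential[OF Z am integrable] by (auto simp: adm_def)
qed

section \<open>Replacing one coordinate by a given function\<close>

lemma invertible_upd:
  fixes w :: "complex ^ 'n \<Rightarrow> complex"
  assumes "pd m w x \<noteq> 0"
  shows "invertible (\<chi> k j. pd j (\<lambda>x. upd m (w x) x $ k) x)"
  unfolding invertible_left_inverse matrix_left_invertible_ker
proof (intro allI impI)
  fix v assume v: "(\<chi> k j. pd j (\<lambda>x. upd m (w x) x $ k) x) *v v = 0"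
  have c: "(\<lambda>x. upd m (w x) x $ k) = (if k = m then w else (\<lambda>x. x $ k))" for k by auto
  have row: "(\<Sum>j\<in>UNIV. pd j (if k = m then w else (\<lambda>x. x $ k)) x * v $ j) = 0" for k
    using arg_cong[OF v, of "\<lambda>z. z $ k"] by (simp only: matrix_vector_mult_def vec_lambda_beta c zero_index)
  have 1: "v $ k = 0" if "k \<noteq> m" for k
  proof -
    have "(\<Sum>j\<in>UNIV. of_bool (j = k) * v $ j) = 0"
      using row[of k] that by (simp add: pd_nth)
    then show ?thesis by simp
  qed
  have "(\<Sum>j\<in>UNIV. pd j w x * v $ j) = (\<Sum>j\<in>UNIV. if j = m then pd m w x * v $ m else 0)"
    by (rule sum.cong) (use 1 in auto)
  with row[of m] assms have "v $ m = 0" by simp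
  with 1 show "v = 0" by (metis vec_eq_iff zero_index)
qed

text \<open>The map that puts \<open>w\<close> in place of coordinate \<open>m\<close> has a
  Jacobian that is the identity outside row \<open>m\<close>, with \<open>pd m w\<close> on the
  diagonal of that row. Its inverse also changes coordinate \<open>m\<close> only and is therefore
  recorded by one scalar function \<open>z\<close>; the last conclusion is implicit differentiation
  of w(y with y_m replaced by z) = y_m.\<close>

lemma upd_inverse_function:
  fixes w :: "complex ^ 'n \<Rightarrow> complex"
  assumes "open U" "p \<in> U" and w: "holo_on w U" and "pd m w p \<noteq> 0"
  obtains V W z where "open V" "p \<in> V" "V \<subseteq> U" "open W" "(\<lambda>x. upd m (w x) x) ` V = W"
    "holo_on z W" "\<And>y. y \<in> W \<Longrightarrow> upd m (z y) y \<in> V" "\<And>y. y \<in> W \<Longrightarrow> w (upd m (z y) y) = y $ m"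
    "\<And>x. x \<in> V \<Longrightarrow> z (upd m (w x) x) = x $ m"
    "\<And>y i. y \<in> W \<Longrightarrow> pd m w (upd m (z y) y) * pd i z y + of_bool (i \<noteq> m) * pd i w (upd m (z y) y) = of_bool (i = m)"
proof -
  have c: "(\<lambda>x. upd m (w x) x $ k) = (if k = m then w else (\<lambda>x. x $ k))" for k by auto
  have h: "holo_on (\<lambda>x. upd m (w x) x $ k) U" for k unfolding c using w by simp
  obtain V W g where *: "open V" "p \<in> V" "V \<subseteq> U" "open W" "(\<lambda>x. upd m (w x) x) ` V = W" "g ` W = V"
    "\<And>x. x \<in> V \<Longrightarrow> g (upd m (w x) x) = x" "\<And>y. y \<in> W \<Longrightarrow> upd m (w (g y)) (g y) = y"
    "\<And>k. holo_on (\<lambda>y. g y $ k) W"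
    by (rule holo_inverse_function[OF assms(1,2) h invertible_upd[of m w p, OF assms(4)]]) (rule that)
  define z where "z y = g y $ m" for y
  have g: "upd m (z y) y = g y" if "y \<in> W" for y
  proof -
    have "upd m (z y) (upd m (w (g y)) (g y)) = g y" by (simp add: z_def)
    then show ?thesis using *(8)[OF that] by simp
  qed
  have mem: "upd m (z y) y \<in> V" if "y \<in> W" for y using g[OF that] *(6) that by auto
  have wz: "w (upd m (z y) y) = y $ m" if "y \<in> W" for y
    using arg_cong[OF *(8)[OF that], of "\<lambda>v. v $ m"] g[OF that] by simp
  have z: "holo_on z W" unfolding z_def by (rule *(9))
  have "pd m w (upd m (z y) y) * pd i z y + of_bool (i \<noteq> m) * pd i w (upd m (z y) y) = of_bool (i = m)"
    if y: "y \<in> W" for y i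
  proof -
    have "pd i (\<lambda>y. w (upd m (z y) y)) y = pd i (\<lambda>y. y $ m) y"
      by (rule pd_cong[OF *(4) y wz])
    moreover have "upd m (z y) y \<in> U" if "y \<in> W" for y using mem[OF that] *(3) by blast
    ultimately show ?thesis using pd_upd[OF w z _ y, of m i] by (simp add: pd_nth)
  qed
  with * mem wz z show thesis by (intro that[of V W z]) (auto simp: z_def)
qed

lemma open_nonzero_set:
  fixes f :: "complex ^ 'n \<Rightarrow> complex"
  assumes "open U" "holo_on f U" shows "open {x \<in> U. f x \<noteq> 0}"
proof -
  have "open (U \<inter> f -` (- {0}))"
    by (rule continuous_open_preimage[OF holo_on_imp_continuous_on]) (use assms in auto)
  moreover have "U \<inter> f -` (- {0}) = {x \<in> U. f x \<noteq> 0}" by auto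
  ultimately show ?thesis by simp
qed

text \<open>Where \<theta>_m is nonzero, the kernel of \<theta> is given by dx_m = \<Sum> a_j dx_j
  with a_j = -\<theta>_j / \<theta>_m, and \<theta> \<and> d\<theta> = 0 is the compatibility
  condition for the total differential equation. Solving Z for its label gives a function u that is
  constant on the integral hypersurfaces, so \<theta> is a multiple of du.\<close>

theorem frobenius_one_form:
  fixes \<theta> :: "'n::finite \<Rightarrow> complex ^ 'n \<Rightarrow> complex"
  assumes U: "open U" "p \<in> U" and \<theta>: "\<And>j. holo_on (\<theta> j) U" and nz: "\<theta> m p \<noteq> 0"
    and int: "\<And>x i j k. x \<in> U \<Longrightarrow> \<theta> i x * (pd j (\<theta> k) x - pd k (\<theta> j) x)
      + \<theta> j x * (pd k (\<theta> i) x - pd i (\<theta> k) x) + \<theta> k x * (pd i (\<theta> j) x - pd j (\<theta> i) x) = 0"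
  obtains V u f where "open V" "p \<in> V" "V \<subseteq> U" "holo_on u V" "holo_on f V"
    "\<And>x. x \<in> V \<Longrightarrow> f x \<noteq> 0" "\<And>x. x \<in> V \<Longrightarrow> pd m u x \<noteq> 0" "\<And>x i. x \<in> V \<Longrightarrow> \<theta> i x = f x * pd i u x"
proof -
  define U' where "U' = {x \<in> U. \<theta> m x \<noteq> 0}"
  have U': "open U'" "p \<in> U'" "U' \<subseteq> U"
    using open_nonzero_set[OF U(1) \<theta>] U(2) nz by (auto simp: U'_def)
  define a where "a j x = (if j = m then 0 else - \<theta> j x / \<theta> m x)" for j x
  have a_eq: "a j = (\<lambda>x. - \<theta> j x / \<theta> m x)" if "j \<noteq> m" for j using that by (simp add: a_def fun_eq_iff)
  have am: "a m = (\<lambda>x. 0)" by (simp add: a_def fun_eq_iff)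
  have hq: "holo_on (\<theta> j) U'" for j using \<theta> U'(3) holo_on_subset by blast
  have a: "holo_on (a j) U'" for j
    by (cases "j = m") (auto simp: am a_eq U'_def intro!: holo_on_divide holo_on_minus hq[unfolded U'_def])
  have pa: "pd i (a j) x = (- pd i (\<theta> j) x * \<theta> m x + \<theta> j x * pd i (\<theta> m) x) / (\<theta> m x)\<^sup>2"
    if "x \<in> U'" "j \<noteq> m" for i j x
    unfolding a_eq[OF that(2)]
    by (subst pd_divide[OF holo_on_minus[OF hq] hq _ that(1)])
       (use that in \<open>auto simp: U'_def pd_minus[OF hq that(1)]\<close>)
  have int': "pd i (a j) x + a i x * pd m (a j) x = pd j (a i) x + a j x * pd m (a i) x"
    if x: "x \<in> U'" and ij: "i \<noteq> m" "j \<noteq> m" for x i j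
  proof -
    let ?T = "\<theta> m x"
    have T: "?T \<noteq> 0" "x \<in> U" using x by (auto simp: U'_def)
    \<comment> \<open>The third power of \<theta>_m clears all denominators and exposes the
      component (i, j, m) of \<theta> \<and> d\<theta>.\<close>
    have "?T ^ 3 * (pd i (a j) x + a i x * pd m (a j) x) - ?T ^ 3 * (pd j (a i) x + a j x * pd m (a i) x)
      = - ?T * (\<theta> i x * (pd j (\<theta> m) x - pd m (\<theta> j) x)
        + \<theta> j x * (pd m (\<theta> i) x - pd i (\<theta> m) x) + ?T * (pd i (\<theta> j) x - pd j (\<theta> i) x))"
      unfolding pa[OF x ij(1)] pa[OF x ij(2)] unfolding a_eq[OF ij(1)] a_eq[OF ij(2)]
      using T(1) by (simp add: field_simps power2_eq_square power3_eq_cube)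
    also have "\<dots> = 0" using int[OF T(2), of i j m] by simp
    finally show ?thesis using T(1) by simp
  qed
  obtain Z r where Z: "r > 0" "holo_on Z (ball p r)" "\<And>x. x \<in> ball p r \<Longrightarrow> upd m (Z x) x \<in> U'"
    "\<And>x i. x \<in> ball p r \<Longrightarrow> i \<noteq> m \<Longrightarrow> pd i Z x = a i (upd m (Z x) x)" "pd m Z p = 1" "Z p = p $ m"
    by (rule total_differential_equation[OF U'(1,2) a am int'], assumption+) (rule that)
  have "pd m Z p \<noteq> 0" using Z(5) by simp
  \<comment> \<open>Since Z(p) = p_m and \<partial>_m Z(p) = 1, the map with last component Z is a
    local coordinate change fixing \<open>p\<close>; the function \<open>u\<close> reads the label
    off its inverse.\<close>
  then obtain V W u where *: "open V" "p \<in> V" "V \<subseteq> ball p r" "open W" "(\<lambda>x. upd m (Z x) x) ` V = W"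
    "holo_on u W" "\<And>y. y \<in> W \<Longrightarrow> upd m (u y) y \<in> V" "\<And>y. y \<in> W \<Longrightarrow> Z (upd m (u y) y) = y $ m"
    "\<And>x. x \<in> V \<Longrightarrow> u (upd m (Z x) x) = x $ m"
    "\<And>y i. y \<in> W \<Longrightarrow> pd m Z (upd m (u y) y) * pd i u y + of_bool (i \<noteq> m) * pd i Z (upd m (u y) y) = of_bool (i = m)"
    by (rule upd_inverse_function[OF open_ball centre_in_ball[THEN iffD2, OF Z(1)] Z(2)]) (rule that)
  have W: "p \<in> W" "W \<subseteq> U'"
    using *(2,3,5) Z(3,6) by (auto simp: image_iff intro!: bexI[of _ p])
  have nzu: "pd m u y \<noteq> 0" "pd m Z (upd m (u y) y) * pd m u y = 1" if "y \<in> W" for y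
    using *(10)[OF that, of m] by auto
  \<comment> \<open>The factor is forced by the component \<open>m\<close>, where the derivative of
    u is nonzero; the remaining components are checked against it.\<close>
  define f where "f y = \<theta> m y / pd m u y" for y
  have "\<theta> i y = f y * pd i u y" if y: "y \<in> W" for y i
  proof (cases "i = m")
    case False
    have "upd m (u y) y \<in> ball p r" using *(3) *(7)[OF y] by auto
    then have dZ: "pd i Z (upd m (u y) y) = - \<theta> i y / \<theta> m y"
      using Z(4)[of "upd m (u y) y" i] False *(8)[OF y] by (simp add: a_eq)
    have "pd m Z (upd m (u y) y) * pd i u y = - pd i Z (upd m (u y) y)"
      using *(10)[OF y, of i] False by (simp add: eq_neg_iff_add_eq_0)
    then have e: "pd m Z (upd m (u y) y) * pd i u y = \<theta> i y / \<theta> m y" by (simp add: dZ)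
    have "pd i u y = (pd m Z (upd m (u y) y) * pd m u y) * pd i u y" using nzu(2)[OF y] by simp
    also have "\<dots> = pd m u y * (pd m Z (upd m (u y) y) * pd i u y)" by simp
    also have "\<dots> = pd m u y * \<theta> i y / \<theta> m y" by (simp add: e)
    finally show ?thesis using nzu(1)[OF y] y W(2) by (auto simp: f_def U'_def)
  qed (simp add: f_def nzu(1)[OF y])
  moreover have "holo_on f W"
    unfolding f_def using W(2) nzu(1)
    by (intro holo_on_divide holo_on_subset[OF hq] holo_on_pd[OF *(4) *(6)])
  moreover have "f y \<noteq> 0" if "y \<in> W" for y
    using W(2) nzu(1)[OF that] that by (auto simp: f_def U'_def)
  ultimately show thesis using * W U'(3) nzu(1) by (intro that[of W u f]) auto
qed

section \<open>Relative Poincare lemma\<close>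

text \<open>The classical homotopy formula applied to the slices on which coordinate
  \<open>m\<close> is constant. The \<open>m\<close>-derivative of the primitive is left
  uncontrolled.\<close>

lemma radial_primitive:
  fixes s :: "'n::finite \<Rightarrow> complex ^ 'n \<Rightarrow> complex"
  assumes s: "\<And>j. holo_on (s j) (ball q r)" and sm: "s m = (\<lambda>x. 0)"
    and sym: "\<And>y j k. y \<in> ball q r \<Longrightarrow> j \<noteq> m \<Longrightarrow> k \<noteq> m \<Longrightarrow> pd k (s j) y = pd j (s k) y"
  obtains \<xi> where "holo_on \<xi> (ball q r)" "\<And>y k. y \<in> ball q r \<Longrightarrow> k \<noteq> m \<Longrightarrow> pd k \<xi> y = s k y"
proof -
  define K where "K t y = (\<Sum>j\<in>UNIV. s j (ray m q t y) * (y $ j - q $ j))" for t y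
  have mem: "ray m q t y \<in> ball q r" if "t \<in> {0..1}" "y \<in> ball q r" for t y
    using dist_ray[of t q m y] that by simp
  have "continuous_on ({0..1} \<times> ball q r) (\<lambda>z. s j (ray m q (fst z) (snd z)))" for j
    by (rule continuous_on_compose2[OF holo_on_imp_continuous_on[OF s], of _ "\<lambda>z. ray m q (fst z) (snd z)"])
       (auto intro!: continuous_intros simp del: mem_ball intro: mem)
  then have cont: "continuous_on ({0..1} \<times> ball q r) (\<lambda>(t, y). K t y)"
    by (auto simp: case_prod_unfold K_def intro!: continuous_intros)
  have hK: "holo_on (K t) (ball q r)" if "t \<in> {0..1}" for t
    unfolding K_def by (intro holo_on_sum holo_on_mult holo_on_ray[OF s that] holo_on_diff) simp_all
  define \<xi> where "\<xi> y = integral {0..1} (\<lambda>t. K t y)" for y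
  have "pd k \<xi> y = s k y" if y: "y \<in> ball q r" and k: "k \<noteq> m" for y k
  proof -
    \<comment> \<open>By symmetry of the derivatives, the \<open>k\<close>-derivative of the
      integrand is the t-derivative of t * s_k along the ray, so the fundamental theorem
      applies.\<close>
    have pK: "pd k (K t) y = of_real t * (\<Sum>j\<in>UNIV. of_bool (j \<noteq> m) * (y $ j - q $ j) * pd j (s k) (ray m q t y)) + 1 * s k (ray m q t y)"
      if t: "t \<in> {0..1}" for t
    proof -
      have "pd k (K t) y = (\<Sum>j\<in>UNIV. pd k (\<lambda>y. s j (ray m q t y) * (y $ j - q $ j)) y)"
        unfolding K_def by (rule pd_sum[OF _ y]) (intro holo_on_mult holo_on_ray[OF s t] holo_on_diff; simp)
      also have "\<dots> = (\<Sum>j\<in>UNIV. of_real t * (of_bool (j \<noteq> m) * (y $ j - q $ j) * pd j (s k) (ray m q t y))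
          + (if j = k then s j (ray m q t y) else 0))"
      proof (rule sum.cong)
        fix j
        have "pd k (\<lambda>y. s j (ray m q t y) * (y $ j - q $ j)) y =
            s j (ray m q t y) * of_bool (k = j) + of_real t * pd k (s j) (ray m q t y) * (y $ j - q $ j)"
          by (subst pd_mult[OF holo_on_ray[OF s t] holo_on_diff[OF holo_on_nth holo_on_const] y])
             (use k in \<open>simp add: pd_ray[OF s t y] pd_diff[OF holo_on_nth holo_on_const y] pd_nth\<close>)
        moreover have "pd k (s j) (ray m q t y) = of_bool (j \<noteq> m) * pd j (s k) (ray m q t y)"
          using sym[OF mem[OF t y] _ k, of j] by (cases "j = m") (simp_all add: sm)
        ultimately show "pd k (\<lambda>y. s j (ray m q t y) * (y $ j - q $ j)) y =
            of_real t * (of_bool (j \<noteq> m) * (y $ j - q $ j) * pd j (s k) (ray m q t y))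
            + (if j = k then s j (ray m q t y) else 0)" by simp
      qed simp
      finally show ?thesis by (simp only: sum.distrib sum_distrib_left) simp
    qed
    have "((\<lambda>t. pd k (K t) y) has_integral of_real 1 * s k (ray m q 1 y) - of_real 0 * s k (ray m q 0 y)) {0..1}"
    proof (rule fundamental_theorem_of_calculus)
      fix t :: real assume t: "t \<in> {0..1}"
      have "((\<lambda>t. of_real t :: complex) has_vector_derivative 1) (at t within {0..1})"
        by (auto intro!: derivative_eq_intros simp: has_vector_derivative_def scaleR_conv_of_real)
      from has_vector_derivative_mult[OF this has_vector_derivative_along_ray[OF s y t]]
      show "((\<lambda>t. of_real t * s k (ray m q t y)) has_vector_derivative pd k (K t) y) (at t within {0..1})"
        unfolding pK[OF t] .
    qed simp
    moreover have "pd k \<xi> y = integral {0..1} (\<lambda>t. pd k (K t) y)"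
      unfolding \<xi>_def by (rule pd_integral[OF open_ball cont hK y])
    ultimately show ?thesis by (simp add: integral_unique)
  qed
  moreover have "holo_on \<xi> (ball q r)" unfolding \<xi>_def by (rule holo_on_integral[OF open_ball cont hK])
  ultimately show thesis by (intro that)
qed

text \<open>The hypothesis is d\<alpha> \<and> du = 0, so \<alpha> is closed on every level set of
  u. Once u is a coordinate, a primitive on the level sets depends holomorphically on u, and the
  remaining discrepancy is a multiple of du.\<close>

theorem relative_poincare:
  fixes \<alpha> :: "'n::finite \<Rightarrow> complex ^ 'n \<Rightarrow> complex"
  assumes U: "open U" "p \<in> U" and \<alpha>: "\<And>j. holo_on (\<alpha> j) U" and u: "holo_on u U" and nz: "pd m u p \<noteq> 0"
    and closed: "\<And>x i j k. x \<in> U \<Longrightarrow> (pd i (\<alpha> j) x - pd j (\<alpha> i) x) * pd k u x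
      + (pd j (\<alpha> k) x - pd k (\<alpha> j) x) * pd i u x + (pd k (\<alpha> i) x - pd i (\<alpha> k) x) * pd j u x = 0"
  obtains V \<xi> f where "open V" "p \<in> V" "V \<subseteq> U" "holo_on \<xi> V" "holo_on f V"
    "\<And>x i. x \<in> V \<Longrightarrow> \<alpha> i x = pd i \<xi> x + f x * pd i u x"
proof -
  define U' where "U' = {x \<in> U. pd m u x \<noteq> 0}"
  have U': "open U'" "p \<in> U'" "U' \<subseteq> U"
    using open_nonzero_set[OF U(1) holo_on_pd[OF U(1) u]] U(2) nz by (auto simp: U'_def)
  have hu: "holo_on u U'" and h\<alpha>: "holo_on (\<alpha> j) U'" for j
    using u \<alpha> U'(3) holo_on_subset by blast+
  \<comment> \<open>Subtracting l du removes component \<open>m\<close> and does not change the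
    restriction to the level sets of u.\<close>
  define l where "l x = \<alpha> m x / pd m u x" for x
  have l: "holo_on l U'"
    unfolding l_def by (intro holo_on_divide h\<alpha> holo_on_pd[OF U'(1) hu]) (simp add: U'_def)
  define b where "b j x = (if j = m then 0 else \<alpha> j x - l x * pd j u x)" for j x
  have b_eq: "b j x = \<alpha> j x - l x * pd j u x" if "x \<in> U'" for j x
    using that by (auto simp: b_def l_def U'_def)
  have bm: "b m = (\<lambda>x. 0)" by (simp add: b_def fun_eq_iff)
  have hb: "holo_on (b j) U'" for j
    by (rule holo_on_cong[OF _ U'(1) b_eq[symmetric]]) (intro holo_on_diff holo_on_mult l h\<alpha> holo_on_pd[OF U'(1) hu])
  have pb: "pd i (b j) x = pd i (\<alpha> j) x - (l x * pd i (pd j u) x + pd i l x * pd j u x)" if x: "x \<in> U'" for i j x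
  proof -
    have "pd i (b j) x = pd i (\<lambda>x. \<alpha> j x - l x * pd j u x) x"
      by (rule pd_cong[OF U'(1) x b_eq])
    also have "\<dots> = pd i (\<alpha> j) x - pd i (\<lambda>x. l x * pd j u x) x"
      by (rule pd_diff[OF h\<alpha> holo_on_mult[OF l holo_on_pd[OF U'(1) hu]] x])
    also have "pd i (\<lambda>x. l x * pd j u x) x = l x * pd i (pd j u) x + pd i l x * pd j u x"
      by (rule pd_mult[OF l holo_on_pd[OF U'(1) hu] x])
    finally show ?thesis .
  qed
  have b_closed: "(pd j (b k) x - pd k (b j) x) * pd m u x = pd m (b k) x * pd j u x - pd m (b j) x * pd k u x"
    if x: "x \<in> U'" for j k x
  proof -
    have "(pd j (b k) x - pd k (b j) x) * pd m u x + (pd k (b m) x - pd m (b k) x) * pd j u x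
        + (pd m (b j) x - pd j (b m) x) * pd k u x
      = (pd j (\<alpha> k) x - pd k (\<alpha> j) x) * pd m u x + (pd k (\<alpha> m) x - pd m (\<alpha> k) x) * pd j u x
        + (pd m (\<alpha> j) x - pd j (\<alpha> m) x) * pd k u x"
      unfolding pb[OF x] pd_commute[OF U'(1) hu x, of k j] pd_commute[OF U'(1) hu x, of m k]
        pd_commute[OF U'(1) hu x, of m j] by algebra
    also have "\<dots> = 0" using closed[of x j k m] x U'(3) by auto
    finally show ?thesis by (simp add: bm algebra_simps)
  qed
  obtain V W z where *: "open V" "p \<in> V" "V \<subseteq> U'" "open W" "(\<lambda>x. upd m (u x) x) ` V = W"
    "holo_on z W" "\<And>y. y \<in> W \<Longrightarrow> upd m (z y) y \<in> V" "\<And>y. y \<in> W \<Longrightarrow> u (upd m (z y) y) = y $ m"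
    "\<And>x. x \<in> V \<Longrightarrow> z (upd m (u x) x) = x $ m"
    "\<And>y i. y \<in> W \<Longrightarrow> pd m u (upd m (z y) y) * pd i z y + of_bool (i \<noteq> m) * pd i u (upd m (z y) y) = of_bool (i = m)"
    by (rule upd_inverse_function[OF U'(1,2) hu nz]) (rule that)
  define q where "q = upd m (u p) p"
  obtain r where r: "r > 0" "ball q r \<subseteq> W"
    using *(2,4,5) open_contains_ball unfolding q_def by blast
  \<comment> \<open>The coordinate change alters only coordinate \<open>m\<close>, in which
    \<open>b\<close> has no component. Hence these functions are the components of \<open>b\<close>
    in the straightened coordinates, and \<open>b_closed\<close> becomes symmetry of their
    derivatives within a level set.\<close>
  define s where "s j y = b j (upd m (z y) y)" for j y
  have zr: "holo_on z (ball q r)" and mem: "\<And>y. y \<in> ball q r \<Longrightarrow> upd m (z y) y \<in> U'"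
    using *(3,6,7) r(2) holo_on_subset by blast+
  have s: "holo_on (s j) (ball q r)" for j unfolding s_def by (rule holo_on_upd[OF hb zr mem])
  have sm: "s m = (\<lambda>x. 0)" by (simp add: s_def bm fun_eq_iff)
  have sym: "pd k (s j) y = pd j (s k) y" if y: "y \<in> ball q r" and jk: "j \<noteq> m" "k \<noteq> m" for y j k
  proof -
    let ?x = "upd m (z y) y"
    have yW: "y \<in> W" using y r(2) by auto
    have nzx: "pd m u ?x \<noteq> 0" using mem[OF y] by (simp add: U'_def)
    have dz: "pd m u ?x * pd i z y = - pd i u ?x" if "i \<noteq> m" for i
      using *(10)[OF yW, of i] that by (simp add: eq_neg_iff_add_eq_0)
    have ps: "pd k (s j) y = pd m (b j) ?x * pd k z y + pd k (b j) ?x" if "k \<noteq> m" for j k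
      unfolding s_def by (subst pd_upd[OF hb zr mem y]) (simp_all add: that)
    have "pd m u ?x * pd k (s j) y = pd m u ?x * pd j (s k) y"
      using b_closed[OF mem[OF y], of j k] dz[OF jk(1)] dz[OF jk(2)]
      unfolding ps[OF jk(1)] ps[OF jk(2)] by algebra
    then show ?thesis using nzx by simp
  qed
  obtain \<eta> where \<eta>: "holo_on \<eta> (ball q r)" "\<And>y k. y \<in> ball q r \<Longrightarrow> k \<noteq> m \<Longrightarrow> pd k \<eta> y = s k y"
    by (rule radial_primitive[OF s sm sym], assumption+) (rule that)
  define V' where "V' = V \<inter> (\<lambda>x. upd m (u x) x) -` ball q r"
  have "continuous_on V u" using hu *(3) holo_on_imp_continuous_on holo_on_subset by blast
  then have "open V'" unfolding V'_def by (intro continuous_open_preimage *(1)) (auto intro!: continuous_intros)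
  moreover have "p \<in> V'" using *(2) r(1) by (simp add: V'_def q_def)
  moreover have V': "V' \<subseteq> U'" "V' \<subseteq> U" using *(3) U'(3) by (auto simp: V'_def)
  moreover have mem': "\<And>x. x \<in> V' \<Longrightarrow> upd m (u x) x \<in> ball q r" by (simp add: V'_def)
  moreover have hu': "holo_on u V'" using hu V'(1) holo_on_subset by blast
  moreover have "holo_on (\<lambda>x. \<eta> (upd m (u x) x)) V'" by (rule holo_on_upd[OF \<eta>(1) hu' mem'])
  moreover have "holo_on (\<lambda>x. l x - pd m \<eta> (upd m (u x) x)) V'"
    by (intro holo_on_diff holo_on_upd[OF holo_on_pd[OF open_ball \<eta>(1)] hu' mem'] holo_on_subset[OF l V'(1)])
  moreover have "\<alpha> i x = pd i (\<lambda>x. \<eta> (upd m (u x) x)) x + (l x - pd m \<eta> (upd m (u x) x)) * pd i u x"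
    if x: "x \<in> V'" for x i
  proof -
    have "s i (upd m (u x) x) = b i x"
      using x *(9)[of x] by (simp add: s_def V'_def)
    then have "of_bool (i \<noteq> m) * pd i \<eta> (upd m (u x) x) = b i x"
      using \<eta>(2)[OF mem'[OF x], of i] by (cases "i = m") (simp_all add: bm)
    then show ?thesis
      using b_eq[of x i] x V'(1) by (auto simp: pd_upd[OF \<eta>(1) hu' mem' x] algebra_simps)
  qed
  ultimately show thesis by (intro that[of V' "\<lambda>x. \<eta> (upd m (u x) x)" "\<lambda>x. l x - pd m \<eta> (upd m (u x) x)"])
qed

section \<open>Normal form of a closed adapted coframe\<close>

text \<open>The components of \<theta> \<and> d\<theta>.\<close>

definition frobenius_at :: "('n \<Rightarrow> complex ^ 'n \<Rightarrow> complex) \<Rightarrow> complex ^ 'n \<Rightarrow> bool" where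
  "frobenius_at \<theta> x \<longleftrightarrow> (\<forall>i j k. \<theta> i x * (pd j (\<theta> k) x - pd k (\<theta> j) x)
      + \<theta> j x * (pd k (\<theta> i) x - pd i (\<theta> k) x) + \<theta> k x * (pd i (\<theta> j) x - pd j (\<theta> i) x) = 0)"

definition closed_at :: "('n \<Rightarrow> 'n \<Rightarrow> complex ^ 'n \<Rightarrow> complex) \<Rightarrow> complex ^ 'n \<Rightarrow> bool" where
  "closed_at \<omega> x \<longleftrightarrow> (\<forall>i j k. pd i (\<omega> j k) x + pd j (\<omega> k i) x + pd k (\<omega> i j) x = 0)"

definition wedge ::
  "('n \<Rightarrow> complex ^ 'n \<Rightarrow> complex) \<Rightarrow> ('n \<Rightarrow> complex ^ 'n \<Rightarrow> complex) \<Rightarrow> 'n \<Rightarrow> 'n \<Rightarrow> complex ^ 'n \<Rightarrow> complex" where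
  "wedge a b i j x = a i x * b j x - a j x * b i x"

definition ev :: "('n \<Rightarrow> complex) \<Rightarrow> complex ^ 'n \<Rightarrow> complex" where
  "ev a v = (\<Sum>i\<in>UNIV. a i * v $ i)"

text \<open>The components of a \<and> b \<and> c, that is, the 3 by 3 minors of the three
  covectors.\<close>

definition alt3 :: "('n \<Rightarrow> complex) \<Rightarrow> ('n \<Rightarrow> complex) \<Rightarrow> ('n \<Rightarrow> complex) \<Rightarrow> 'n \<Rightarrow> 'n \<Rightarrow> 'n \<Rightarrow> complex" where
  "alt3 a b c i j k = a i * (b j * c k - b k * c j) + a j * (b k * c i - b i * c k) + a k * (b i * c j - b j * c i)"

lemma sum_triple_product:
  fixes a b c :: "'n::finite \<Rightarrow> complex"
  shows "(\<Sum>i\<in>UNIV. \<Sum>j\<in>UNIV. \<Sum>k\<in>UNIV. (a i * b j * c k) * (X $ i * Y $ j * Z $ k)) = ev a X * (ev b Y * ev c Z)"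
proof -
  have "ev b Y * ev c Z = (\<Sum>j\<in>UNIV. \<Sum>k\<in>UNIV. (b j * Y $ j) * (c k * Z $ k))"
    unfolding ev_def by (rule sum_product)
  then show ?thesis
    by (simp only: ev_def[of a] sum_distrib_right, simp only: sum_distrib_left)
       (intro sum.cong refl, simp add: mult_ac)
qed

text \<open>Evaluates a \<and> b \<and> c on three vectors. It converts identities between
  components in the original coordinates into identities along vector fields dual to the new
  ones.\<close>

lemma contract_alt3:
  fixes a b c :: "'n::finite \<Rightarrow> complex"
  shows "(\<Sum>i\<in>UNIV. \<Sum>j\<in>UNIV. \<Sum>k\<in>UNIV. alt3 a b c i j k * (X $ i * Y $ j * Z $ k)) =
    ev a X * (ev b Y * ev c Z - ev b Z * ev c Y) + ev a Y * (ev b Z * ev c X - ev b X * ev c Z)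
    + ev a Z * (ev b X * ev c Y - ev b Y * ev c X)"
proof -
  have *: "alt3 a b c i j k * (X $ i * Y $ j * Z $ k) =
     (a i * b j * c k) * (X $ i * Y $ j * Z $ k) - (a i * c j * b k) * (X $ i * Y $ j * Z $ k)
     + (c i * a j * b k) * (X $ i * Y $ j * Z $ k) - (b i * a j * c k) * (X $ i * Y $ j * Z $ k)
     + (b i * c j * a k) * (X $ i * Y $ j * Z $ k) - (c i * b j * a k) * (X $ i * Y $ j * Z $ k)" for i j k
    unfolding alt3_def by algebra
  show ?thesis
    unfolding * sum.distrib sum_subtractf sum_triple_product by algebra
qed

lemma distinct_indices_4 [simp]:
  "(1::4) \<noteq> 2" "(1::4) \<noteq> 3" "(1::4) \<noteq> 4" "(2::4) \<noteq> 1" "(2::4) \<noteq> 3" "(2::4) \<noteq> 4"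
  "(3::4) \<noteq> 1" "(3::4) \<noteq> 2" "(3::4) \<noteq> 4" "(4::4) \<noteq> 1" "(4::4) \<noteq> 2" "(4::4) \<noteq> 3"
  by simp_all

lemma distinct_indices_2 [simp]: "(1::2) \<noteq> 2" "(2::2) \<noteq> 1"
  by simp_all

lemma const_along_directions:
  fixes f :: "complex ^ 'n \<Rightarrow> complex"
  assumes f: "holo_on f (ball q r)" and z: "\<And>y i. y \<in> ball q r \<Longrightarrow> i \<in> I \<Longrightarrow> pd i f y = 0"
    and y: "y \<in> ball q r" "y' \<in> ball q r" and eq: "\<And>i. i \<notin> I \<Longrightarrow> y $ i = y' $ i"
  shows "f y = f y'"
proof -
  have seg: "closed_segment y y' \<subseteq> ball q r" by (rule closed_segment_subset[OF y convex_ball])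
  have "f y' - f y = 0"
  proof (rule norm_le_zero_iff[THEN iffD1])
    define l where "l t = y + t *\<^sub>R (y' - y)" for t :: real
    have l: "l t \<in> ball q r" if "t \<in> {0..1}" for t
    proof (rule subsetD[OF seg])
      show "l t \<in> closed_segment y y'"
        using that unfolding closed_segment_def l_def by (auto intro!: exI[of _ t] simp: algebra_simps)
    qed
    have "((\<lambda>t. f (l t)) has_derivative (\<lambda>h. 0)) (at t within {0..1})" if t: "t \<in> {0..1}" for t
    proof -
      have d: "(l has_derivative (\<lambda>h. h *\<^sub>R (y' - y))) (at t within {0..1})"
        unfolding l_def by (auto intro!: derivative_eq_intros)
      have key: "pd j f (l t) * (h *\<^sub>R (y' - y)) $ j = 0" for j h
        using z[OF l[OF t], of j] eq[of j] by (cases "j \<in> I") auto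
      show ?thesis
        by (rule has_derivative_eq_rhs[OF has_derivative_compose[OF d holo_onD[OF f l[OF t]]]])
           (simp only: key sum.neutral_const)
    qed
    then have "norm (f (l 1) - f (l 0)) \<le> 0 * norm (1 - 0 :: real)"
      by (intro differentiable_bound[where S="{0..1}" and f'="\<lambda>t h. 0"]) (auto simp: onorm_zero)
    then show "norm (f y' - f y) \<le> 0" by (simp add: l_def)
  qed
  then show ?thesis by simp
qed

text \<open>For \<theta> = a du + b dv one has \<theta> \<and> d\<theta> = (b da - a db) \<and> du
  \<and> dv, and b da - a db is b^2 d(a/b).\<close>

lemma frobenius_at_component:
  assumes "open U" "x \<in> U" and u: "holo_on u U" and v: "holo_on v U" and a: "holo_on a U" and b: "holo_on b U"
    and eq: "\<And>y i. y \<in> U \<Longrightarrow> \<theta> i y = a y * pd i u y + b y * pd i v y"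
    and frob: "frobenius_at \<theta> x"
  shows "alt3 (\<lambda>i. b x * pd i a x - a x * pd i b x) (\<lambda>i. pd i u x) (\<lambda>i. pd i v x) i j k = 0"
proof -
  note U = assms(1,2)
  have hu: "\<And>i. holo_on (pd i u) U" and hv: "\<And>i. holo_on (pd i v) U"
    using holo_on_pd[OF U(1)] u v by blast+
  have p: "pd i (\<theta> j) x = a x * pd i (pd j u) x + pd i a x * pd j u x + (b x * pd i (pd j v) x + pd i b x * pd j v x)" for i j
  proof -
    have "pd i (\<theta> j) x = pd i (\<lambda>y. a y * pd j u y + b y * pd j v y) x" by (rule pd_cong[OF U eq])
    also have "\<dots> = pd i (\<lambda>y. a y * pd j u y) x + pd i (\<lambda>y. b y * pd j v y) x"
      by (rule pd_add[OF holo_on_mult[OF a hu] holo_on_mult[OF b hv] U(2)])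
    finally show ?thesis by (simp only: pd_mult[OF a hu U(2)] pd_mult[OF b hv U(2)])
  qed
  have "\<theta> i x * (pd j (\<theta> k) x - pd k (\<theta> j) x) + \<theta> j x * (pd k (\<theta> i) x - pd i (\<theta> k) x)
      + \<theta> k x * (pd i (\<theta> j) x - pd j (\<theta> i) x) = 0"
    using frob unfolding frobenius_at_def by blast
  then show ?thesis
    unfolding p eq[OF U(2)] alt3_def
      pd_commute[OF U(1) u U(2), of k j] pd_commute[OF U(1) u U(2), of k i] pd_commute[OF U(1) u U(2), of j i]
      pd_commute[OF U(1) v U(2), of k j] pd_commute[OF U(1) v U(2), of k i] pd_commute[OF U(1) v U(2), of j i]
    by algebra
qed

text \<open>d(\<alpha> \<and> du) = d\<alpha> \<and> du, which is the hypothesis of the relative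
  Poincare lemma.\<close>

lemma closed_at_wedge_pd:
  assumes "open U" "x \<in> U" and u: "holo_on u U" and \<alpha>: "\<And>j. holo_on (\<alpha> j) U"
    and eq: "\<And>y i j. y \<in> U \<Longrightarrow> \<omega> i j y = \<alpha> i y * pd j u y - \<alpha> j y * pd i u y"
    and closed: "closed_at \<omega> x"
  shows "(pd i (\<alpha> j) x - pd j (\<alpha> i) x) * pd k u x
      + (pd j (\<alpha> k) x - pd k (\<alpha> j) x) * pd i u x + (pd k (\<alpha> i) x - pd i (\<alpha> k) x) * pd j u x = 0"
proof -
  note U = assms(1,2)
  have hu: "\<And>i. holo_on (pd i u) U" using holo_on_pd[OF U(1) u] by blast
  have p: "pd i (\<omega> j k) x = (\<alpha> j x * pd i (pd k u) x + pd i (\<alpha> j) x * pd k u x)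
      - (\<alpha> k x * pd i (pd j u) x + pd i (\<alpha> k) x * pd j u x)" for i j k
  proof -
    have "pd i (\<omega> j k) x = pd i (\<lambda>y. \<alpha> j y * pd k u y - \<alpha> k y * pd j u y) x" by (rule pd_cong[OF U eq])
    also have "\<dots> = pd i (\<lambda>y. \<alpha> j y * pd k u y) x - pd i (\<lambda>y. \<alpha> k y * pd j u y) x"
      by (rule pd_diff[OF holo_on_mult[OF \<alpha> hu] holo_on_mult[OF \<alpha> hu] U(2)])
    finally show ?thesis by (simp only: pd_mult[OF \<alpha> hu U(2)])
  qed
  have "pd i (\<omega> j k) x + pd j (\<omega> k i) x + pd k (\<omega> i j) x = 0"
    using closed unfolding closed_at_def by blast
  then show ?thesis
    unfolding p pd_commute[OF U(1) u U(2), of k j] pd_commute[OF U(1) u U(2), of k i] pd_commute[OF U(1) u U(2), of j i]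
    by algebra
qed

text \<open>Products of exact forms are closed, so the exterior derivative hits only the
  coefficients F, G and Q.\<close>

lemma closed_at_three_wedges:
  assumes "open U" "x \<in> U"
    and h: "holo_on F U" "holo_on G U" "holo_on Q U" "holo_on \<eta> U" "holo_on \<xi> U" "holo_on u U" "holo_on v U"
    and eq: "\<And>y i j. y \<in> U \<Longrightarrow> \<omega> i j y = F y * (pd i \<eta> y * pd j u y - pd j \<eta> y * pd i u y)
      + G y * (pd i \<xi> y * pd j v y - pd j \<xi> y * pd i v y) - Q y * (pd i u y * pd j v y - pd j u y * pd i v y)"
    and closed: "closed_at \<omega> x"
  shows "alt3 (\<lambda>i. pd i F x) (\<lambda>i. pd i \<eta> x) (\<lambda>i. pd i u x) i j k
      + alt3 (\<lambda>i. pd i G x) (\<lambda>i. pd i \<xi> x) (\<lambda>i. pd i v x) i j k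
      - alt3 (\<lambda>i. pd i Q x) (\<lambda>i. pd i u x) (\<lambda>i. pd i v x) i j k = 0"
proof -
  note U = assms(1,2)
  have w: "holo_on (\<lambda>y. f y * (pd i a y * pd j b y - pd j a y * pd i b y)) U"
    and pw: "pd l (\<lambda>y. f y * (pd i a y * pd j b y - pd j a y * pd i b y)) x =
      f x * ((pd i a x * pd l (pd j b) x + pd l (pd i a) x * pd j b x)
        - (pd j a x * pd l (pd i b) x + pd l (pd j a) x * pd i b x))
      + pd l f x * (pd i a x * pd j b x - pd j a x * pd i b x)"
    if f: "holo_on f U" and a: "holo_on a U" and b: "holo_on b U" for f a b i j l
  proof -
    have ha: "\<And>i. holo_on (pd i a) U" and hb: "\<And>i. holo_on (pd i b) U"
      using holo_on_pd[OF U(1)] a b by blast+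
    note hab = holo_on_mult[OF ha hb]
    show "holo_on (\<lambda>y. f y * (pd i a y * pd j b y - pd j a y * pd i b y)) U"
      by (intro holo_on_mult f holo_on_diff ha hb)
    show "pd l (\<lambda>y. f y * (pd i a y * pd j b y - pd j a y * pd i b y)) x =
      f x * ((pd i a x * pd l (pd j b) x + pd l (pd i a) x * pd j b x)
        - (pd j a x * pd l (pd i b) x + pd l (pd j a) x * pd i b x))
      + pd l f x * (pd i a x * pd j b x - pd j a x * pd i b x)"
      by (simp only: pd_mult[OF f holo_on_diff[OF hab hab] U(2)] pd_diff[OF hab hab U(2)] pd_mult[OF ha hb U(2)])
  qed
  note w1 = w[OF h(1,4,6)] and w2 = w[OF h(2,5,7)] and w3 = w[OF h(3,6,7)]
  have p: "pd l (\<omega> i j) x = pd l (\<lambda>y. F y * (pd i \<eta> y * pd j u y - pd j \<eta> y * pd i u y)) x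
      + pd l (\<lambda>y. G y * (pd i \<xi> y * pd j v y - pd j \<xi> y * pd i v y)) x
      - pd l (\<lambda>y. Q y * (pd i u y * pd j v y - pd j u y * pd i v y)) x" for l i j
  proof -
    have "pd l (\<omega> i j) x = pd l (\<lambda>y. F y * (pd i \<eta> y * pd j u y - pd j \<eta> y * pd i u y)
      + G y * (pd i \<xi> y * pd j v y - pd j \<xi> y * pd i v y) - Q y * (pd i u y * pd j v y - pd j u y * pd i v y)) x"
      by (rule pd_cong[OF U eq])
    then show ?thesis by (simp only: pd_diff[OF holo_on_add[OF w1 w2] w3 U(2)] pd_add[OF w1 w2 U(2)])
  qed
  have "pd i (\<omega> j k) x + pd j (\<omega> k i) x + pd k (\<omega> i j) x = 0"
    using closed unfolding closed_at_def by blast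
  then show ?thesis
    unfolding p pw[OF h(1,4,6)] pw[OF h(2,5,7)] pw[OF h(3,6,7)] alt3_def
      pd_commute[OF U(1) h(4) U(2), of k j] pd_commute[OF U(1) h(4) U(2), of k i] pd_commute[OF U(1) h(4) U(2), of j i]
      pd_commute[OF U(1) h(5) U(2), of k j] pd_commute[OF U(1) h(5) U(2), of k i] pd_commute[OF U(1) h(5) U(2), of j i]
      pd_commute[OF U(1) h(6) U(2), of k j] pd_commute[OF U(1) h(6) U(2), of k i] pd_commute[OF U(1) h(6) U(2), of j i]
      pd_commute[OF U(1) h(7) U(2), of k j] pd_commute[OF U(1) h(7) U(2), of k i] pd_commute[OF U(1) h(7) U(2), of j i]
    by algebra
qed

text \<open>The four covectors form the rows of an injective, hence invertible, matrix, which has no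
  zero row. It yields the nonvanishing component with which Frobenius starts.\<close>

lemma trivial_common_kernel_imp_nonzero:
  fixes r1 r2 r3 r4 :: "4 \<Rightarrow> complex"
  assumes "\<And>v. ev r1 v = 0 \<Longrightarrow> ev r2 v = 0 \<Longrightarrow> ev r3 v = 0 \<Longrightarrow> ev r4 v = 0 \<Longrightarrow> v = 0"
  shows "\<exists>m. r1 m \<noteq> 0"
proof (rule ccontr)
  assume *: "\<nexists>m. r1 m \<noteq> 0"
  define C :: cmat where "C = (\<chi> i j. if i = 1 then r1 j else if i = 2 then r2 j else if i = 3 then r3 j else r4 j)"
  have row: "(C *v v) $ i = ev (\<lambda>j. C $ i $ j) v" for v i
    by (simp add: matrix_vector_mult_def ev_def)
  have "\<exists>E. E ** C = mat 1"
    unfolding matrix_left_invertible_ker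
  proof (intro allI impI)
    fix v assume v: "C *v v = 0"
    have "ev (\<lambda>j. C $ i $ j) v = 0" for i using row[of v i] v by simp
    from this[of 1] this[of 2] this[of 3] this[of 4] show "v = 0"
      by (intro assms) (simp_all add: C_def)
  qed
  then have "invertible C" by (simp add: invertible_left_inverse)
  then obtain E where "C ** E = mat 1" by (auto simp: invertible_def)
  from arg_cong[OF this, of "\<lambda>M. M $ 1 $ 1"] * show False
    by (simp add: matrix_matrix_mult_def mat_def C_def)
qed

text \<open>Since \<kappa>0 \<and> \<theta>0 = (a \<kappa>0) \<and> du, the integrating factor of
  \<theta>0 can be moved to \<kappa>0, and closedness says that a \<kappa>0 is exact modulo du. The
  same holds for \<kappa>1, \<theta>1, b and v.\<close>

lemma coframe_potentials:
  fixes \<theta>0 \<theta>1 \<kappa>0 \<kappa>1 :: "4 \<Rightarrow> cvec \<Rightarrow> complex"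
  assumes U: "open U" "p \<in> U"
    and holo: "\<And>j. holo_on (\<theta>0 j) U" "\<And>j. holo_on (\<theta>1 j) U" "\<And>j. holo_on (\<kappa>0 j) U" "\<And>j. holo_on (\<kappa>1 j) U"
    and frob: "\<forall>x\<in>U. frobenius_at \<theta>0 x" "\<forall>x\<in>U. frobenius_at \<theta>1 x"
    and closed: "\<forall>x\<in>U. closed_at (wedge \<kappa>0 \<theta>0) x" "\<forall>x\<in>U. closed_at (wedge \<kappa>1 \<theta>1) x"
    and nz: "\<theta>0 m p \<noteq> 0" "\<theta>1 n p \<noteq> 0"
  shows "\<exists>V u v \<xi> \<eta> a b f h. open V \<and> p \<in> V \<and> V \<subseteq> U \<and>
    holo_on u V \<and> holo_on v V \<and> holo_on \<xi> V \<and> holo_on \<eta> V \<and> holo_on a V \<and> holo_on b V \<and> holo_on f V \<and> holo_on h V \<and>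
    (\<forall>x\<in>V. a x \<noteq> 0 \<and> b x \<noteq> 0 \<and> (\<forall>i. \<theta>0 i x = a x * pd i u x \<and> \<theta>1 i x = b x * pd i v x \<and>
      a x * \<kappa>0 i x = pd i \<xi> x + f x * pd i u x \<and> b x * \<kappa>1 i x = pd i \<eta> x + h x * pd i v x))"
proof -
  obtain V0 u a where 0: "open V0" "p \<in> V0" "V0 \<subseteq> U" "holo_on u V0" "holo_on a V0"
    "\<And>x. x \<in> V0 \<Longrightarrow> a x \<noteq> 0" "\<And>x. x \<in> V0 \<Longrightarrow> pd m u x \<noteq> 0" "\<And>x i. x \<in> V0 \<Longrightarrow> \<theta>0 i x = a x * pd i u x"
    by (rule frobenius_one_form[OF U holo(1) nz(1) frob(1)[unfolded frobenius_at_def, rule_format]], assumption) (rule that)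
  obtain V1 v b where 1: "open V1" "p \<in> V1" "V1 \<subseteq> U" "holo_on v V1" "holo_on b V1"
    "\<And>x. x \<in> V1 \<Longrightarrow> b x \<noteq> 0" "\<And>x. x \<in> V1 \<Longrightarrow> pd n v x \<noteq> 0" "\<And>x i. x \<in> V1 \<Longrightarrow> \<theta>1 i x = b x * pd i v x"
    by (rule frobenius_one_form[OF U holo(2) nz(2) frob(2)[unfolded frobenius_at_def, rule_format]], assumption) (rule that)
  define \<alpha> where "\<alpha> j x = a x * \<kappa>0 j x" for j x
  define \<beta> where "\<beta> j x = b x * \<kappa>1 j x" for j x
  have \<alpha>: "holo_on (\<alpha> j) V0" for j
    unfolding \<alpha>_def by (intro holo_on_mult 0(5) holo_on_subset[OF holo(3) 0(3)])
  have \<beta>: "holo_on (\<beta> j) V1" for j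
    unfolding \<beta>_def by (intro holo_on_mult 1(5) holo_on_subset[OF holo(4) 1(3)])
  have w0: "wedge \<kappa>0 \<theta>0 i j x = \<alpha> i x * pd j u x - \<alpha> j x * pd i u x" if "x \<in> V0" for i j x
    using 0(8)[OF that] by (simp add: wedge_def \<alpha>_def)
  have w1: "wedge \<kappa>1 \<theta>1 i j x = \<beta> i x * pd j v x - \<beta> j x * pd i v x" if "x \<in> V1" for i j x
    using 1(8)[OF that] by (simp add: wedge_def \<beta>_def)
  obtain V2 \<xi> f where 2: "open V2" "p \<in> V2" "V2 \<subseteq> V0" "holo_on \<xi> V2" "holo_on f V2"
    "\<And>x i. x \<in> V2 \<Longrightarrow> \<alpha> i x = pd i \<xi> x + f x * pd i u x"
    by (rule relative_poincare[OF 0(1,2) \<alpha> 0(4) 0(7)[OF 0(2)]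
          closed_at_wedge_pd[OF 0(1) _ 0(4) \<alpha> w0 closed(1)[rule_format, OF subsetD[OF 0(3)]]]], assumption+) (rule that)
  obtain V3 \<eta> h where 3: "open V3" "p \<in> V3" "V3 \<subseteq> V1" "holo_on \<eta> V3" "holo_on h V3"
    "\<And>x i. x \<in> V3 \<Longrightarrow> \<beta> i x = pd i \<eta> x + h x * pd i v x"
    by (rule relative_poincare[OF 1(1,2) \<beta> 1(4) 1(7)[OF 1(2)]
          closed_at_wedge_pd[OF 1(1) _ 1(4) \<beta> w1 closed(2)[rule_format, OF subsetD[OF 1(3)]]]], assumption+) (rule that)
  have sub: "V2 \<inter> V3 \<subseteq> V0" "V2 \<inter> V3 \<subseteq> V1" "V2 \<inter> V3 \<subseteq> U" "V2 \<inter> V3 \<subseteq> V2" "V2 \<inter> V3 \<subseteq> V3"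
    using 0(3) 2(3) 3(3) by auto
  show ?thesis
  proof (rule exI[of _ "V2 \<inter> V3"], rule exI[of _ u], rule exI[of _ v], rule exI[of _ \<xi>], rule exI[of _ \<eta>],
      rule exI[of _ a], rule exI[of _ b], rule exI[of _ f], rule exI[of _ h], intro conjI ballI allI)
    show "holo_on u (V2 \<inter> V3)" "holo_on a (V2 \<inter> V3)" using 0(4,5) sub(1) holo_on_subset by blast+
    show "holo_on v (V2 \<inter> V3)" "holo_on b (V2 \<inter> V3)" using 1(4,5) sub(2) holo_on_subset by blast+
    show "holo_on \<xi> (V2 \<inter> V3)" "holo_on f (V2 \<inter> V3)" using 2(4,5) sub(4) holo_on_subset by blast+
    show "holo_on \<eta> (V2 \<inter> V3)" "holo_on h (V2 \<inter> V3)" using 3(4,5) sub(5) holo_on_subset by blast+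
    show "open (V2 \<inter> V3)" "p \<in> V2 \<inter> V3" "V2 \<inter> V3 \<subseteq> U" using 2(1,2) 3(1,2) sub(3) by auto
    fix x assume x: "x \<in> V2 \<inter> V3"
    then have x': "x \<in> V0" "x \<in> V1" "x \<in> V2" "x \<in> V3" using sub by auto
    show "a x \<noteq> 0" "b x \<noteq> 0" using 0(6) 1(6) x' by auto
    fix i
    show "\<theta>0 i x = a x * pd i u x" "\<theta>1 i x = b x * pd i v x" using 0(8) 1(8) x' by auto
    show "a x * \<kappa>0 i x = pd i \<xi> x + f x * pd i u x" "b x * \<kappa>1 i x = pd i \<eta> x + h x * pd i v x"
      using 2(6)[OF x'(3), of i] 3(6)[OF x'(4), of i] by (simp_all add: \<alpha>_def \<beta>_def)
  qed
qed

lemma ev_smult: "ev (\<lambda>i. c * a i) v = c * ev a v"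
  and ev_add: "ev (\<lambda>i. a i + b i) v = ev a v + ev b v"
  by (simp_all add: ev_def sum_distrib_left sum.distrib algebra_simps)

lemma bil_products:
  assumes "\<And>i j. G $ i $ j = k1 i * t0 j + t0 i * k1 j - k0 i * t1 j - t1 i * k0 j"
  shows "bil G v w = ev k1 v * ev t0 w + ev t0 v * ev k1 w - ev k0 v * ev t1 w - ev t1 v * ev k0 w"
  unfolding bil_def assms ev_def sum_product
  by (simp only: sum.distrib[symmetric] sum_subtractf[symmetric])
     (intro sum.cong refl, simp add: algebra_simps)

lemma bil_sym_prods:
  "bil (\<chi> i j. a * sym_prod 1 4 i j + b * sym_prod 2 3 i j + h * sym_prod 2 4 i j) v w =
    a / 2 * (v $ 1 * w $ 4 + v $ 4 * w $ 1) + b / 2 * (v $ 2 * w $ 3 + v $ 3 * w $ 2)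
    + h / 2 * (v $ 2 * w $ 4 + v $ 4 * w $ 2)"
  unfolding bil_def sum_4 sym_prod_def by (simp add: field_simps)

lemma bil_normal_metric:
  "bil (normal_metric A D u) v w =
    A (base u) / 2 * (v $ 1 * w $ 4 + v $ 4 * w $ 1) + 1 / A (base u) / 2 * (v $ 2 * w $ 3 + v $ 3 * w $ 2)
    + (u $ 1 * pd 1 A (base u) - u $ 3 * pd 2 A (base u) / (A (base u))\<^sup>2 + D (base u)) / 2
      * (v $ 2 * w $ 4 + v $ 4 * w $ 2)"
  unfolding normal_metric_def bil_sym_prods ..

lemma
  fixes f :: "complex ^ 2 \<Rightarrow> complex"
  assumes f: "holo_on f W" and sub: "\<And>x. x \<in> S \<Longrightarrow> base x \<in> W"
  shows holo_on_base: "holo_on (\<lambda>x. f (base x)) S"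
    and pd_base: "x \<in> S \<Longrightarrow> pd i (\<lambda>x. f (base x)) x =
      of_bool (i = 2) * pd 1 f (base x) + of_bool (i = 4) * pd 2 f (base x)"
proof -
  have c: "(\<lambda>x. base x $ k) = (if k = 1 then (\<lambda>x. x $ 2) else (\<lambda>x. x $ 4))" for k :: 2
    using exhaust_2[of k] by (auto simp: base_def fun_eq_iff)
  have h: "holo_on (\<lambda>x. base x $ k) S" for k unfolding c by simp
  show "holo_on (\<lambda>x. f (base x)) S" by (rule holo_on_compose[OF f h sub])
  assume x: "x \<in> S"
  show "pd i (\<lambda>x. f (base x)) x = of_bool (i = 2) * pd 1 f (base x) + of_bool (i = 4) * pd 2 f (base x)"
    using pd_compose[OF f h sub x, of i] unfolding sum_2 c by (simp add: pd_nth)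
qed

text \<open>With the potentials, g = 2 F d\<eta> du - 2 G d\<xi> dv + 2 Q du dv, where F = a/b and G
  = b/a, while the third closed form is F d\<eta> \<and> du + G d\<xi> \<and> dv - Q du \<and> dv.
  The Frobenius condition for \<theta>0 + \<theta>1 gives dF \<and> du \<and> dv = 0; closedness
  then prescribes the derivatives of Q by \<eta> and \<xi>.\<close>

theorem coframe_normal_form:
  fixes \<theta>0 \<theta>1 \<kappa>0 \<kappa>1 :: "4 \<Rightarrow> cvec \<Rightarrow> complex"
  assumes U: "open U" "p \<in> U"
    and holo: "\<And>j. holo_on (\<theta>0 j) U" "\<And>j. holo_on (\<theta>1 j) U" "\<And>j. holo_on (\<kappa>0 j) U" "\<And>j. holo_on (\<kappa>1 j) U"
    and frob: "\<And>x. x \<in> U \<Longrightarrow> frobenius_at \<theta>0 x" "\<And>x. x \<in> U \<Longrightarrow> frobenius_at \<theta>1 x"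
      "\<And>x. x \<in> U \<Longrightarrow> frobenius_at (\<lambda>i x. \<theta>0 i x + \<theta>1 i x) x"
    and closed: "\<And>x. x \<in> U \<Longrightarrow> closed_at (wedge \<kappa>0 \<theta>0) x" "\<And>x. x \<in> U \<Longrightarrow> closed_at (wedge \<kappa>1 \<theta>1) x"
      "\<And>x. x \<in> U \<Longrightarrow> closed_at (\<lambda>i j x. wedge \<kappa>1 \<theta>0 i j x + wedge \<kappa>0 \<theta>1 i j x) x"
    and coframe: "\<And>v. ev (\<lambda>i. \<theta>0 i p) v = 0 \<Longrightarrow> ev (\<lambda>i. \<theta>1 i p) v = 0 \<Longrightarrow>
      ev (\<lambda>i. \<kappa>0 i p) v = 0 \<Longrightarrow> ev (\<lambda>i. \<kappa>1 i p) v = 0 \<Longrightarrow> v = 0"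
    and metric: "\<And>x i j. x \<in> U \<Longrightarrow> g x $ i $ j =
      \<kappa>1 i x * \<theta>0 j x + \<theta>0 i x * \<kappa>1 j x - \<kappa>0 i x * \<theta>1 j x - \<theta>1 i x * \<kappa>0 j x"
  shows "\<exists>V \<phi> W A D. p \<in> V \<and> V \<subseteq> U \<and> local_coordinates V \<phi> \<and> admissible W A D \<and>
    (\<forall>x\<in>V. base (\<phi> x) \<in> W) \<and>
    (\<forall>x\<in>V. \<forall>v w. bil (g x) v w = bil (normal_metric A D (\<phi> x)) (differential \<phi> x v) (differential \<phi> x w))"
proof -
  obtain m where m: "\<theta>0 m p \<noteq> 0" using trivial_common_kernel_imp_nonzero[OF coframe] by blast
  obtain n where n: "\<theta>1 n p \<noteq> 0"
    using trivial_common_kernel_imp_nonzero[of "\<lambda>i. \<theta>1 i p" "\<lambda>i. \<theta>0 i p" "\<lambda>i. \<kappa>0 i p" "\<lambda>i. \<kappa>1 i p"] coframe by blast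
  have "\<forall>x\<in>U. frobenius_at \<theta>0 x" "\<forall>x\<in>U. frobenius_at \<theta>1 x"
    "\<forall>x\<in>U. closed_at (wedge \<kappa>0 \<theta>0) x" "\<forall>x\<in>U. closed_at (wedge \<kappa>1 \<theta>1) x"
    using frob(1,2) closed(1,2) by blast+
  from coframe_potentials[OF U holo this m n]
  obtain V u v \<xi> \<eta> a b f h where *: "open V \<and> p \<in> V \<and> V \<subseteq> U \<and>
    holo_on u V \<and> holo_on v V \<and> holo_on \<xi> V \<and> holo_on \<eta> V \<and> holo_on a V \<and> holo_on b V \<and> holo_on f V \<and> holo_on h V \<and>
    (\<forall>x\<in>V. a x \<noteq> 0 \<and> b x \<noteq> 0 \<and> (\<forall>i. \<theta>0 i x = a x * pd i u x \<and> \<theta>1 i x = b x * pd i v x \<and>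
      a x * \<kappa>0 i x = pd i \<xi> x + f x * pd i u x \<and> b x * \<kappa>1 i x = pd i \<eta> x + h x * pd i v x))"
    by (elim exE) (rule that, assumption)
  then have V: "open V" "p \<in> V" "V \<subseteq> U"
    and hol: "holo_on u V" "holo_on v V" "holo_on \<xi> V" "holo_on \<eta> V" "holo_on a V" "holo_on b V" "holo_on f V" "holo_on h V"
    and a0: "\<And>x. x \<in> V \<Longrightarrow> a x \<noteq> 0" and b0: "\<And>x. x \<in> V \<Longrightarrow> b x \<noteq> 0"
    and \<theta>0: "\<And>x i. x \<in> V \<Longrightarrow> \<theta>0 i x = a x * pd i u x" and \<theta>1: "\<And>x i. x \<in> V \<Longrightarrow> \<theta>1 i x = b x * pd i v x"
    and \<kappa>0: "\<And>x i. x \<in> V \<Longrightarrow> a x * \<kappa>0 i x = pd i \<xi> x + f x * pd i u x"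
    and \<kappa>1: "\<And>x i. x \<in> V \<Longrightarrow> b x * \<kappa>1 i x = pd i \<eta> x + h x * pd i v x"
    by simp_all
  define F where "F x = a x / b x" for x
  define G where "G x = b x / a x" for x
  define Q where "Q x = F x * h x - G x * f x" for x
  have hF: "holo_on F V" and hG: "holo_on G V"
    unfolding F_def G_def using a0 b0 by (intro holo_on_divide hol; blast)+
  have hQ: "holo_on Q V" unfolding Q_def by (intro holo_on_diff holo_on_mult hF hG hol)
  have F0: "F x \<noteq> 0" if "x \<in> V" for x using a0 b0 that by (simp add: F_def)
  have pF: "(b x)\<^sup>2 * pd i F x = b x * pd i a x - a x * pd i b x" if x: "x \<in> V" for i x
    unfolding F_def using pd_divide[OF hol(5,6) b0 x, of i] b0[OF x] by (simp add: field_simps)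
  have pG: "pd i G x = - 1 / (F x)\<^sup>2 * pd i F x" if x: "x \<in> V" for i x
  proof -
    have 1: "pd i F x = (pd i a x * b x - a x * pd i b x) / (b x)\<^sup>2"
      unfolding F_def by (rule pd_divide[OF hol(5,6) b0 x])
    have 2: "pd i G x = (pd i b x * a x - b x * pd i a x) / (a x)\<^sup>2"
      unfolding G_def by (rule pd_divide[OF hol(6,5) a0 x])
    show ?thesis unfolding 1 2 F_def using a0[OF x] b0[OF x] by (simp add: field_simps power2_eq_square)
  qed
  have altF: "alt3 (\<lambda>i. pd i F x) (\<lambda>i. pd i u x) (\<lambda>i. pd i v x) i j k = 0" if x: "x \<in> V" for x i j k
  proof -
    have "alt3 (\<lambda>i. b x * pd i a x - a x * pd i b x) (\<lambda>i. pd i u x) (\<lambda>i. pd i v x) i j k = 0"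
      by (rule frobenius_at_component[OF V(1) x hol(1,2,5,6) _ frob(3)]) (use \<theta>0 \<theta>1 x V(3) in auto)
    then have "(b x)\<^sup>2 * alt3 (\<lambda>i. pd i F x) (\<lambda>i. pd i u x) (\<lambda>i. pd i v x) i j k = 0"
      unfolding pF[OF x, symmetric] alt3_def by (simp add: algebra_simps)
    then show ?thesis using b0[OF x] by simp
  qed
  have \<omega>: "wedge \<kappa>1 \<theta>0 i j y + wedge \<kappa>0 \<theta>1 i j y = F y * (pd i \<eta> y * pd j u y - pd j \<eta> y * pd i u y)
      + G y * (pd i \<xi> y * pd j v y - pd j \<xi> y * pd i v y) - Q y * (pd i u y * pd j v y - pd j u y * pd i v y)"
    if y: "y \<in> V" for i j y
  proof -
    have 1: "\<kappa>1 i y * a y = F y * (pd i \<eta> y + h y * pd i v y)" for i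
      using \<kappa>1[OF y, of i, symmetric] b0[OF y] by (simp add: F_def)
    have 0: "\<kappa>0 i y * b y = G y * (pd i \<xi> y + f y * pd i u y)" for i
      using \<kappa>0[OF y, of i, symmetric] a0[OF y] by (simp add: G_def)
    have "wedge \<kappa>1 \<theta>0 i j y + wedge \<kappa>0 \<theta>1 i j y = (\<kappa>1 i y * a y) * pd j u y - (\<kappa>1 j y * a y) * pd i u y
        + (\<kappa>0 i y * b y) * pd j v y - (\<kappa>0 j y * b y) * pd i v y"
      by (simp add: wedge_def \<theta>0[OF y] \<theta>1[OF y])
    then show ?thesis unfolding 1 0 Q_def by (simp add: algebra_simps)
  qed
  have altQ: "alt3 (\<lambda>i. pd i F x) (\<lambda>i. pd i \<eta> x) (\<lambda>i. pd i u x) i j k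
      + alt3 (\<lambda>i. pd i G x) (\<lambda>i. pd i \<xi> x) (\<lambda>i. pd i v x) i j k
      - alt3 (\<lambda>i. pd i Q x) (\<lambda>i. pd i u x) (\<lambda>i. pd i v x) i j k = 0" if x: "x \<in> V" for x i j k
    by (rule closed_at_three_wedges[OF V(1) x hF hG hQ hol(4,3,1,2) \<omega> closed(3)]) (use x V(3) in auto)

  \<comment> \<open>The order matches the normal form: u^1 = 2 \<eta>, u^2 = v, and for the tilde
    coordinates -2 \<xi> and u. The factors 2 and -2 absorb the coefficients of d\<eta> du and
    d\<xi> dv in the metric.\<close>
  define \<phi> :: "cvec \<Rightarrow> cvec" where
    "\<phi> x = (\<chi> k. if k = 1 then 2 * \<eta> x else if k = 2 then v x else if k = 3 then (- 2) * \<xi> x else u x)" for x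
  have c: "(\<lambda>x. \<phi> x $ 1) = (\<lambda>x. 2 * \<eta> x)" "(\<lambda>x. \<phi> x $ 2) = v" "(\<lambda>x. \<phi> x $ 3) = (\<lambda>x. (- 2) * \<xi> x)" "(\<lambda>x. \<phi> x $ 4) = u"
    by (simp_all add: \<phi>_def)
  have h\<phi>: "holo_on (\<lambda>x. \<phi> x $ k) V" for k
  proof -
    have "holo_on (\<lambda>x. \<phi> x $ 1) V" "holo_on (\<lambda>x. \<phi> x $ 2) V" "holo_on (\<lambda>x. \<phi> x $ 3) V" "holo_on (\<lambda>x. \<phi> x $ 4) V"
      unfolding c by (rule holo_on_cmult hol)+
    then show ?thesis using exhaust_4[of k] by blast
  qed
  have pc: "pd j (\<lambda>x. \<phi> x $ 1) x = 2 * pd j \<eta> x" "pd j (\<lambda>x. \<phi> x $ 3) x = (- 2) * pd j \<xi> x" if "x \<in> V" for j x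
    unfolding c using pd_cmult[OF hol(4) that] pd_cmult[OF hol(3) that] by blast+
  have "invertible (\<chi> k j. pd j (\<lambda>x. \<phi> x $ k) p)"
    unfolding invertible_left_inverse matrix_left_invertible_ker
  proof (intro allI impI)
    fix w assume w: "(\<chi> k j. pd j (\<lambda>x. \<phi> x $ k) p) *v w = 0"
    have row: "ev (\<lambda>j. pd j (\<lambda>x. \<phi> x $ k) p) w = 0" for k
      using arg_cong[OF w, of "\<lambda>z. z $ k"] by (simp only: matrix_vector_mult_def vec_lambda_beta zero_index ev_def)
    have r: "ev (\<lambda>j. pd j \<eta> p) w = 0" "ev (\<lambda>j. pd j v p) w = 0" "ev (\<lambda>j. pd j \<xi> p) w = 0" "ev (\<lambda>j. pd j u p) w = 0"
      using row[of 1] row[of 2] row[of 3] row[of 4] unfolding pc[OF V(2)] ev_smult c(2,4) by simp_all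
    have "a p * ev (\<lambda>i. \<kappa>0 i p) w = 0" "b p * ev (\<lambda>i. \<kappa>1 i p) w = 0"
      unfolding ev_smult[symmetric] \<kappa>0[OF V(2)] \<kappa>1[OF V(2)] ev_add unfolding ev_smult r by simp_all
    then show "w = 0"
      using a0[OF V(2)] b0[OF V(2)] by (intro coframe) (simp_all add: \<theta>0[OF V(2)] \<theta>1[OF V(2)] ev_smult r)
  qed
  then obtain V1 W1 \<psi> where 1: "open V1" "p \<in> V1" "V1 \<subseteq> V" "open W1" "\<phi> ` V1 = W1" "\<psi> ` W1 = V1"
    "\<And>x. x \<in> V1 \<Longrightarrow> \<psi> (\<phi> x) = x" "\<And>y. y \<in> W1 \<Longrightarrow> \<phi> (\<psi> y) = y" "\<And>k. holo_on (\<lambda>y. \<psi> y $ k) W1"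
    by (rule holo_inverse_function[OF V(1,2) h\<phi>]) (rule that)
  define q where "q = \<phi> p"
  obtain r where r: "r > 0" "ball q r \<subseteq> W1" using 1(2,4,5) open_contains_ball unfolding q_def by blast
  have h\<psi>: "holo_on (\<lambda>y. \<psi> y $ k) (ball q r)" for k by (rule holo_on_subset[OF 1(9) r(2)])
  have mem\<psi>: "\<psi> y \<in> V" "\<phi> (\<psi> y) = y" "\<psi> y \<in> V1" if "y \<in> ball q r" for y
    using subsetD[OF r(2) that] 1(3,6,8) by blast+
  \<comment> \<open>The coordinate vector fields of the new coordinates, expressed in the old
    ones.\<close>
  define X where "X i y = (\<chi> k. pd i (\<lambda>y. \<psi> y $ k) y)" for i y
  have chain: "holo_on (\<lambda>y. k (\<psi> y)) (ball q r)"
    "y \<in> ball q r \<Longrightarrow> pd i (\<lambda>y. k (\<psi> y)) y = ev (\<lambda>l. pd l k (\<psi> y)) (X i y)" if k: "holo_on k V" for k i y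
    using holo_on_compose[OF k h\<psi> mem\<psi>(1)] pd_compose[OF k h\<psi> mem\<psi>(1), of y i] by (simp_all add: X_def ev_def)
  have dual: "ev (\<lambda>l. pd l u (\<psi> y)) (X i y) = of_bool (i = 4)" "ev (\<lambda>l. pd l v (\<psi> y)) (X i y) = of_bool (i = 2)"
    "ev (\<lambda>l. pd l \<eta> (\<psi> y)) (X i y) = of_bool (i = 1) / 2" "ev (\<lambda>l. pd l \<xi> (\<psi> y)) (X i y) = - of_bool (i = 3) / 2"
    if y: "y \<in> ball q r" for y i
  proof -
    have *: "ev (\<lambda>l. pd l (\<lambda>x. \<phi> x $ k) (\<psi> y)) (X i y) = of_bool (i = k)" for k
    proof -
      have "pd i (\<lambda>y. \<phi> (\<psi> y) $ k) y = pd i (\<lambda>y. y $ k) y"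
        by (rule pd_cong[OF open_ball y]) (simp only: mem\<psi>)
      then show ?thesis unfolding chain(2)[OF h\<phi> y] pd_nth .
    qed
    show "ev (\<lambda>l. pd l u (\<psi> y)) (X i y) = of_bool (i = 4)" "ev (\<lambda>l. pd l v (\<psi> y)) (X i y) = of_bool (i = 2)"
      "ev (\<lambda>l. pd l \<eta> (\<psi> y)) (X i y) = of_bool (i = 1) / 2" "ev (\<lambda>l. pd l \<xi> (\<psi> y)) (X i y) = - of_bool (i = 3) / 2"
      using *[of 4] *[of 2] *[of 1, symmetric] *[of 3, symmetric] unfolding c(2,4) pc[OF mem\<psi>(1)[OF y]] ev_smult
      by (simp_all only:) simp_all
  qed
  \<comment> \<open>Evaluating dF \<and> du \<and> dv on \<open>X i\<close>, \<open>X 4\<close>,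
    \<open>X 2\<close> isolates the derivative of F along \<open>X i\<close>, because du and dv are
    dual to \<open>X 4\<close> and \<open>X 2\<close>.\<close>
  have FX: "ev (\<lambda>l. pd l F (\<psi> y)) (X i y) = 0" if y: "y \<in> ball q r" and i: "i \<in> {1, 3}" for y i
    using contract_alt3[of "\<lambda>l. pd l F (\<psi> y)" "\<lambda>l. pd l u (\<psi> y)" "\<lambda>l. pd l v (\<psi> y)" "X i y" "X 4 y" "X 2 y"] i
    unfolding altF[OF mem\<psi>(1)[OF y]] dual[OF y] by auto
  have QX: "2 * ev (\<lambda>l. pd l Q (\<psi> y)) (X 1 y) = ev (\<lambda>l. pd l F (\<psi> y)) (X 2 y)"
    "2 * ev (\<lambda>l. pd l Q (\<psi> y)) (X 3 y) = - 1 / (F (\<psi> y))\<^sup>2 * ev (\<lambda>l. pd l F (\<psi> y)) (X 4 y)" if y: "y \<in> ball q r" for y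
  proof -
    let ?x = "\<psi> y"
    have x: "?x \<in> V" by (rule mem\<psi>(1)[OF y])
    \<comment> \<open>The closed three-form is evaluated on \<open>X a\<close>, \<open>X 4\<close>,
      \<open>X 2\<close>; a = 1 isolates the derivative of Q by u^1, and a = 3 the one by the first
      tilde coordinate.\<close>
    have *: "0 = (\<Sum>i\<in>UNIV. \<Sum>j\<in>UNIV. \<Sum>k\<in>UNIV. alt3 (\<lambda>i. pd i F ?x) (\<lambda>i. pd i \<eta> ?x) (\<lambda>i. pd i u ?x) i j k * (X a y $ i * X 4 y $ j * X 2 y $ k))
        + (\<Sum>i\<in>UNIV. \<Sum>j\<in>UNIV. \<Sum>k\<in>UNIV. alt3 (\<lambda>i. pd i G ?x) (\<lambda>i. pd i \<xi> ?x) (\<lambda>i. pd i v ?x) i j k * (X a y $ i * X 4 y $ j * X 2 y $ k))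
        - (\<Sum>i\<in>UNIV. \<Sum>j\<in>UNIV. \<Sum>k\<in>UNIV. alt3 (\<lambda>i. pd i Q ?x) (\<lambda>i. pd i u ?x) (\<lambda>i. pd i v ?x) i j k * (X a y $ i * X 4 y $ j * X 2 y $ k))" for a
      unfolding sum.distrib[symmetric] sum_subtractf[symmetric] distrib_right[symmetric] left_diff_distrib[symmetric] altQ[OF x]
      by simp
    show "2 * ev (\<lambda>l. pd l Q (\<psi> y)) (X 1 y) = ev (\<lambda>l. pd l F (\<psi> y)) (X 2 y)"
      using *[of 1] unfolding contract_alt3 dual[OF y] FX[OF y, of 1, simplified] by simp
    have e: "- (ev (\<lambda>l. pd l F (\<psi> y)) (X 4 y) / ((F (\<psi> y))\<^sup>2 * 2)) = ev (\<lambda>l. pd l Q (\<psi> y)) (X 3 y)"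
      using *[of 3] unfolding contract_alt3 dual[OF y] pG[OF x] ev_smult by simp
    show "2 * ev (\<lambda>l. pd l Q (\<psi> y)) (X 3 y) = - 1 / (F (\<psi> y))\<^sup>2 * ev (\<lambda>l. pd l F (\<psi> y)) (X 4 y)"
      unfolding e[symmetric] by simp
  qed

  \<comment> \<open>A section of \<open>base\<close> that freezes coordinates 1 and 3 at their
    values at \<open>q\<close>. It does not increase the distance from \<open>q\<close>, so the
    segment from a point to its projection stays in the ball; functions constant in these two
    directions descend to \<open>W\<close>.\<close>
  define emb :: "complex ^ 2 \<Rightarrow> cvec" where
    "emb z = (\<chi> k. if k = 2 then z $ 1 else if k = 4 then z $ 2 else q $ k)" for z
  have base_emb: "base (emb z) = z" for z by (simp add: base_def emb_def vec_eq_iff forall_2)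
  have emb_base: "emb (base y) $ k = (if k = 2 \<or> k = 4 then y $ k else q $ k)" for y k
    by (auto simp: base_def emb_def)
  have emb_eq: "y $ i = emb (base y) $ i" if "i \<notin> {1, 3}" for y i
    using exhaust_4[of i] that by (auto simp: emb_base)
  have emb_mem: "emb (base y) \<in> ball q r" if "y \<in> ball q r" for y
  proof -
    have "norm (q - emb (base y)) \<le> norm (q - y)"
      by (rule norm_le_componentwise_cart) (simp add: emb_base)
    then show ?thesis using that by (simp add: dist_norm)
  qed
  define W where "W = {z. emb z \<in> ball q r}"
  have cemb: "(\<lambda>z. emb z $ k) = (if k = 2 then (\<lambda>z. z $ 1) else if k = 4 then (\<lambda>z. z $ 2) else (\<lambda>z. q $ k))" for k
    by (auto simp: emb_def)
  have hemb: "holo_on (\<lambda>z. emb z $ k) S" for k S unfolding cemb by simp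
  have "continuous_on UNIV emb"
  proof -
    have "continuous_on UNIV (\<lambda>z. \<chi> k. emb z $ k)"
      by (intro continuous_on_vec_lambda holo_on_imp_continuous_on hemb)
    then show ?thesis by simp
  qed
  then have W: "open W" unfolding W_def
    using open_vimage[OF open_ball, of emb q r] by (simp add: vimage_def)
  have baseW: "base y \<in> W" if "y \<in> ball q r" for y using emb_mem[OF that] by (simp add: W_def)
  define A where "A z = F (\<psi> (emb z))" for z
  have hA: "holo_on A W" unfolding A_def
    by (rule holo_on_compose[OF chain(1)[OF hF] hemb]) (simp add: W_def)
  have A0: "A z \<noteq> 0" if "z \<in> W" for z using that F0 mem\<psi>(1) by (simp add: A_def W_def)
  have FA: "F (\<psi> y) = A (base y)" if y: "y \<in> ball q r" for y
    unfolding A_def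
    by (rule const_along_directions[OF chain(1)[OF hF] _ y emb_mem[OF y] emb_eq])
       (simp_all only: FX chain(2)[OF hF])
  have FA': "ev (\<lambda>l. pd l F (\<psi> y)) (X i y) = of_bool (i = 2) * pd 1 A (base y) + of_bool (i = 4) * pd 2 A (base y)"
    if y: "y \<in> ball q r" for y i
  proof -
    have "pd i (\<lambda>y. F (\<psi> y)) y = pd i (\<lambda>y. A (base y)) y" by (rule pd_cong[OF open_ball y FA])
    moreover have "pd i (\<lambda>y. A (base y)) y = of_bool (i = 2) * pd 1 A (base y) + of_bool (i = 4) * pd 2 A (base y)"
      by (rule pd_base[OF hA baseW y])
    ultimately show ?thesis unfolding chain(2)[OF hF y] by (rule trans)
  qed
  define S where "S z = pd 2 A z / (A z)\<^sup>2" for z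
  have hP: "holo_on (pd 1 A) W" and hS: "holo_on S W"
    unfolding S_def power2_eq_square using A0 by (intro holo_on_divide holo_on_mult holo_on_pd[OF W hA] hA; simp)+
  \<comment> \<open>What remains of the du dv coefficient 2 Q after removing the prescribed linear
    part. Its derivatives in directions 1 and 3 vanish, so it descends to the function
    \<open>D\<close>.\<close>
  define R where "R y = 2 * Q (\<psi> y) - (y $ 1 * pd 1 A (base y) - y $ 3 * S (base y))" for y
  have hPb: "holo_on (\<lambda>y. pd 1 A (base y)) (ball q r)" by (rule holo_on_base[OF hP baseW])
  have hSb: "holo_on (\<lambda>y. S (base y)) (ball q r)" by (rule holo_on_base[OF hS baseW])
  have hR: "holo_on R (ball q r)"
    unfolding R_def by (intro holo_on_diff holo_on_mult hPb hSb chain(1)[OF hQ]) simp_all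
  have pR: "pd i R y = 2 * ev (\<lambda>l. pd l Q (\<psi> y)) (X i y) - (of_bool (i = 1) * pd 1 A (base y) - of_bool (i = 3) * S (base y))"
    if y: "y \<in> ball q r" and i: "i = 1 \<or> i = 3" for i y
  proof -
    have z: "pd i (\<lambda>y. pd 1 A (base y)) y = 0" "pd i (\<lambda>y. S (base y)) y = 0"
      using i by (subst pd_base[OF hP baseW y] pd_base[OF hS baseW y]; auto)+
    note m1 = holo_on_mult[OF holo_on_nth hPb] and m2 = holo_on_mult[OF holo_on_nth hSb]
    have "pd i R y = pd i (\<lambda>y. 2 * Q (\<psi> y)) y - pd i (\<lambda>y. y $ 1 * pd 1 A (base y) - y $ 3 * S (base y)) y"
      unfolding R_def by (rule pd_diff[OF holo_on_cmult[OF chain(1)[OF hQ]] holo_on_diff[OF m1 m2] y])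
    also have "pd i (\<lambda>y. 2 * Q (\<psi> y)) y = 2 * ev (\<lambda>l. pd l Q (\<psi> y)) (X i y)"
      by (rule trans[OF pd_cmult[OF chain(1)[OF hQ] y]]) (simp only: chain(2)[OF hQ y])
    also have "pd i (\<lambda>y. y $ 1 * pd 1 A (base y) - y $ 3 * S (base y)) y =
        pd i (\<lambda>y. y $ 1 * pd 1 A (base y)) y - pd i (\<lambda>y. y $ 3 * S (base y)) y"
      by (rule pd_diff[OF m1 m2 y])
    also have "pd i (\<lambda>y. y $ 1 * pd 1 A (base y)) y = of_bool (i = 1) * pd 1 A (base y)"
      by (rule trans[OF pd_mult[OF holo_on_nth hPb y]]) (simp only: z pd_nth mult_zero_right add_0_left)
    also have "pd i (\<lambda>y. y $ 3 * S (base y)) y = of_bool (i = 3) * S (base y)"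
      by (rule trans[OF pd_mult[OF holo_on_nth hSb y]]) (simp only: z pd_nth mult_zero_right add_0_left)
    finally show ?thesis .
  qed
  have pR0: "pd i R y = 0" if y: "y \<in> ball q r" and i: "i \<in> {1, 3}" for y i
  proof -
    consider "i = 1" | "i = 3" using i by blast
    then show ?thesis
    proof cases
      case 1 then show ?thesis using pR[OF y, of i] QX(1)[OF y] by (simp add: FA'[OF y])
    next
      case 2 then show ?thesis using pR[OF y, of i] QX(2)[OF y] by (simp add: FA'[OF y] FA[OF y] S_def)
    qed
  qed
  define D where "D z = R (emb z)" for z
  have hD: "holo_on D W" unfolding D_def by (rule holo_on_compose[OF hR hemb]) (simp add: W_def)
  have RD: "R y = D (base y)" if y: "y \<in> ball q r" for y
    unfolding D_def
    by (rule const_along_directions[OF hR pR0 y emb_mem[OF y] emb_eq])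

  \<comment> \<open>Shrinking to the preimage of the ball makes the image of the chart exactly the
    set on which \<open>A\<close> and \<open>D\<close> are known to represent F and R.\<close>
  define V2 where "V2 = V1 \<inter> \<phi> -` ball q r"
  have "continuous_on V1 (\<lambda>x. \<chi> k. \<phi> x $ k)"
    by (intro continuous_on_vec_lambda holo_on_imp_continuous_on holo_on_subset[OF h\<phi> 1(3)])
  then have V2: "open V2" unfolding V2_def by (intro continuous_open_preimage 1(1)) simp_all
  have img: "\<phi> ` V2 = ball q r"
  proof
    show "ball q r \<subseteq> \<phi> ` V2"
    proof
      fix y assume y: "y \<in> ball q r"
      then have "\<psi> y \<in> V2" "y = \<phi> (\<psi> y)" using y mem\<psi>[OF y] by (simp_all add: V2_def)
      then show "y \<in> \<phi> ` V2" by blast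
    qed
  qed (auto simp: V2_def)
  have inj: "inj_on \<phi> V2" using 1(7) unfolding V2_def by (metis IntE inj_onI)
  have sub: "V2 \<subseteq> V" using 1(3) by (auto simp: V2_def)
  have "the_inv_into V2 \<phi> y = \<psi> y" if y: "y \<in> ball q r" for y
    using y mem\<psi>[OF y] by (intro the_inv_into_f_eq[OF inj]) (simp_all add: V2_def)
  then have "local_coordinates V2 \<phi>"
    unfolding local_coordinates_def holo_vec_def img
    using V2 inj holo_on_subset[OF h\<phi> sub] by (auto intro: holo_on_cong[OF h\<psi>])
  moreover have "p \<in> V2" using 1(2) r(1) by (simp add: V2_def q_def)
  moreover have "V2 \<subseteq> U" using sub V(3) by blast
  moreover have "admissible W A D" using W hA hD A0 by (simp add: admissible_def)
  moreover have "base (\<phi> x) \<in> W" if "x \<in> V2" for x using that baseW by (simp add: V2_def)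
  moreover have "bil (g x) s t = bil (normal_metric A D (\<phi> x)) (differential \<phi> x s) (differential \<phi> x t)"
    if x2: "x \<in> V2" for x s t
  proof -
    have x: "x \<in> V" "x \<in> U" using x2 sub V(3) by auto
    have y: "\<phi> x \<in> ball q r" "\<psi> (\<phi> x) = x" using x2 1(7) by (auto simp: V2_def)
    define e where "e k = ev (\<lambda>i. pd i k x)" for k
    have dif: "differential \<phi> x s $ 1 = 2 * e \<eta> s" "differential \<phi> x s $ 2 = e v s"
      "differential \<phi> x s $ 3 = (- 2) * e \<xi> s" "differential \<phi> x s $ 4 = e u s" for s
      unfolding e_def ev_smult[symmetric] pc[OF x(1), symmetric]
      by (simp_all add: differential_def ev_def c)
    have t0: "ev (\<lambda>i. \<theta>0 i x) s = a x * e u s" and t1: "ev (\<lambda>i. \<theta>1 i x) s = b x * e v s" for s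
      by (simp_all add: \<theta>0[OF x(1)] \<theta>1[OF x(1)] ev_smult e_def)
    have "a x * ev (\<lambda>i. \<kappa>0 i x) s = e \<xi> s + f x * e u s" "b x * ev (\<lambda>i. \<kappa>1 i x) s = e \<eta> s + h x * e v s" for s
      unfolding ev_smult[symmetric] \<kappa>0[OF x(1)] \<kappa>1[OF x(1)] ev_add unfolding ev_smult e_def by simp_all
    then have k0: "ev (\<lambda>i. \<kappa>0 i x) s = (e \<xi> s + f x * e u s) / a x"
      and k1: "ev (\<lambda>i. \<kappa>1 i x) s = (e \<eta> s + h x * e v s) / b x" for s
      using a0[OF x(1)] b0[OF x(1)] by (simp_all add: field_simps)
    have H1: "\<phi> x $ 1 * pd 1 A (base (\<phi> x)) - \<phi> x $ 3 * pd 2 A (base (\<phi> x)) / (A (base (\<phi> x)))\<^sup>2 + D (base (\<phi> x)) = 2 * Q x"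
      using RD[OF y(1), symmetric] y(2) by (simp add: R_def S_def)
    have H2: "A (base (\<phi> x)) = a x / b x" using FA[OF y(1)] y(2) by (simp add: F_def)
    show ?thesis
      unfolding bil_normal_metric unfolding H1 unfolding H2 dif bil_products[OF metric[OF x(2)]] t0 t1 k0 k1 Q_def F_def G_def
      using a0[OF x(1)] b0[OF x(1)] by (simp add: field_simps)
  qed
  ultimately show ?thesis
    by - (rule exI[of _ V2], rule exI[of _ \<phi>], rule exI[of _ W], rule exI[of _ A], rule exI[of _ D], intro conjI ballI allI; simp only:)
qed

section \<open>Bilinear algebra of a hyper-Kaehler structure\<close>

lemma bil_add_left: "bil G (v + v') w = bil G v w + bil G v' w"
  and bil_add_right: "bil G v (w + w') = bil G v w + bil G v w'"
  and bil_diff_left: "bil G (v - v') w = bil G v w - bil G v' w"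
  and bil_diff_right: "bil G v (w - w') = bil G v w - bil G v w'"
  and bil_smult_left: "bil G (c *s v) w = c * bil G v w"
  and bil_smult_right: "bil G v (c *s w) = c * bil G v w"
  and bil_zero_left: "bil G 0 w = 0"
  and bil_zero_right: "bil G v 0 = 0"
  and bil_minus_left: "bil G (- v) w = - bil G v w"
  and bil_minus_right: "bil G v (- w) = - bil G v w"
  unfolding bil_def
  by (simp_all add: sum.distrib sum_subtractf sum_distrib_left sum_negf algebra_simps)

lemmas bil_linear = bil_add_left bil_add_right bil_diff_left bil_diff_right bil_smult_left bil_smult_right
  bil_zero_left bil_zero_right bil_minus_left bil_minus_right

lemma bil_axis_right: "bil G v (axis j 1) = (\<Sum>i\<in>UNIV. G $ i $ j * v $ i)"
  unfolding bil_def
proof (rule sum.cong)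
  fix i
  show "(\<Sum>k\<in>UNIV. G $ i $ k * v $ i * axis j 1 $ k) = G $ i $ j * v $ i"
    using sum_axis[of "\<lambda>k. G $ i $ k * v $ i" j 1] by simp
qed simp

lemma bil_axis: "bil G (axis i 1) (axis j 1) = G $ i $ j"
  unfolding bil_axis_right using sum_axis[of "\<lambda>k. G $ k $ j" i 1] by simp

lemma ev_bil: "ev (\<lambda>j. bil G v (axis j 1)) w = bil G v w"
proof -
  have "ev (\<lambda>j. bil G v (axis j 1)) w = (\<Sum>j\<in>UNIV. \<Sum>i\<in>UNIV. G $ i $ j * v $ i * w $ j)"
    by (simp only: ev_def bil_axis_right sum_distrib_right)
  also have "\<dots> = bil G v w" unfolding bil_def by (rule sum.swap)
  finally show ?thesis .
qed

lemma symmetric_nth: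
  fixes G :: "'a ^ 'n ^ 'n"
  assumes "transpose G = G" shows "G $ i $ j = G $ j $ i"
  using arg_cong[OF assms, of "\<lambda>M. M $ i $ j"] by (simp add: transpose_def)

lemma bil_symmetric: "transpose G = G \<Longrightarrow> bil G v w = bil G w v"
proof -
  assume "transpose G = G"
  note sym = symmetric_nth[OF this]
  have "bil G v w = (\<Sum>i\<in>UNIV. \<Sum>j\<in>UNIV. G $ j $ i * v $ j * w $ i)"
    unfolding bil_def by (rule sum.swap)
  also have "\<dots> = bil G w v"
    unfolding bil_def by (intro sum.cong refl) (use sym in \<open>metis mult.assoc mult.commute\<close>)
  finally show ?thesis .
qed

lemma bil_nondegenerate:
  assumes "transpose G = G" "invertible G" "\<And>w. bil G v w = 0"
  shows "v = 0"
proof -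
  have "G *v v = 0"
  proof (rule vec_eq_iff[THEN iffD2], rule allI)
    fix j
    have "(G *v v) $ j = bil G (axis j 1) v"
      using ev_bil[of G "axis j 1" v] by (simp add: matrix_vector_mult_def ev_def bil_axis)
    also have "\<dots> = bil G v (axis j 1)" by (rule bil_symmetric[OF assms(1)])
    also have "\<dots> = 0" by (rule assms(3))
    finally show "(G *v v) $ j = 0 $ j" by simp
  qed
  then show ?thesis using assms(2) matrix_left_invertible_ker invertible_left_inverse by blast
qed

lemma dim_cvec: "vec.dim (UNIV :: cvec set) = 4"
  unfolding vec_dim_card by simp

text \<open>The algebra of the structure on a single tangent space, separated from the differential
  conditions so that it can be interpreted at each point.\<close>

locale hk_point =
  fixes G I J K :: cmat
  assumes sym: "transpose G = G" and inv: "invertible G"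
    and herm: "\<And>T v w. T \<in> {I, J, K} \<Longrightarrow> bil G (T *v v) (T *v w) = bil G v w"
    and quat: "I ** I = - mat 1" "J ** J = - mat 1" "K ** K = - mat 1" "I ** J ** K = - mat 1"
begin

lemma minus_vec: "(T::cmat) *v (- v) = - (T *v v)"
  by (simp add: matrix_vector_mult_def vec_eq_iff sum_negf)

lemmas lin = matrix_vector_right_distrib matrix_vector_mult_diff_distrib vector_scalar_commute
  matrix_vector_mult_0_right minus_vec

lemma sq: "I *v (I *v v) = - v" "J *v (J *v v) = - v" "K *v (K *v v) = - v"
  unfolding matrix_vector_mul_assoc quat by (simp_all add: matrix_vector_mult_def vec_eq_iff mat_def sum_negf if_distrib[of "\<lambda>x. x * _"] cong: if_cong)

lemma IJK: "I *v (J *v (K *v v)) = - v"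
  using quat(4) sq(1)[of v] quat(1) by (simp add: matrix_vector_mul_assoc matrix_mul_assoc)

lemma products: "I *v (J *v v) = K *v v" "J *v (K *v v) = I *v v" "J *v (I *v v) = - (K *v v)"
  "I *v (K *v v) = - (J *v v)" "K *v (I *v v) = J *v v" "K *v (J *v v) = - (I *v v)"
proof -
  show 1: "I *v (J *v v) = K *v v" for v
    using IJK[of "K *v v"] by (simp add: sq minus_vec)
  show 2: "J *v (K *v v) = I *v v" for v
    using arg_cong[OF IJK[of v], of "\<lambda>z. I *v z"] by (simp add: sq minus_vec)
  show 3: "J *v (I *v v) = - (K *v v)" for v
    unfolding 2[symmetric] by (simp add: sq)
  show 4: "I *v (K *v v) = - (J *v v)" for v
    unfolding 1[symmetric] by (simp add: sq)
  show "K *v (I *v v) = J *v v" for v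
    unfolding 1[symmetric] by (simp add: 3 4 minus_vec)
  show "K *v (J *v v) = - (I *v v)" for v
    unfolding 1[symmetric] by (simp add: sq minus_vec)
qed

lemma skew: "T \<in> {I, J, K} \<Longrightarrow> bil G (T *v v) w = - bil G v (T *v w)"
proof -
  assume T: "T \<in> {I, J, K}"
  then have "T *v (T *v w) = - w" using sq by auto
  then have "- bil G (T *v v) w = bil G v (T *v w)"
    using herm[OF T, of v "T *v w"] by (simp add: bil_linear)
  then show ?thesis by (metis minus_minus)
qed

text \<open>The Lagrangian condition puts T B into the orthogonal complement of B = span {X, Y}, and
  nondegeneracy forces equality. Otherwise w, T X and T Y would be three independent vectors
  orthogonal to B, and some nonzero element of B would be orthogonal to a whole basis.\<close>

lemma lagrangian_perp:
  assumes ind: "vec.independent {X, Y}" "X \<noteq> Y" and T: "T \<in> {I, J, K}"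
    and lag: "\<And>v w. v \<in> {X, Y} \<Longrightarrow> w \<in> {X, Y} \<Longrightarrow> bil G (T *v v) w = 0"
    and w: "\<And>v. v \<in> {X, Y} \<Longrightarrow> bil G v w = 0"
  shows "\<exists>u \<in> vec.span {X, Y}. w = T *v u"
proof (rule ccontr)
  assume no: "\<not> ?thesis"
  have comb: "a *s X + b *s Y \<in> vec.span {X, Y}" for a b
    by (intro vec.span_add vec.span_scale vec.span_base) auto
  have zero: "a = 0 \<and> b = 0" if e: "a *s X + b *s Y = 0" for a b
  proof -
    have "a = 0"
    proof (rule ccontr)
      assume a: "a \<noteq> 0"
      have "X = (- b / a) *s Y"
      proof -
        have "(1 / a) *s (a *s X + b *s Y) = 0" using e by simp
        then show ?thesis using a by (simp add: vec_eq_iff field_simps eq_neg_iff_add_eq_0)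
      qed
      then have "X \<in> vec.span {Y}" by (metis insertI1 vec.span_base vec.span_scale)
      then show False using ind by (simp add: vec.independent_insert)
    qed
    moreover have "b = 0"
    proof (rule ccontr)
      assume b: "b \<noteq> 0"
      then have "Y = 0" using e \<open>a = 0\<close> by (simp add: vec_eq_iff)
      then show False using ind vec.dependent_zero by blast
    qed
    ultimately show ?thesis by simp
  qed
  have TT: "T *v (T *v v) = - v" for v using T sq by auto
  let ?S = "{T *v X, T *v Y}"
  have nin: "w \<notin> vec.span ?S"
  proof
    assume "w \<in> vec.span ?S"
    then obtain a b where "w = a *s (T *v X) + b *s (T *v Y)"
      by (auto simp: vec.span_breakdown_eq vec.span_singleton algebra_simps)
    then have "w = T *v (a *s X + b *s Y)" by (simp add: lin)
    with no comb show False by blast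
  qed
  have "vec.dim (insert w ?S) \<le> card (insert w ?S)" by (rule vec.dim_le_card') simp
  also have "\<dots> \<le> 3" by (simp add: card_insert_if)
  finally have dim3: "vec.dim (insert w ?S) \<le> 3" .
  have "vec.span (insert w ?S) \<noteq> UNIV"
  proof
    assume "vec.span (insert w ?S) = UNIV"
    then have "vec.dim (insert w ?S) = vec.dim (UNIV :: cvec set)" by (metis vec.dim_span)
    then show False using dim3 dim_cvec by linarith
  qed
  then obtain z where z: "z \<notin> vec.span (insert w ?S)" by blast
  have neq: "T *v X \<noteq> T *v Y" using TT ind(2) by (metis minus_minus)
  have i2: "vec.independent ?S"
  proof -
    have "T *v X \<notin> vec.span {T *v Y}"
    proof
      assume "T *v X \<in> vec.span {T *v Y}"
      then obtain k where "T *v X = k *s (T *v Y)" by (auto simp: vec.span_singleton)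
      then have "T *v (1 *s X + (- k) *s Y) = 0" by (simp add: lin)
      then have "1 *s X + (- k) *s Y = 0" using TT[of "1 *s X + (- k) *s Y"] by (simp add: lin)
      then show False using zero[of 1 "- k"] by simp
    qed
    moreover have "T *v Y \<noteq> 0"
    proof
      assume "T *v Y = 0"
      then have "Y = 0" using TT[of Y] by (simp add: lin)
      then show False using ind vec.dependent_zero by blast
    qed
    ultimately show ?thesis using neq by (simp add: vec.independent_insert)
  qed
  have ind4: "vec.independent (insert z (insert w ?S))"
    by (intro vec.independent_insertI i2 nin z)
  have card4: "card (insert z (insert w ?S)) = 4"
  proof -
    have "w \<notin> ?S" using nin vec.span_base[of w ?S] by blast
    moreover have "z \<notin> insert w ?S" using z vec.span_base[of z "insert w ?S"] by blast
    ultimately show ?thesis using neq by (simp only: card_insert_disjoint finite.intros insert_iff empty_iff simp_thms) simp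
  qed
  have full: "UNIV \<subseteq> vec.span (insert z (insert w ?S))"
    by (rule vec.card_ge_dim_independent[OF subset_UNIV ind4]) (simp only: dim_cvec card4 order_refl)
  \<comment> \<open>A nontrivial combination of X and Y orthogonal to the one basis vector z that
    need not be orthogonal to B.\<close>
  obtain a b where ab: "a \<noteq> 0 \<or> b \<noteq> 0" "a * bil G X z + b * bil G Y z = 0"
  proof (cases "bil G X z = 0 \<and> bil G Y z = 0")
    case True
    then show ?thesis by (intro that[of 1 0]) auto
  next
    case False
    then show ?thesis by (intro that[of "bil G Y z" "- bil G X z"]) (auto simp: mult.commute)
  qed
  let ?u = "a *s X + b *s Y"
  have "bil G ?u v = 0" for v
  proof -
    have "v \<in> vec.span (insert z (insert w ?S))" using full by auto
    then show ?thesis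
    proof (induction rule: vec.span_induct_alt)
      case base then show ?case by (simp add: bil_linear)
    next
      case (step c x y)
      have "bil G ?u x = 0"
        using step(1) ab(2) w lag bil_symmetric[OF sym] by (auto simp: bil_linear)
      with step(2) show ?case by (simp add: bil_linear)
    qed
  qed
  then have "?u = 0" by (rule bil_nondegenerate[OF sym inv])
  then show False using zero ab(1) by blast
qed

text \<open>By \<open>lagrangian_perp\<close> the planes I B, J B and K B all equal the orthogonal
  complement of B. Composing one structure with another then maps B to itself, and such products are
  again I or J up to sign.\<close>

lemma lagrangian_invariant:
  assumes ind: "vec.independent {X, Y}" "X \<noteq> Y"
    and lag: "\<And>T v w. T \<in> {I, J, K} \<Longrightarrow> v \<in> vec.span {X, Y} \<Longrightarrow> w \<in> vec.span {X, Y} \<Longrightarrow> bil G (T *v v) w = 0"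
    and v: "v \<in> vec.span {X, Y}"
  shows "I *v v \<in> vec.span {X, Y}" "J *v v \<in> vec.span {X, Y}"
proof -
  have perp: "\<exists>u \<in> vec.span {X, Y}. S *v v = T *v u" if "T \<in> {I, J, K}" "S \<in> {I, J, K}" for S T
  proof (rule lagrangian_perp[OF ind that(1)])
    fix x assume x: "x \<in> {X, Y}"
    show "bil G x (S *v v) = 0"
      using lag[OF that(2) v vec.span_base[OF x]] bil_symmetric[OF sym] by simp
  next
    fix a b assume "a \<in> {X, Y}" "b \<in> {X, Y}"
    then show "bil G (T *v a) b = 0"
      by (intro lag[OF that(1)] vec.span_base)
  qed
  obtain u where u: "u \<in> vec.span {X, Y}" "K *v v = J *v u" using perp[of J K] by blast
  have "I *v v = - u" using arg_cong[OF u(2), of "\<lambda>z. J *v z"] by (simp add: sq products)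
  then show "I *v v \<in> vec.span {X, Y}" using u(1) by (simp add: vec.span_neg)
  obtain u' where u': "u' \<in> vec.span {X, Y}" "I *v v = K *v u'" using perp[of K I] by blast
  have "J *v v = - u'" using arg_cong[OF u'(2), of "\<lambda>z. K *v z"] by (simp add: sq products)
  then show "J *v v \<in> vec.span {X, Y}" using u'(1) by (simp add: vec.span_neg)
qed

end

section \<open>Parallel endomorphisms give closed two-forms\<close>

text \<open>The two-form g(T., .) written as a sum of products of components, a form in which
  holomorphy and derivatives are direct.\<close>

definition kform :: "(cvec \<Rightarrow> cmat) \<Rightarrow> (cvec \<Rightarrow> cmat) \<Rightarrow> 4 \<Rightarrow> 4 \<Rightarrow> cvec \<Rightarrow> complex" where
  "kform g T i j x = (\<Sum>l\<in>UNIV. g x $ l $ j * T x $ l $ i)"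

lemma kform_eq_bil: "kform g T i j x = bil (g x) (T x *v axis i 1) (axis j 1)"
  unfolding bil_axis_right kform_def
  by (rule sum.cong) (simp_all add: matrix_vector_mult_def sum_axis)

lemma holo_kform: "holo_mat U g \<Longrightarrow> holo_mat U T \<Longrightarrow> holo_on (kform g T i j) U"
  unfolding kform_def[abs_def] holo_mat_def by (intro holo_on_sum holo_on_mult) auto

lemma mult_matrix_inv: "invertible A \<Longrightarrow> A ** matrix_inv A = mat 1"
  unfolding invertible_def matrix_inv_def by (drule someI_ex) simp

text \<open>The equation \<nabla>g = 0. Lowering the index gives the Christoffel symbols of the
  first kind, called \<open>L\<close> below, and two of them add up to one derivative of the
  metric.\<close>

lemma metric_christoffel:
  assumes U: "open U" "x \<in> U" and g: "holo_metric U g"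
  shows "pd k (\<lambda>y. g y $ l $ j) x =
    (\<Sum>n\<in>UNIV. christoffel g x n k l * g x $ n $ j) + (\<Sum>n\<in>UNIV. christoffel g x n k j * g x $ n $ l)"
proof -
  have sym: "g y $ i $ j = g y $ j $ i" if "y \<in> U" for y i j
    using g that symmetric_nth unfolding holo_metric_def by blast
  have inv: "g x ** matrix_inv (g x) = mat 1"
    using g U(2) unfolding holo_metric_def by (simp add: mult_matrix_inv)
  define L where "L l j k = (pd j (\<lambda>y. g y $ l $ k) x + pd k (\<lambda>y. g y $ l $ j) x - pd l (\<lambda>y. g y $ j $ k) x) / 2" for l j k
  have lower: "(\<Sum>n\<in>UNIV. christoffel g x n k l * g x $ n $ j) = L j k l" for j k l
  proof -
    have "(\<Sum>n\<in>UNIV. christoffel g x n k l * g x $ n $ j) =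
        (\<Sum>n\<in>UNIV. \<Sum>q\<in>UNIV. (g x $ j $ n * matrix_inv (g x) $ n $ q) * L q k l)"
      unfolding christoffel_def L_def
      by (rule sum.cong) (simp_all add: sum_distrib_left sum_distrib_right sum_divide_distrib sym[OF U(2), of _ j] mult_ac)
    also have "\<dots> = (\<Sum>q\<in>UNIV. (g x ** matrix_inv (g x)) $ j $ q * L q k l)"
      by (subst sum.swap) (simp add: matrix_matrix_mult_def sum_distrib_right)
    also have "\<dots> = (\<Sum>q\<in>UNIV. if q = j then L q k l else 0)"
      unfolding inv by (rule sum.cong) (auto simp: mat_def)
    finally show ?thesis by simp
  qed
  have psym: "pd k (\<lambda>y. g y $ i $ j) x = pd k (\<lambda>y. g y $ j $ i) x" for i j k
    by (rule pd_cong[OF U sym])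
  show ?thesis
    unfolding lower L_def psym[of _ j l] psym[of _ k l] psym[of _ k j] by (simp add: field_simps)
qed

lemma christoffel_sym:
  assumes U: "open U" "x \<in> U" and g: "holo_metric U g"
  shows "christoffel g x i j k = christoffel g x i k j"
proof -
  have "pd l (\<lambda>y. g y $ j $ k) x = pd l (\<lambda>y. g y $ k $ j) x" for l
  proof (rule pd_cong[OF U])
    show "g y $ j $ k = g y $ k $ j" if "y \<in> U" for y
      using g that symmetric_nth unfolding holo_metric_def by blast
  qed
  then show ?thesis unfolding christoffel_def by (simp add: add.commute)
qed

text \<open>Metric compatibility and \<nabla>T = 0 make the two-form parallel. For a torsion-free
  connection its exterior derivative is the cyclic sum of covariant derivatives, hence zero.\<close>

lemma closed_kform:
  assumes U: "open U" "x \<in> U" and g: "holo_metric U g" and T: "holo_mat U T" and par: "parallel U g T"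
    and anti: "\<And>i j. kform g T i j x = - kform g T j i x"
  shows "closed_at (kform g T) x"
proof -
  have hg: "holo_on (\<lambda>y. g y $ i $ j) U" and hT: "holo_on (\<lambda>y. T y $ i $ j) U" for i j
    using g T by (auto simp: holo_metric_def holo_mat_def)
  have sym: "g x $ i $ j = g x $ j $ i" for i j
    using g U(2) symmetric_nth unfolding holo_metric_def by blast
  define C where "C i j k = christoffel g x i j k" for i j k
  have Csym: "C i j k = C i k j" for i j k unfolding C_def by (rule christoffel_sym[OF U g])
  have pT: "pd k (\<lambda>y. T y $ l $ i) x = (\<Sum>n\<in>UNIV. C n k i * T x $ l $ n) - (\<Sum>n\<in>UNIV. C l k n * T x $ n $ i)" for k l i
    using par U(2) unfolding parallel_def cov_deriv_def C_def by (simp add: algebra_simps eq_neg_iff_add_eq_0)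
  have pk: "pd k (kform g T i j) x = (\<Sum>n\<in>UNIV. C n k j * kform g T i n x) + (\<Sum>n\<in>UNIV. C n k i * kform g T n j x)" for i j k
  proof -
    have "pd k (kform g T i j) x = (\<Sum>l\<in>UNIV. pd k (\<lambda>y. g y $ l $ j * T y $ l $ i) x)"
      unfolding kform_def[abs_def] by (rule pd_sum[OF holo_on_mult[OF hg hT] U(2)])
    also have "\<dots> = (\<Sum>l\<in>UNIV. g x $ l $ j * ((\<Sum>n\<in>UNIV. C n k i * T x $ l $ n) - (\<Sum>n\<in>UNIV. C l k n * T x $ n $ i))
        + ((\<Sum>n\<in>UNIV. C n k l * g x $ n $ j) + (\<Sum>n\<in>UNIV. C n k j * g x $ n $ l)) * T x $ l $ i)"
      by (simp only: pd_mult[OF hg hT U(2)] pT metric_christoffel[OF U g] C_def[symmetric])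
    also have "\<dots> = (\<Sum>l\<in>UNIV. \<Sum>n\<in>UNIV. C n k i * (g x $ l $ j * T x $ l $ n) - C l k n * g x $ l $ j * T x $ n $ i
          + (C n k l * g x $ n $ j * T x $ l $ i + C n k j * (g x $ l $ n * T x $ l $ i)))"
    proof (rule sum.cong)
      fix l
      have "(\<Sum>n\<in>UNIV. C n k j * g x $ n $ l) = (\<Sum>n\<in>UNIV. C n k j * g x $ l $ n)"
        by (intro sum.cong refl arg_cong[of _ _ "\<lambda>z. C _ k j * z"] sym)
      then show "g x $ l $ j * ((\<Sum>n\<in>UNIV. C n k i * T x $ l $ n) - (\<Sum>n\<in>UNIV. C l k n * T x $ n $ i))
        + ((\<Sum>n\<in>UNIV. C n k l * g x $ n $ j) + (\<Sum>n\<in>UNIV. C n k j * g x $ n $ l)) * T x $ l $ i =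
        (\<Sum>n\<in>UNIV. C n k i * (g x $ l $ j * T x $ l $ n) - C l k n * g x $ l $ j * T x $ n $ i
          + (C n k l * g x $ n $ j * T x $ l $ i + C n k j * (g x $ l $ n * T x $ l $ i)))"
        by (simp add: sum_distrib_left sum_distrib_right sum.distrib sum_subtractf algebra_simps)
    qed simp
    also have "\<dots> = (\<Sum>l\<in>UNIV. \<Sum>n\<in>UNIV. C n k i * (g x $ l $ j * T x $ l $ n)) - (\<Sum>l\<in>UNIV. \<Sum>n\<in>UNIV. C l k n * g x $ l $ j * T x $ n $ i)
        + ((\<Sum>l\<in>UNIV. \<Sum>n\<in>UNIV. C n k l * g x $ n $ j * T x $ l $ i) + (\<Sum>l\<in>UNIV. \<Sum>n\<in>UNIV. C n k j * (g x $ l $ n * T x $ l $ i)))"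
      by (simp only: sum.distrib sum_subtractf)
    also have "(\<Sum>l\<in>UNIV. \<Sum>n\<in>UNIV. C l k n * g x $ l $ j * T x $ n $ i) = (\<Sum>l\<in>UNIV. \<Sum>n\<in>UNIV. C n k l * g x $ n $ j * T x $ l $ i)"
      by (rule sum.swap)
    also have "(\<Sum>l\<in>UNIV. \<Sum>n\<in>UNIV. C n k i * (g x $ l $ j * T x $ l $ n)) = (\<Sum>n\<in>UNIV. C n k i * kform g T n j x)"
      by (subst sum.swap) (simp add: kform_def sum_distrib_left)
    also have "(\<Sum>l\<in>UNIV. \<Sum>n\<in>UNIV. C n k j * (g x $ l $ n * T x $ l $ i)) = (\<Sum>n\<in>UNIV. C n k j * kform g T i n x)"
      by (subst sum.swap) (simp add: kform_def sum_distrib_left)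
    finally show ?thesis by simp
  qed
  \<comment> \<open>In the cyclic sum the Christoffel terms cancel in pairs, by symmetry of the
    lower indices and antisymmetry of the form.\<close>
  have swap: "(\<Sum>n\<in>UNIV. C n a b * kform g T i n x) = - (\<Sum>n\<in>UNIV. C n b a * kform g T n i x)" for a b i
    unfolding sum_negf[symmetric] by (rule sum.cong) (simp_all add: anti[of i] Csym[of _ a b])
  show ?thesis
    unfolding closed_at_def pk
    using swap by (simp add: Csym)
qed

section \<open>Null frames built from eigenvectors of I\<close>

context hk_point
begin

lemma eigen_action:
  assumes s: "I *v s = (- \<i>) *s s"
  shows "K *v s = \<i> *s (J *v s)" "I *v (J *v s) = \<i> *s (J *v s)" "K *v (J *v s) = \<i> *s s"
proof -
  have "- (K *v s) = (- \<i>) *s (J *v s)" unfolding products(3)[symmetric] s by (simp add: lin)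
  then show 1: "K *v s = \<i> *s (J *v s)" by (simp add: vec_eq_iff)
  show "I *v (J *v s) = \<i> *s (J *v s)" unfolding products(1) by (rule 1)
  show "K *v (J *v s) = \<i> *s s" unfolding products(6) s by (simp add: vec_eq_iff)
qed

text \<open>Hermiticity of I gives g(s, t) = (-\<i>)^2 g(s, t) = -g(s, t).\<close>

lemma eigen_null:
  assumes "I *v s = (- \<i>) *s s" "I *v t = (- \<i>) *s t"
  shows "bil G s t = 0"
  using herm[of I s t] unfolding assms by (simp add: bil_linear)

lemma eigen_pairings:
  assumes s: "I *v s = (- \<i>) *s s" and t: "I *v t = (- \<i>) *s t"
  shows "bil G (J *v s) (J *v t) = 0" "bil G s (J *v s) = 0" "bil G t (J *v s) = - bil G s (J *v t)"
proof -
  show "bil G (J *v s) (J *v t) = 0" using herm[of J s t] eigen_null[OF s t] by simp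
  show "bil G s (J *v s) = 0"
    using skew[of J s s] bil_symmetric[OF sym, of s "J *v s"] by simp
  show "bil G t (J *v s) = - bil G s (J *v t)"
    using skew[of J t s] bil_symmetric[OF sym, of "J *v t" s] by simp
qed

text \<open>Among s, J s, t, J t the only nonzero pairings are g(s, J t) = \<rho> and g(J s, t) =
  -\<rho>, up to symmetry. The frame is thus its own dual basis up to the factor \<rho>, and pairing
  reads off coefficients.\<close>

lemma frame_expansion:
  assumes s: "I *v s = (- \<i>) *s s" and t: "I *v t = (- \<i>) *s t" and \<rho>: "\<rho> = bil G s (J *v t)" "\<rho> \<noteq> 0"
  shows "\<rho> *s v = bil G (J *v t) v *s s - bil G t v *s (J *v s) - bil G (J *v s) v *s t + bil G s v *s (J *v t)"
proof -
  \<comment> \<open>The matrix with the frame as columns. The pairings show that it is injective,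
    hence surjective in dimension 4, so every vector is \<open>M *v c\<close> for some c.\<close>
  define M :: cmat where "M = (\<chi> i j. if j = 1 then s $ i else if j = 2 then (J *v s) $ i else if j = 3 then t $ i else (J *v t) $ i)"
  have M: "M *v c = c $ 1 *s s + c $ 2 *s (J *v s) + c $ 3 *s t + c $ 4 *s (J *v t)" for c
    by (simp only: vec_eq_iff matrix_vector_mult_def[of M] vec_lambda_beta sum_4) (simp add: M_def mult.commute)
  note null = eigen_null[OF s s] eigen_null[OF t t] eigen_null[OF s t] eigen_null[OF t s]
    eigen_pairings[OF s t] eigen_pairings[OF t s] eigen_pairings(1)[OF s s] eigen_pairings(1)[OF t t]
  note null' = null[unfolded \<rho>(1)[symmetric]]
  have flip: "bil G (J *v s) s = 0" "bil G (J *v t) t = 0" "bil G (J *v t) s = \<rho>" "bil G (J *v s) t = - \<rho>"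
    using null' \<rho>(1) bil_symmetric[OF sym, of "J *v s" s] bil_symmetric[OF sym, of "J *v t" t]
      bil_symmetric[OF sym, of "J *v t" s] bil_symmetric[OF sym, of "J *v s" t] by simp_all
  have coeff: "bil G (J *v t) (M *v c) = \<rho> * c $ 1" "bil G t (M *v c) = - \<rho> * c $ 2"
    "bil G (J *v s) (M *v c) = - \<rho> * c $ 3" "bil G s (M *v c) = \<rho> * c $ 4" for c
    unfolding M using null' flip by (simp_all add: bil_linear \<rho>(1)[symmetric])
  have "\<exists>N. N ** M = mat 1"
    unfolding matrix_left_invertible_ker
  proof (intro allI impI)
    fix c assume "M *v c = 0"
    then have "c $ 1 = 0" "c $ 2 = 0" "c $ 3 = 0" "c $ 4 = 0"
      using coeff[of c] \<rho>(2) by (simp_all add: bil_linear)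
    then show "c = 0" by (simp add: vec_eq_iff forall_4)
  qed
  then obtain N where "M ** N = mat 1" using matrix_left_right_inverse by blast
  then have v: "v = M *v (N *v v)" by (simp add: matrix_vector_mul_assoc)
  define c where "c = N *v v"
  have "v = M *v c" using v by (simp add: c_def)
  then show ?thesis unfolding \<open>v = M *v c\<close> coeff unfolding M by (simp add: vec_eq_iff algebra_simps)
qed

text \<open>The combinations (J + \<i>K)/2 and (J - \<i>K)/2 are nilpotent: the first kills s and t
  and sends J s, J t to -s, -t, the second kills J s and J t. Their two-forms have rank two and are
  the decomposable forms wanted for the Poincare lemma.\<close>

lemma frame_forms:
  assumes s: "I *v s = (- \<i>) *s s" and t: "I *v t = (- \<i>) *s t" and \<rho>: "\<rho> = bil G s (J *v t)" "\<rho> \<noteq> 0"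
  shows "\<rho> * bil G v w = bil G (J *v t) v * bil G s w + bil G s v * bil G (J *v t) w
      - bil G t v * bil G (J *v s) w - bil G (J *v s) v * bil G t w"
    and "\<rho> * (\<i> * bil G (I *v v) w) = (bil G (J *v t) v * bil G s w - bil G (J *v t) w * bil G s v)
      + (bil G t v * bil G (J *v s) w - bil G t w * bil G (J *v s) v)"
    and "\<rho> * (1 / 2 * bil G (J *v v) w + \<i> / 2 * bil G (K *v v) w) = bil G t v * bil G s w - bil G t w * bil G s v"
    and "\<rho> * (1 / 2 * bil G (J *v v) w - \<i> / 2 * bil G (K *v v) w) =
      bil G (J *v t) v * bil G (J *v s) w - bil G (J *v t) w * bil G (J *v s) v"
proof -
  note e = frame_expansion[OF s t \<rho>, of v]
  note acts = s t eigen_action[OF s] eigen_action[OF t] sq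
  have T: "\<rho> * bil G (T *v v) w = bil G (J *v t) v * bil G (T *v s) w - bil G t v * bil G (T *v (J *v s)) w
      - bil G (J *v s) v * bil G (T *v t) w + bil G s v * bil G (T *v (J *v t)) w" for T
  proof -
    have "\<rho> * bil G (T *v v) w = bil G (T *v (\<rho> *s v)) w" by (simp add: lin bil_linear)
    then show ?thesis unfolding e by (simp add: lin bil_linear)
  qed
  have TI: "\<rho> * bil G (I *v v) w = bil G (J *v t) v * (- \<i> * bil G s w) - bil G t v * (\<i> * bil G (J *v s) w)
      - bil G (J *v s) v * (- \<i> * bil G t w) + bil G s v * (\<i> * bil G (J *v t) w)"
    and TJ: "\<rho> * bil G (J *v v) w = bil G (J *v t) v * bil G (J *v s) w + bil G t v * bil G s w
      - bil G (J *v s) v * bil G (J *v t) w - bil G s v * bil G t w"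
    and TK: "\<rho> * bil G (K *v v) w = bil G (J *v t) v * (\<i> * bil G (J *v s) w) - bil G t v * (\<i> * bil G s w)
      - bil G (J *v s) v * (\<i> * bil G (J *v t) w) + bil G s v * (\<i> * bil G t w)"
    unfolding T acts by (simp_all add: bil_linear)
  have "\<rho> * bil G v w = bil G (\<rho> *s v) w" by (simp add: bil_linear)
  then show "\<rho> * bil G v w = bil G (J *v t) v * bil G s w + bil G s v * bil G (J *v t) w
      - bil G t v * bil G (J *v s) w - bil G (J *v s) v * bil G t w"
    unfolding e by (simp add: bil_linear algebra_simps)
  have ii: "\<i> * (\<i> * x) = - x" for x by (simp add: mult.assoc[symmetric])
  have "\<rho> * (\<i> * bil G (I *v v) w) = \<i> * (\<rho> * bil G (I *v v) w)" by simp
  then show "\<rho> * (\<i> * bil G (I *v v) w) = (bil G (J *v t) v * bil G s w - bil G (J *v t) w * bil G s v)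
      + (bil G t v * bil G (J *v s) w - bil G t w * bil G (J *v s) v)"
    unfolding TI by (simp add: algebra_simps ii)
  have "\<rho> * (1 / 2 * bil G (J *v v) w + \<i> / 2 * bil G (K *v v) w) = 1 / 2 * (\<rho> * bil G (J *v v) w) + \<i> / 2 * (\<rho> * bil G (K *v v) w)"
    by (simp add: algebra_simps)
  also have "\<dots> = bil G t v * bil G s w - bil G t w * bil G s v"
    unfolding TJ TK by (simp add: field_simps ii)
  finally show "\<rho> * (1 / 2 * bil G (J *v v) w + \<i> / 2 * bil G (K *v v) w) = bil G t v * bil G s w - bil G t w * bil G s v" .
  have "\<rho> * (1 / 2 * bil G (J *v v) w - \<i> / 2 * bil G (K *v v) w) = 1 / 2 * (\<rho> * bil G (J *v v) w) - \<i> / 2 * (\<rho> * bil G (K *v v) w)"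
    by (simp add: algebra_simps)
  also have "\<dots> = bil G (J *v t) v * bil G (J *v s) w - bil G (J *v t) w * bil G (J *v s) v"
    unfolding TJ TK by (simp add: field_simps ii)
  finally show "\<rho> * (1 / 2 * bil G (J *v v) w - \<i> / 2 * bil G (K *v v) w) =
      bil G (J *v t) v * bil G (J *v s) w - bil G (J *v t) w * bil G (J *v s) v" .
qed

end

section \<open>Integrability from the bracket condition\<close>

text \<open>Splitting every basis vector into a multiple of e and an element of the kernel shows
  that A is \<theta> wedged with a one-form, so \<theta> \<and> A = 0. It is applied to A =
  d\<theta>.\<close>

lemma frobenius_from_kernel:
  fixes A :: cmat and \<theta> :: "4 \<Rightarrow> complex"
  assumes anti: "\<And>v w. bil A v w = - bil A w v" and e: "ev \<theta> e = 1"
    and ker: "\<And>v w. ev \<theta> v = 0 \<Longrightarrow> ev \<theta> w = 0 \<Longrightarrow> bil A v w = 0"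
  shows "\<theta> i * A $ j $ k + \<theta> j * A $ k $ i + \<theta> k * A $ i $ j = 0"
proof -
  have lin: "ev \<theta> (axis i 1 - \<theta> i *s e) = 0" for i
  proof -
    have "ev \<theta> (axis i 1 - \<theta> i *s e) = ev \<theta> (axis i 1) - \<theta> i * ev \<theta> e"
      by (simp add: ev_def sum_subtractf sum_distrib_left algebra_simps)
    also have "ev \<theta> (axis i 1) = \<theta> i" unfolding ev_def using sum_axis[of \<theta> i 1] by simp
    finally show ?thesis by (simp add: e)
  qed
  have ee: "bil A e e = 0" using anti[of e e] by simp
  have A: "A $ i $ j = \<theta> i * bil A e (axis j 1) - \<theta> j * bil A e (axis i 1)" for i j
    using ker[OF lin lin, of i j] anti[of "axis i 1" e]
    by (simp add: bil_linear bil_axis ee algebra_simps)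
  show ?thesis unfolding A by algebra
qed

text \<open>Cartan's formula d\<theta>(y, w) = y \<theta>(w) - w \<theta>(y) - \<theta>([y, w]), in
  which the first two terms vanish because y and w are annihilated by \<theta> on all of V.\<close>

lemma exterior_derivative_bracket:
  assumes V: "open V" "x \<in> V" and \<theta>: "\<And>j. holo_on (\<theta> j) V" and y: "holo_vec V y" and w: "holo_vec V w"
    and zy: "\<And>x. x \<in> V \<Longrightarrow> ev (\<lambda>j. \<theta> j x) (y x) = 0" and zw: "\<And>x. x \<in> V \<Longrightarrow> ev (\<lambda>j. \<theta> j x) (w x) = 0"
    and br: "ev (\<lambda>j. \<theta> j x) (lie_bracket y w x) = 0"
  shows "bil (\<chi> i j. pd i (\<theta> j) x - pd j (\<theta> i) x) (y x) (w x) = 0"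
proof -
  have d: "(\<Sum>j\<in>UNIV. \<theta> j x * pd i (\<lambda>x. m x $ j) x + pd i (\<theta> j) x * m x $ j) = 0"
    if m: "holo_vec V m" and z: "\<And>x. x \<in> V \<Longrightarrow> ev (\<lambda>j. \<theta> j x) (m x) = 0" for m i
  proof -
    have hm: "holo_on (\<lambda>x. m x $ j) V" for j using m by (simp add: holo_vec_def)
    have "0 = pd i (\<lambda>x. ev (\<lambda>j. \<theta> j x) (m x)) x"
      using pd_cong[OF V, of "\<lambda>x. ev (\<lambda>j. \<theta> j x) (m x)" "\<lambda>x. 0" i] z by simp
    also have "\<dots> = (\<Sum>j\<in>UNIV. pd i (\<lambda>x. \<theta> j x * m x $ j) x)"
      unfolding ev_def by (rule pd_sum[OF holo_on_mult[OF \<theta> hm] V(2)])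
    finally show ?thesis by (simp only: pd_mult[OF \<theta> hm V(2)])
  qed
  have 1: "(\<Sum>i\<in>UNIV. \<Sum>j\<in>UNIV. y x $ i * (\<theta> j x * pd i (\<lambda>x. w x $ j) x + pd i (\<theta> j) x * w x $ j)) = 0"
    unfolding sum_distrib_left[symmetric] by (intro sum.neutral ballI) (simp only: d[OF w zw] mult_zero_right)
  have 2: "(\<Sum>i\<in>UNIV. \<Sum>j\<in>UNIV. w x $ i * (\<theta> j x * pd i (\<lambda>x. y x $ j) x + pd i (\<theta> j) x * y x $ j)) = 0"
    unfolding sum_distrib_left[symmetric] by (intro sum.neutral ballI) (simp only: d[OF y zy] mult_zero_right)
  have 3: "(\<Sum>i\<in>UNIV. \<Sum>j\<in>UNIV. \<theta> j x * (y x $ i * pd i (\<lambda>x. w x $ j) x - w x $ i * pd i (\<lambda>x. y x $ j) x)) = 0"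
  proof -
    have "ev (\<lambda>j. \<theta> j x) (lie_bracket y w x) =
        (\<Sum>j\<in>UNIV. \<Sum>i\<in>UNIV. \<theta> j x * (y x $ i * pd i (\<lambda>x. w x $ j) x - w x $ i * pd i (\<lambda>x. y x $ j) x))"
      by (simp only: ev_def lie_bracket_def vec_lambda_beta sum_distrib_left)
    then show ?thesis using br by (subst sum.swap) simp
  qed
  have "bil (\<chi> i j. pd i (\<theta> j) x - pd j (\<theta> i) x) (y x) (w x) =
      (\<Sum>i\<in>UNIV. \<Sum>j\<in>UNIV. pd i (\<theta> j) x * y x $ i * w x $ j) - (\<Sum>i\<in>UNIV. \<Sum>j\<in>UNIV. pd j (\<theta> i) x * y x $ i * w x $ j)"
    unfolding bil_def by (simp add: sum_subtractf left_diff_distrib)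
  also have "(\<Sum>i\<in>UNIV. \<Sum>j\<in>UNIV. pd j (\<theta> i) x * y x $ i * w x $ j) = (\<Sum>i\<in>UNIV. \<Sum>j\<in>UNIV. pd i (\<theta> j) x * y x $ j * w x $ i)"
    by (rule sum.swap)
  also have "(\<Sum>i\<in>UNIV. \<Sum>j\<in>UNIV. pd i (\<theta> j) x * y x $ i * w x $ j) - \<dots> =
      (\<Sum>i\<in>UNIV. \<Sum>j\<in>UNIV. y x $ i * (\<theta> j x * pd i (\<lambda>x. w x $ j) x + pd i (\<theta> j) x * w x $ j))
      - (\<Sum>i\<in>UNIV. \<Sum>j\<in>UNIV. w x $ i * (\<theta> j x * pd i (\<lambda>x. y x $ j) x + pd i (\<theta> j) x * y x $ j))
      - (\<Sum>i\<in>UNIV. \<Sum>j\<in>UNIV. \<theta> j x * (y x $ i * pd i (\<lambda>x. w x $ j) x - w x $ i * pd i (\<lambda>x. y x $ j) x))"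
    unfolding sum_subtractf[symmetric] by (intro sum.cong refl) (simp add: algebra_simps)
  finally show ?thesis unfolding 1 2 3 by simp
qed

lemma closed_at_linear:
  assumes V: "open V" "x \<in> V" and h: "\<And>i j. holo_on (\<omega>1 i j) V" "\<And>i j. holo_on (\<omega>2 i j) V"
    and eq: "\<And>y i j. y \<in> V \<Longrightarrow> \<omega> i j y = a * \<omega>1 i j y + b * \<omega>2 i j y"
    and c: "closed_at \<omega>1 x" "closed_at \<omega>2 x"
  shows "closed_at \<omega> x"
proof -
  have p: "pd k (\<omega> i j) x = a * pd k (\<omega>1 i j) x + b * pd k (\<omega>2 i j) x" for i j k
  proof -
    have "pd k (\<omega> i j) x = pd k (\<lambda>y. a * \<omega>1 i j y + b * \<omega>2 i j y) x" by (rule pd_cong[OF V eq])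
    also have "\<dots> = pd k (\<lambda>y. a * \<omega>1 i j y) x + pd k (\<lambda>y. b * \<omega>2 i j y) x"
      by (rule pd_add[OF holo_on_cmult[OF h(1)] holo_on_cmult[OF h(2)] V(2)])
    finally show ?thesis by (simp only: pd_cmult[OF h(1) V(2)] pd_cmult[OF h(2) V(2)])
  qed
  show ?thesis
    unfolding closed_at_def p
  proof (intro allI)
    fix i j k
    have "a * (pd i (\<omega>1 j k) x + pd j (\<omega>1 k i) x + pd k (\<omega>1 i j) x) + b * (pd i (\<omega>2 j k) x + pd j (\<omega>2 k i) x + pd k (\<omega>2 i j) x) = 0"
      using c by (simp add: closed_at_def)
    then show "a * pd i (\<omega>1 j k) x + b * pd i (\<omega>2 j k) x + (a * pd j (\<omega>1 k i) x + b * pd j (\<omega>2 k i) x) +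
        (a * pd k (\<omega>1 i j) x + b * pd k (\<omega>2 i j) x) = 0" by (simp add: algebra_simps)
  qed
qed

section \<open>Holomorphic sections adapted to the foliation\<close>

lemma holo_vec_mv: "holo_mat V T \<Longrightarrow> holo_vec V m \<Longrightarrow> holo_vec V (\<lambda>x. T x *v m x)"
  and holo_vec_lincomb: "holo_vec V m \<Longrightarrow> holo_vec V n \<Longrightarrow> holo_vec V (\<lambda>x. c *s m x + d *s n x)"
  and holo_vec_const: "holo_vec V (\<lambda>x. z)"
  and holo_on_bil: "holo_mat V G \<Longrightarrow> holo_vec V m \<Longrightarrow> holo_vec V n \<Longrightarrow> holo_on (\<lambda>x. bil (G x) (m x) (n x)) V"
  unfolding holo_vec_def holo_mat_def bil_def matrix_vector_mult_def
  by (simp_all add: holo_on_sum holo_on_mult holo_on_add holo_on_cmult)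

lemma hk_pointI: "hyper_kaehler U g I J K \<Longrightarrow> x \<in> U \<Longrightarrow> hk_point (g x) (I x) (J x) (K x)"
  unfolding hyper_kaehler_def holo_metric_def hermitian_def by unfold_locales auto

lemma independent_pair:
  assumes "vec.dim (vec.span {X, Y :: cvec}) = 2"
  shows "vec.independent {X, Y}" "X \<noteq> Y"
proof -
  have card: "card {X, Y} \<le> 2" by (simp add: card_insert_if)
  show "vec.independent {X, Y}"
    by (rule vec.card_le_dim_spanning[OF vec.span_superset order_refl]) (simp_all only: card assms finite.intros)
  show "X \<noteq> Y"
  proof
    assume "X = Y"
    then have "vec.dim {X, Y} \<le> 1" using vec.dim_le_card'[of "{X}"] by simp
    then show False using assms by (simp add: vec.dim_span)
  qed
qed

lemma holo_mat_subset: "holo_mat U T \<Longrightarrow> V \<subseteq> U \<Longrightarrow> holo_mat V T"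
  unfolding holo_mat_def using holo_on_subset by blast

lemma holo_vec_subset: "holo_vec U m \<Longrightarrow> V \<subseteq> U \<Longrightarrow> holo_vec V m"
  unfolding holo_vec_def using holo_on_subset by blast

text \<open>J anticommutes with I and so interchanges its two eigenspaces. As B is invariant under
  both, it must meet the eigenspace for -\<i>, and a section is found by projecting a spanning
  field.\<close>

lemma adapted_section:
  assumes hk: "hyper_kaehler U g I J K" and hl: "hyper_lagrangian_foliation U g I J K B" and p: "p \<in> U"
  obtains V s where "open V" "p \<in> V" "V \<subseteq> U" "holo_vec V s" "s p \<noteq> 0"
    "\<And>x. x \<in> V \<Longrightarrow> I x *v s x = (- \<i>) *s s x" "\<And>x. x \<in> V \<Longrightarrow> s x \<in> B x" "\<And>x. x \<in> V \<Longrightarrow> J x *v s x \<in> B x"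
proof -
  have "rank2_distribution U B" using hl by (simp add: hyper_lagrangian_foliation_def)
  from bspec[OF this[unfolded rank2_distribution_def] p]
  obtain V X Y where *: "open V \<and> p \<in> V \<and> V \<subseteq> U \<and> holo_vec V X \<and> holo_vec V Y \<and>
      (\<forall>x\<in>V. B x = vec.span {X x, Y x} \<and> vec.dim (B x) = 2)"
    by (elim exE) (rule that, assumption)
  then have V: "open V" "p \<in> V" "V \<subseteq> U" and XY: "holo_vec V X" "holo_vec V Y"
    and B: "\<forall>x\<in>V. B x = vec.span {X x, Y x} \<and> vec.dim (B x) = 2" by blast+
  have ind: "vec.independent {X x, Y x}" "X x \<noteq> Y x" if "x \<in> V" for x
    using independent_pair[of "X x" "Y x"] B that by metis+
  have Binv: "I x *v v \<in> B x" "J x *v v \<in> B x" if x: "x \<in> V" and v: "v \<in> B x" for x v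
  proof -
    have xU: "x \<in> U" using x V by auto
    interpret hk_point "g x" "I x" "J x" "K x" by (rule hk_pointI[OF hk xU])
    have Bx: "B x = vec.span {X x, Y x}" using B x by blast
    have lag: "bil (g x) (T *v v) w = 0"
      if "T \<in> {I x, J x, K x}" "v \<in> vec.span {X x, Y x}" "w \<in> vec.span {X x, Y x}" for T v w
      using hl xU that unfolding hyper_lagrangian_foliation_def lagrangian_def Bx[symmetric] by auto
    show "I x *v v \<in> B x" "J x *v v \<in> B x"
      using lagrangian_invariant[OF ind[OF x] lag, of v] v unfolding Bx by blast+
  qed
  have sub: "c *s v + d *s w \<in> B x" if "x \<in> V" "v \<in> B x" "w \<in> B x" for c d v w x
    using that B by (auto intro!: vec.span_add vec.span_scale)
  \<comment> \<open>Twice the projection to the eigenspace of I for -\<i>. If it killed both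
    spanning fields at p, then I would act as \<i> on all of B, while J maps such vectors to the
    other eigenspace.\<close>
  define pr where "pr m x = 1 *s m x + \<i> *s (I x *v m x)" for m x
  have "\<exists>m\<in>{X, Y}. pr m p \<noteq> 0"
  proof (rule ccontr)
    assume no: "\<not> ?thesis"
    interpret hk_point "g p" "I p" "J p" "K p" by (rule hk_pointI[OF hk p])
    have "I p *v m = \<i> *s m" if "1 *s m + \<i> *s (I p *v m) = 0" for m
    proof -
      have "\<i> *s (1 *s m + \<i> *s (I p *v m)) = 0" using that by simp
      then show ?thesis by (simp add: vec_eq_iff algebra_simps)
    qed
    then have gen: "I p *v X p = \<i> *s X p" "I p *v Y p = \<i> *s Y p" using no by (auto simp: pr_def)
    have Iv: "I p *v v = \<i> *s v" if "v \<in> B p" for v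
    proof -
      have "v \<in> vec.span {X p, Y p}" using that B V(2) by blast
      then show ?thesis
      proof (induction rule: vec.span_induct_alt)
        case base show ?case by simp
      next
        case (step c x y)
        have "I p *v x = \<i> *s x" using step(1) gen by auto
        then show ?case using step(2) by (simp add: lin vec_eq_iff algebra_simps)
      qed
    qed
    have X: "X p \<in> B p" using B V(2) vec.span_base by blast
    have "K p *v X p = \<i> *s (J p *v X p)" using Iv[OF Binv(2)[OF V(2) X]] by (simp add: products)
    moreover have "- (K p *v X p) = \<i> *s (J p *v X p)" unfolding products(3)[symmetric] gen(1) by (simp add: lin)
    ultimately have "- (\<i> *s (J p *v X p)) = \<i> *s (J p *v X p)" by simp
    then have "J p *v X p = 0" by (simp add: vec_eq_iff neg_eq_iff_add_eq_0)
    then have "X p = 0" using sq(2)[of "X p"] by simp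
    then show False using ind(1)[OF V(2)] vec.dependent_zero[of "{X p, Y p}"] by simp
  qed
  then obtain m where m: "m \<in> {X, Y}" "pr m p \<noteq> 0" by blast
  have hm: "holo_vec V m" using m(1) XY by auto
  have mB: "m x \<in> B x" if "x \<in> V" for x
    using m(1) bspec[OF B that] by (auto intro: vec.span_base)
  have hI: "holo_mat V I" using hk V(3) holo_mat_subset by (auto simp: hyper_kaehler_def)
  have eig: "I x *v pr m x = (- \<i>) *s pr m x" if "x \<in> V" for x
  proof -
    interpret hk_point "g x" "I x" "J x" "K x" by (rule hk_pointI[OF hk]) (use that V in auto)
    show ?thesis unfolding pr_def by (simp add: lin sq vec_eq_iff algebra_simps)
  qed
  have prB: "pr m x \<in> B x" if "x \<in> V" for x
    unfolding pr_def by (rule sub[OF that mB[OF that] Binv(1)[OF that mB[OF that]]])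
  show thesis
  proof (rule that[OF V])
    show "holo_vec V (pr m)" unfolding pr_def[abs_def] by (rule holo_vec_lincomb[OF hm holo_vec_mv[OF hI hm]])
  qed (use m(2) eig prB Binv(2) in auto)
qed

text \<open>The vector q = a s + b J s is orthogonal to B and, lying in the image of the skew map N,
  also to its kernel D. Brackets of sections of B and D are therefore annihilated by \<theta> = g(q,
  .), so d\<theta> vanishes on B \<times> D. The kernel of \<theta> is B + D; the remaining pair
  inside B is reached because q lies in both B and D.\<close>

lemma bracket_frobenius:
  assumes hk: "hyper_kaehler U g I J K" and hl: "hyper_lagrangian_foliation U g I J K B"
    and ac: "alpha_compatible U I J K B" and V: "open V" "V \<subseteq> U" and hs: "holo_vec V s" and ht: "holo_vec V t"
    and es: "\<And>x. x \<in> V \<Longrightarrow> I x *v s x = (- \<i>) *s s x" and et: "\<And>x. x \<in> V \<Longrightarrow> I x *v t x = (- \<i>) *s t x"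
    and sB: "\<And>x. x \<in> V \<Longrightarrow> s x \<in> B x" and JsB: "\<And>x. x \<in> V \<Longrightarrow> J x *v s x \<in> B x"
    and \<rho>: "\<And>x. x \<in> V \<Longrightarrow> bil (g x) (s x) (J x *v t x) \<noteq> 0" and ab: "b * m0 - a * m1 = (1::complex)" and x: "x \<in> V"
  shows "frobenius_at (\<lambda>j x. bil (g x) (a *s s x + b *s (J x *v s x)) (axis j 1)) x"
proof -
  \<comment> \<open>Solves -\<i>\<alpha> = a b, \<beta> + \<i>\<gamma> = b^2, \<beta> - \<i>\<gamma>
    = a^2, which parametrises the null conic. The action on m and J m then has rank one with image a
    m + b J m.\<close>
  define \<alpha> \<beta> \<gamma> where "\<alpha> = \<i> * a * b" and "\<beta> = (a\<^sup>2 + b\<^sup>2) / 2" and "\<gamma> = - \<i> * (b\<^sup>2 - a\<^sup>2) / 2"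
  have bg: "\<beta> + \<i> * \<gamma> = b\<^sup>2" "\<beta> - \<i> * \<gamma> = a\<^sup>2"
    by (simp_all add: \<beta>_def \<gamma>_def field_simps)
  have null: "\<alpha>\<^sup>2 + \<beta>\<^sup>2 + \<gamma>\<^sup>2 = 0"
  proof -
    have 1: "\<beta>\<^sup>2 + \<gamma>\<^sup>2 = (\<beta> + \<i> * \<gamma>) * (\<beta> - \<i> * \<gamma>)" by (simp add: algebra_simps power2_eq_square)
    have 2: "\<alpha>\<^sup>2 = - (b\<^sup>2 * a\<^sup>2)" by (simp add: \<alpha>_def power_mult_distrib)
    show ?thesis unfolding add.assoc 1 bg 2 by simp
  qed
  have nz: "(\<alpha>, \<beta>, \<gamma>) \<noteq> (0, 0, 0)"
  proof
    assume "(\<alpha>, \<beta>, \<gamma>) = (0, 0, 0)"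
    then have "a = 0" "b = 0" using bg by simp_all
    then show False using ab by simp
  qed
  define D where "D = alpha_distribution I J K \<alpha> \<beta> \<gamma>"
  define N where "N x v = \<alpha> *s (I x *v v) + \<beta> *s (J x *v v) + \<gamma> *s (K x *v v)" for x v
  have D: "v \<in> D x \<longleftrightarrow> N x v = 0" for v x by (simp add: D_def alpha_distribution_def N_def)
  have Nact: "N x (c0 *s m + c1 *s (J x *v m)) = (b * c0 - a * c1) *s (a *s m + b *s (J x *v m))"
    if x: "x \<in> U" and m: "I x *v m = (- \<i>) *s m" for x m c0 c1
  proof -
    interpret hk_point "g x" "I x" "J x" "K x" by (rule hk_pointI[OF hk x])
    note act = m eigen_action[OF m] sq(2)
    have "N x (c0 *s m + c1 *s (J x *v m)) = c0 *s (N x m) + c1 *s (N x (J x *v m))"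
      unfolding N_def by (simp add: lin vec_eq_iff algebra_simps)
    also have "N x m = (- \<i> * \<alpha>) *s m + (\<beta> + \<i> * \<gamma>) *s (J x *v m)"
      unfolding N_def act by (simp add: vec_eq_iff algebra_simps)
    also have "N x (J x *v m) = (\<i> * \<alpha>) *s (J x *v m) - (\<beta> - \<i> * \<gamma>) *s m"
      unfolding N_def act by (simp add: vec_eq_iff algebra_simps)
    finally show ?thesis unfolding bg \<alpha>_def by (simp add: vec_eq_iff algebra_simps power2_eq_square)
  qed
  have Nskew: "bil (g x) (N x v) w = - bil (g x) v (N x w)" if "x \<in> U" for x v w
  proof -
    interpret hk_point "g x" "I x" "J x" "K x" by (rule hk_pointI[OF hk that])
    show ?thesis unfolding N_def by (simp add: bil_linear skew)
  qed
  have hg: "holo_mat V g" and hJ: "holo_mat V J" using hk V(2) holo_mat_subset by (auto simp: hyper_kaehler_def holo_metric_def)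
  define q where "q x = a *s s x + b *s (J x *v s x)" for x
  define r where "r x = a *s t x + b *s (J x *v t x)" for x
  have hJs: "holo_vec V (\<lambda>x. J x *v s x)" and hJt: "holo_vec V (\<lambda>x. J x *v t x)"
    using holo_vec_mv[OF hJ] hs ht by blast+
  have hq: "holo_vec V q" and hr: "holo_vec V r"
    unfolding q_def[abs_def] r_def[abs_def] by (rule holo_vec_lincomb; fact)+
  have ND: "N y (q y) = 0" "N y (r y) = 0" if "y \<in> V" for y
  proof -
    have y: "y \<in> U" using that V(2) by blast
    show "N y (q y) = 0" "N y (r y) = 0"
      unfolding q_def r_def Nact[OF y es[OF that]] Nact[OF y et[OF that]] by (simp_all add: mult.commute)
  qed
  define \<theta> where "\<theta> j x = bil (g x) (q x) (axis j 1)" for j x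
  have ev\<theta>: "ev (\<lambda>j. \<theta> j x) v = bil (g x) (q x) v" for x v unfolding \<theta>_def by (rule ev_bil)
  have h\<theta>: "holo_on (\<theta> j) V" for j unfolding \<theta>_def[abs_def] by (rule holo_on_bil[OF hg hq holo_vec_const])
  have pair: "bil (g y) (q y) (s y) = 0" "bil (g y) (q y) (J y *v s y) = 0"
    "bil (g y) (q y) (t y) = - b * bil (g y) (s y) (J y *v t y)" "bil (g y) (q y) (J y *v t y) = a * bil (g y) (s y) (J y *v t y)"
    if y: "y \<in> V" for y
  proof -
    interpret hk_point "g y" "I y" "J y" "K y" by (rule hk_pointI[OF hk]) (use y V in auto)
    note e = es[OF y] et[OF y]
    show "bil (g y) (q y) (s y) = 0" "bil (g y) (q y) (J y *v s y) = 0"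
      "bil (g y) (q y) (t y) = - b * bil (g y) (s y) (J y *v t y)" "bil (g y) (q y) (J y *v t y) = a * bil (g y) (s y) (J y *v t y)"
      unfolding q_def
      using eigen_null[OF e(1) e(1)] eigen_null[OF e] eigen_pairings[OF e] eigen_pairings[OF e(1) e(1)]
        bil_symmetric[OF sym, of "J y *v s y" "s y"] bil_symmetric[OF sym, of "J y *v s y" "t y"]
      by (simp_all add: bil_linear)
  qed
  have qq: "bil (g y) (q y) (q y) = 0" "bil (g y) (q y) (r y) = 0" if y: "y \<in> V" for y
  proof -
    have "bil (g y) (q y) (a *s s y + b *s (J y *v s y)) = 0"
      unfolding bil_add_right bil_smult_right pair[OF y] by simp
    then show "bil (g y) (q y) (q y) = 0" unfolding q_def[symmetric] .
    show "bil (g y) (q y) (r y) = 0" unfolding r_def bil_add_right bil_smult_right pair[OF y] by simp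
  qed
  define A :: cmat where "A = (\<chi> i j. pd i (\<theta> j) x - pd j (\<theta> i) x)"
  have bracket: "bil A (y x) (w x) = 0"
    if y: "holo_vec V y" "\<And>x. x \<in> V \<Longrightarrow> y x \<in> B x" "\<And>x. x \<in> V \<Longrightarrow> bil (g x) (q x) (y x) = 0"
      and w: "holo_vec V w" "\<And>x. x \<in> V \<Longrightarrow> N x (w x) = 0" "\<And>x. x \<in> V \<Longrightarrow> bil (g x) (q x) (w x) = 0" for y w
  proof -
    have "local_section U B V y" "local_section U D V w"
      using y w V by (auto simp: local_section_def D)
    moreover have "brackets_within U B D (dist_sum B D)"
      using ac nz null unfolding alpha_compatible_def D_def by blast
    ultimately have "lie_bracket y w x \<in> dist_sum B D x"
      using x unfolding brackets_within_def by blast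
    then obtain v1 w1 where vw: "lie_bracket y w x = v1 + w1" "v1 \<in> B x" "N x w1 = 0"
      unfolding dist_sum_def D by blast
    have xU: "x \<in> U" using x V by auto
    have "bil (g x) (q x) v1 = 0"
    proof -
      interpret hk_point "g x" "I x" "J x" "K x" by (rule hk_pointI[OF hk xU])
      have lag: "bil (g x) (I x *v v) v1 = 0" if "v \<in> B x" for v
        using hl xU that vw(2) unfolding hyper_lagrangian_foliation_def lagrangian_def by auto
      have "bil (g x) (s x) v1 = 0" "bil (g x) (J x *v s x) v1 = 0"
        using lag[OF sB[OF x]] lag[OF JsB[OF x]] unfolding es[OF x] eigen_action(2)[OF es[OF x]] by (simp_all add: bil_linear)
      then show ?thesis by (simp add: q_def bil_linear)
    qed
    moreover have "bil (g x) (q x) w1 = 0"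
    proof -
      \<comment> \<open>The numbers m0, m1 serve as a preimage of q under N, by the relation b m0 -
        a m1 = 1.\<close>
      have "q x = N x (m0 *s s x + m1 *s (J x *v s x))"
        using Nact[OF xU es[OF x]] ab by (simp add: q_def)
      then show ?thesis using Nskew[OF xU] vw(3) by (simp add: bil_linear)
    qed
    ultimately have "ev (\<lambda>j. \<theta> j x) (lie_bracket y w x) = 0" unfolding ev\<theta> vw(1) by (simp add: bil_linear)
    then show ?thesis
      unfolding A_def using y w by (intro exterior_derivative_bracket[OF V(1) x h\<theta>]) (simp_all add: ev\<theta>)
  qed
  have As: "bil A (s x) (q x) = 0" "bil A (s x) (r x) = 0" "bil A (J x *v s x) (q x) = 0" "bil A (J x *v s x) (r x) = 0"
    using bracket[OF hs sB pair(1) hq ND(1) qq(1)] bracket[OF hs sB pair(1) hr ND(2) qq(2)]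
      bracket[OF hJs JsB pair(2) hq ND(1) qq(1)] bracket[OF hJs JsB pair(2) hr ND(2) qq(2)] by auto
  have anti: "bil A v w = - bil A w v" for v w
  proof -
    have "bil A v w = (\<Sum>i\<in>UNIV. \<Sum>j\<in>UNIV. A $ j $ i * v $ j * w $ i)" unfolding bil_def by (rule sum.swap)
    also have "\<dots> = - bil A w v"
      unfolding bil_def sum_negf[symmetric] by (intro sum.cong refl) (simp add: A_def algebra_simps)
    finally show ?thesis .
  qed
  have zz: "bil A v v = 0" for v using anti[of v v] by simp
  \<comment> \<open>Pairing s and J s with q in d\<theta> gives b d\<theta>(s, J s) = 0 and a
    d\<theta>(s, J s) = 0, and a, b do not both vanish.\<close>
  have sJs: "bil A (s x) (J x *v s x) = 0"
  proof -
    have "b * bil A (s x) (J x *v s x) = 0" "a * bil A (s x) (J x *v s x) = 0"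
      using As(1,3) anti[of "J x *v s x" "s x"] by (simp_all add: q_def bil_linear zz)
    moreover have "bil A (s x) (J x *v s x) = m0 * (b * bil A (s x) (J x *v s x)) - m1 * (a * bil A (s x) (J x *v s x))"
      using arg_cong[OF ab, of "\<lambda>z. z * bil A (s x) (J x *v s x)"] by (simp add: algebra_simps)
    ultimately show ?thesis by auto
  qed
  let ?\<rho> = "bil (g x) (s x) (J x *v t x)"
  have ker: "bil A v w = 0" if v: "ev (\<lambda>j. \<theta> j x) v = 0" and w: "ev (\<lambda>j. \<theta> j x) w = 0" for v w
  proof -
    interpret hk_point "g x" "I x" "J x" "K x" by (rule hk_pointI[OF hk]) (use x V in auto)
    \<comment> \<open>On the kernel of \<theta> the t and J t components are proportional to (a, b),
      so the kernel is spanned by s, J s and r; m0, m1 recover the factor of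
      proportionality.\<close>
    have e: "?\<rho> *s v = bil (g x) (J x *v t x) v *s s x - bil (g x) (t x) v *s (J x *v s x)
        + (m0 * bil (g x) (s x) v + m1 * bil (g x) (J x *v s x) v) *s r x" if v: "bil (g x) (q x) v = 0" for v
    proof -
      let ?t0 = "bil (g x) (s x) v" and ?t1 = "bil (g x) (J x *v s x) v"
      have k: "a * ?t0 + b * ?t1 = 0" using v by (simp add: q_def bil_linear)
      have "(m0 * ?t0 + m1 * ?t1) * a = m0 * (a * ?t0 + b * ?t1) - (b * m0 - a * m1) * ?t1" by algebra
      then have 1: "(m0 * ?t0 + m1 * ?t1) * a = - ?t1" unfolding k ab by simp
      have "(m0 * ?t0 + m1 * ?t1) * b = m1 * (a * ?t0 + b * ?t1) + (b * m0 - a * m1) * ?t0" by algebra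
      then have 2: "(m0 * ?t0 + m1 * ?t1) * b = ?t0" unfolding k ab by simp
      have "(m0 * ?t0 + m1 * ?t1) *s r x = ((m0 * ?t0 + m1 * ?t1) * a) *s t x + ((m0 * ?t0 + m1 * ?t1) * b) *s (J x *v t x)"
        by (simp add: r_def vec_eq_iff algebra_simps)
      also have "\<dots> = - (?t1 *s t x) + ?t0 *s (J x *v t x)" unfolding 1 2 by simp
      finally show ?thesis
        using frame_expansion[OF es[OF x] et[OF x] refl \<rho>[OF x], of v] by simp
    qed
    have "?\<rho> * (?\<rho> * bil A v w) = bil A (?\<rho> *s v) (?\<rho> *s w)" by (simp add: bil_linear)
    also have "\<dots> = 0"
      unfolding e[OF v[unfolded ev\<theta>]] e[OF w[unfolded ev\<theta>]]
      using As sJs anti[of "J x *v s x" "s x"] anti[of "r x" "s x"] anti[of "r x" "J x *v s x"]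
      by (simp add: bil_linear zz)
    finally show ?thesis using \<rho>[OF x] by simp
  qed
  \<comment> \<open>A vector transversal to the kernel, using \<theta>(t) = -b \<rho> and \<theta>(J
    t) = a \<rho>.\<close>
  have "ev (\<lambda>j. \<theta> j x) ((1 / ?\<rho>) *s ((- m0) *s t x + (- m1) *s (J x *v t x))) = 1"
  proof -
    have "ev (\<lambda>j. \<theta> j x) ((1 / ?\<rho>) *s ((- m0) *s t x + (- m1) *s (J x *v t x))) = b * m0 - a * m1"
      unfolding ev\<theta> bil_smult_right bil_add_right pair[OF x] using \<rho>[OF x] by (simp add: field_simps)
    then show ?thesis by (simp add: ab)
  qed
  then have "\<theta> i x * A $ j $ k + \<theta> j x * A $ k $ i + \<theta> k x * A $ i $ j = 0" for i j k
    by (rule frobenius_from_kernel[OF anti _ ker])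
  then have "frobenius_at \<theta> x" by (simp add: frobenius_at_def A_def)
  then show ?thesis unfolding \<theta>_def[abs_def] q_def .
qed

theorem normal_form_exists:
  assumes hk: "hyper_kaehler U g I J K" and hl: "hyper_lagrangian_foliation U g I J K B"
    and ac: "alpha_compatible U I J K B" and p: "p \<in> U"
  shows "\<exists>V \<phi> W A D. p \<in> V \<and> V \<subseteq> U \<and> local_coordinates V \<phi> \<and> admissible W A D \<and>
    (\<forall>x\<in>V. base (\<phi> x) \<in> W) \<and>
    (\<forall>x\<in>V. \<forall>v w. bil (g x) v w = bil (normal_metric A D (\<phi> x)) (differential \<phi> x v) (differential \<phi> x w))"
proof -
  obtain V0 s where V0: "open V0" "p \<in> V0" "V0 \<subseteq> U" and hs0: "holo_vec V0 s" and sp: "s p \<noteq> 0"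
    and es0: "\<And>x. x \<in> V0 \<Longrightarrow> I x *v s x = (- \<i>) *s s x" and sB0: "\<And>x. x \<in> V0 \<Longrightarrow> s x \<in> B x"
    and JsB0: "\<And>x. x \<in> V0 \<Longrightarrow> J x *v s x \<in> B x"
    by (rule adapted_section[OF hk hl p]) (rule that)
  have hp: "x \<in> U \<Longrightarrow> hk_point (g x) (I x) (J x) (K x)" for x by (rule hk_pointI[OF hk])
  \<comment> \<open>A constant vector is enough: the field \<open>t\<close> is twice its projection
    to the eigenspace of I for -\<i>, and g(J s, t) = 2 g(J s, z) at p. This makes \<rho> nonzero at
    p, hence nearby.\<close>
  obtain z where z: "bil (g p) (J p *v s p) z \<noteq> 0"
  proof -
    interpret hk_point "g p" "I p" "J p" "K p" by (rule hp[OF p])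
    have "J p *v s p \<noteq> 0" using sq(2)[of "s p"] sp by auto
    then have "\<exists>z. bil (g p) (J p *v s p) z \<noteq> 0" using bil_nondegenerate[OF sym inv] by blast
    then show thesis using that by blast
  qed
  define t where "t x = 1 *s z + \<i> *s (I x *v z)" for x
  have U: "open U" and gU: "holo_metric U g" and hU: "holo_mat U g" "holo_mat U I" "holo_mat U J" "holo_mat U K"
    and pU: "parallel U g I" "parallel U g J" "parallel U g K"
    using hk by (auto simp: hyper_kaehler_def holo_metric_def)
  have et: "I x *v t x = (- \<i>) *s t x" if "x \<in> U" for x
  proof -
    interpret hk_point "g x" "I x" "J x" "K x" by (rule hp[OF that])
    show ?thesis unfolding t_def by (simp add: lin sq vec_eq_iff algebra_simps)
  qed
  have htU: "holo_vec U t" unfolding t_def[abs_def]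
    by (rule holo_vec_lincomb[OF holo_vec_const holo_vec_mv[OF hU(2) holo_vec_const]])
  define \<rho> where "\<rho> x = bil (g x) (s x) (J x *v t x)" for x
  have h\<rho>0: "holo_on \<rho> V0" unfolding \<rho>_def[abs_def]
    by (intro holo_on_bil holo_vec_mv hs0 holo_mat_subset[OF _ V0(3)] holo_vec_subset[OF htU V0(3)] hU)
  have \<rho>p: "\<rho> p \<noteq> 0"
  proof -
    interpret hk_point "g p" "I p" "J p" "K p" by (rule hp[OF p])
    let ?b = "bil (g p) (J p *v s p) z"
    have "bil (g p) (J p *v s p) (I p *v z) = - bil (g p) (I p *v (J p *v s p)) z"
      using skew[of "I p" "J p *v s p" z] by simp
    also have "\<dots> = - \<i> * ?b" unfolding eigen_action(2)[OF es0[OF V0(2)]] by (simp add: bil_linear)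
    finally have "bil (g p) (J p *v s p) (t p) = 2 * ?b"
      unfolding t_def by (simp add: bil_linear mult.assoc[symmetric])
    then have "- \<rho> p = 2 * ?b" using skew[of "J p" "s p" "t p"] by (simp add: \<rho>_def)
    then show ?thesis using z by auto
  qed
  define V where "V = {x \<in> V0. \<rho> x \<noteq> 0}"
  have V: "open V" "p \<in> V" "V \<subseteq> V0" "V \<subseteq> U"
    using open_nonzero_set[OF V0(1) h\<rho>0] V0 \<rho>p by (auto simp: V_def)
  have \<rho>: "\<rho> x \<noteq> 0" if "x \<in> V" for x using that by (simp add: V_def)
  have h\<rho>: "holo_on \<rho> V" by (rule holo_on_subset[OF h\<rho>0 V(3)])
  note hV = holo_mat_subset[OF hU(1) V(4)] holo_mat_subset[OF hU(3) V(4)]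
  have hs: "holo_vec V s" by (rule holo_vec_subset[OF hs0 V(3)])
  have ht: "holo_vec V t" by (rule holo_vec_subset[OF htU V(4)])
  have hJs: "holo_vec V (\<lambda>x. J x *v s x)" and hJt: "holo_vec V (\<lambda>x. J x *v t x)"
    by (rule holo_vec_mv[OF hV(2) hs], rule holo_vec_mv[OF hV(2) ht])
  have es: "I x *v s x = (- \<i>) *s s x" and sB: "s x \<in> B x" and JsB: "J x *v s x \<in> B x"
    and etV: "I x *v t x = (- \<i>) *s t x" and xU: "x \<in> U" if "x \<in> V" for x
    using that V(3,4) es0 sB0 JsB0 et by blast+
  have \<rho>': "bil (g x) (s x) (J x *v t x) \<noteq> 0" if "x \<in> V" for x using \<rho>[OF that] by (simp add: \<rho>_def)
  define \<theta>0 where "\<theta>0 j x = bil (g x) (s x) (axis j 1)" for j x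
  define \<theta>1 where "\<theta>1 j x = bil (g x) (J x *v s x) (axis j 1)" for j x
  define \<kappa>0 where "\<kappa>0 j x = bil (g x) (t x) (axis j 1) / \<rho> x" for j x
  define \<kappa>1 where "\<kappa>1 j x = bil (g x) (J x *v t x) (axis j 1) / \<rho> x" for j x
  have frob: "frobenius_at (\<lambda>j x. bil (g x) (a *s s x + b *s (J x *v s x)) (axis j 1)) x"
    if "b * m0 - a * m1 = 1" "x \<in> V" for a b m0 m1 x
    by (rule bracket_frobenius[OF hk hl ac V(1,4) hs ht es etV sB JsB \<rho>' that])
  have f0: "frobenius_at \<theta>0 x" and f1: "frobenius_at \<theta>1 x" and f01: "frobenius_at (\<lambda>i x. \<theta>0 i x + \<theta>1 i x) x" if "x \<in> V" for x
  proof -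
    \<comment> \<open>The three points of the conic are (a, b) = (1, 0), (0, 1) and (1, 1), each
      with a pair m0, m1 satisfying b m0 - a m1 = 1.\<close>
    have "\<theta>0 = (\<lambda>j x. bil (g x) (1 *s s x + 0 *s (J x *v s x)) (axis j 1))"
      "\<theta>1 = (\<lambda>j x. bil (g x) (0 *s s x + 1 *s (J x *v s x)) (axis j 1))"
      "(\<lambda>i x. \<theta>0 i x + \<theta>1 i x) = (\<lambda>j x. bil (g x) (1 *s s x + 1 *s (J x *v s x)) (axis j 1))"
      unfolding \<theta>0_def[abs_def] \<theta>1_def[abs_def] by (simp_all add: bil_linear)
    then show "frobenius_at \<theta>0 x" "frobenius_at \<theta>1 x" "frobenius_at (\<lambda>i x. \<theta>0 i x + \<theta>1 i x) x"
      using frob[of 0 0 1 "- 1", OF _ that] frob[of 1 1 0 0, OF _ that] frob[of 1 1 1 0, OF _ that]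
      by simp_all
  qed
  have anti: "kform g T i j x = - kform g T j i x" if x: "x \<in> V" and T: "T \<in> {I, J, K}" for T i j x
  proof -
    interpret hk_point "g x" "I x" "J x" "K x" by (rule hp[OF xU[OF x]])
    show ?thesis unfolding kform_eq_bil using skew[of "T x" "axis i 1" "axis j 1"] T bil_symmetric[OF sym] by auto
  qed
  have ck: "closed_at (kform g T) x" if x: "x \<in> V" and T: "T \<in> {I, J, K}" for T x
    by (rule closed_kform[OF U xU[OF x] gU _ _ anti[OF x T]]) (use T hU pU in auto)
  have hk': "holo_on (kform g T i j) V" if "T \<in> {I, J, K}" for T i j
    using that hU by (intro holo_on_subset[OF holo_kform V(4)]) auto
  \<comment> \<open>The frame identities divided by \<rho>. The wedge products become combinations
    of Kaehler forms with constant coefficients; the summand with coefficient 0 in \<open>w2\<close>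
    gives it the shape expected by \<open>closed_at_linear\<close>.\<close>
  have w0: "wedge \<kappa>0 \<theta>0 i j x = 1 / 2 * kform g J i j x + \<i> / 2 * kform g K i j x"
    and w1: "wedge \<kappa>1 \<theta>1 i j x = 1 / 2 * kform g J i j x + (- \<i> / 2) * kform g K i j x"
    and w2: "wedge \<kappa>1 \<theta>0 i j x + wedge \<kappa>0 \<theta>1 i j x = \<i> * kform g I i j x + 0 * kform g I i j x"
    and met: "g x $ i $ j = \<kappa>1 i x * \<theta>0 j x + \<theta>0 i x * \<kappa>1 j x - \<kappa>0 i x * \<theta>1 j x - \<theta>1 i x * \<kappa>0 j x"
    if x: "x \<in> V" for x i j
  proof -
    note f = hk_point.frame_forms[OF hp[OF xU[OF x]] es[OF x] etV[OF x] \<rho>_def \<rho>[OF x], of "axis i 1" "axis j 1"]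
    note d = wedge_def \<kappa>0_def \<kappa>1_def \<theta>0_def \<theta>1_def kform_eq_bil
    have div: "\<rho> x * a = b \<Longrightarrow> b / \<rho> x = a" for a b using \<rho>[OF x] by (auto simp: field_simps)
    show "wedge \<kappa>0 \<theta>0 i j x = 1 / 2 * kform g J i j x + \<i> / 2 * kform g K i j x"
      using div[OF f(3)] unfolding d by (simp add: diff_divide_distrib)
    show "wedge \<kappa>1 \<theta>1 i j x = 1 / 2 * kform g J i j x + (- \<i> / 2) * kform g K i j x"
      using div[OF f(4)] unfolding d by (simp add: diff_divide_distrib)
    show "wedge \<kappa>1 \<theta>0 i j x + wedge \<kappa>0 \<theta>1 i j x = \<i> * kform g I i j x + 0 * kform g I i j x"
      using div[OF f(2)] unfolding d by (simp add: diff_divide_distrib add_divide_distrib)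
    show "g x $ i $ j = \<kappa>1 i x * \<theta>0 j x + \<theta>0 i x * \<kappa>1 j x - \<kappa>0 i x * \<theta>1 j x - \<theta>1 i x * \<kappa>0 j x"
      using div[OF f(1)] unfolding d bil_axis by (simp add: diff_divide_distrib add_divide_distrib)
  qed
  have c0: "closed_at (wedge \<kappa>0 \<theta>0) x" if x: "x \<in> V" for x
    by (rule closed_at_linear[OF V(1) x hk' hk' w0 ck[OF x] ck[OF x]]) simp_all
  have c1: "closed_at (wedge \<kappa>1 \<theta>1) x" if x: "x \<in> V" for x
    by (rule closed_at_linear[OF V(1) x hk' hk' w1 ck[OF x] ck[OF x]]) simp_all
  have c2: "closed_at (\<lambda>i j x. wedge \<kappa>1 \<theta>0 i j x + wedge \<kappa>0 \<theta>1 i j x) x" if x: "x \<in> V" for x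
    by (rule closed_at_linear[OF V(1) x hk' hk' w2 ck[OF x] ck[OF x]]) simp_all
  have co: "v = 0" if "ev (\<lambda>i. \<theta>0 i p) v = 0" "ev (\<lambda>i. \<theta>1 i p) v = 0" "ev (\<lambda>i. \<kappa>0 i p) v = 0" "ev (\<lambda>i. \<kappa>1 i p) v = 0" for v
  proof -
    have e: "ev (\<lambda>j. bil (g p) m (axis j 1) / \<rho> p) v = bil (g p) m v / \<rho> p" for m
      using ev_smult[of "1 / \<rho> p" "\<lambda>j. bil (g p) m (axis j 1)" v] by (simp add: ev_bil)
    have "\<rho> p *s v = 0"
      using that \<rho>[OF V(2)] unfolding hk_point.frame_expansion[OF hp[OF p] es[OF V(2)] etV[OF V(2)] \<rho>_def \<rho>[OF V(2)], of v]
        \<theta>0_def \<theta>1_def \<kappa>0_def \<kappa>1_def e ev_bil by simp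
    then show ?thesis using \<rho>[OF V(2)] by simp
  qed
  have hol: "holo_on (\<theta>0 j) V" "holo_on (\<theta>1 j) V" "holo_on (\<kappa>0 j) V" "holo_on (\<kappa>1 j) V" for j
    unfolding \<theta>0_def[abs_def] \<theta>1_def[abs_def] \<kappa>0_def[abs_def] \<kappa>1_def[abs_def]
    by (intro holo_on_divide holo_on_bil[OF hV(1)] hs ht hJs hJt h\<rho> holo_vec_const \<rho>; assumption)+
  have "\<exists>V' \<phi> W A D. p \<in> V' \<and> V' \<subseteq> V \<and> local_coordinates V' \<phi> \<and> admissible W A D \<and>
    (\<forall>x\<in>V'. base (\<phi> x) \<in> W) \<and>
    (\<forall>x\<in>V'. \<forall>v w. bil (g x) v w = bil (normal_metric A D (\<phi> x)) (differential \<phi> x v) (differential \<phi> x w))"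
    by (rule coframe_normal_form[OF V(1,2) hol f0 f1 f01 c0 c1 c2 co met])
  then obtain V' \<phi> W A D where "p \<in> V' \<and> V' \<subseteq> V \<and> local_coordinates V' \<phi> \<and> admissible W A D \<and>
    (\<forall>x\<in>V'. base (\<phi> x) \<in> W) \<and>
    (\<forall>x\<in>V'. \<forall>v w. bil (g x) v w = bil (normal_metric A D (\<phi> x)) (differential \<phi> x v) (differential \<phi> x w))"
    by (elim exE) (rule that, assumption)
  then have "p \<in> V' \<and> V' \<subseteq> U \<and> local_coordinates V' \<phi> \<and> admissible W A D \<and>
    (\<forall>x\<in>V'. base (\<phi> x) \<in> W) \<and>
    (\<forall>x\<in>V'. \<forall>v w. bil (g x) v w = bil (normal_metric A D (\<phi> x)) (differential \<phi> x v) (differential \<phi> x w))"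
    using V(4) by auto
  then show ?thesis by (intro exI)
qed

section \<open>The hyper-Kaehler structure of a normal metric\<close>

locale normal_form =
  fixes W :: "(complex ^ 2) set" and A D :: "complex ^ 2 \<Rightarrow> complex"
  assumes adm: "admissible W A D"
begin

definition "U = {u::cvec. base u \<in> W}"
definition "a u = A (base u)"
definition "a\<^sub>1 u = pd 1 A (base u)"
definition "a\<^sub>2 u = pd 2 A (base u)"
definition "h u = u $ 1 * a\<^sub>1 u - u $ 3 * a\<^sub>2 u / (a u)\<^sup>2 + D (base u)" for u :: cvec
definition "g = normal_metric A D"
text \<open>The eigenvalues of I on the coordinate fields: -\<i> on those of u^1, u^2 and \<i> on
  the tilde ones.\<close>

definition eps :: "4 \<Rightarrow> complex" where "eps i = (if i = 1 \<or> i = 2 then - \<i> else \<i>)"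
definition I :: "cvec \<Rightarrow> cmat" where "I u = (\<chi> i j. if i = j then eps i else 0)"
text \<open>Determined by prescribing its Kaehler form to have constant coefficients: 1/2 for du^1
  \<and> du^2 and -1/2 for the corresponding tilde product. This is d\<xi> \<and> du + d\<eta>
  \<and> dv, the sum of the two decomposable forms of the forward direction.\<close>

definition J :: "cvec \<Rightarrow> cmat" where "J u = (\<chi> i j.
  (of_bool (i = 2 \<and> j = 4) + of_bool (i = 3 \<and> j = 1)) * a u
  + (- of_bool (i = 1 \<and> j = 3) - of_bool (i = 4 \<and> j = 2)) * (1 / a u)
  + (of_bool (i = 3 \<and> j = 2) - of_bool (i = 1 \<and> j = 4)) * h u)"
definition K :: "cvec \<Rightarrow> cmat" where "K u = (\<chi> i j. eps i * J u $ i $ j)"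
definition B :: "cvec \<Rightarrow> cvec set" where "B u = {v. v $ 2 = 0 \<and> v $ 4 = 0}"

lemma open_U: "open U"
proof -
  have eq: "base u = (\<chi> i. if i = 1 then u $ 2 else u $ 4)" for u :: cvec
    by (simp add: base_def vec_eq_iff forall_2)
  have "continuous_on UNIV (\<lambda>u::cvec. if i = 1 then u $ 2 else u $ 4)" for i :: 2
    by (cases "i = 1") (auto intro!: continuous_intros)
  then have "continuous_on UNIV base" unfolding eq[abs_def] by (intro continuous_on_vec_lambda)
  moreover have "open W" using adm by (simp add: admissible_def)
  ultimately have "open (base -` W)" by (simp add: open_vimage)
  then show ?thesis by (simp add: U_def vimage_def)
qed

lemma a_nz: "u \<in> U \<Longrightarrow> a u \<noteq> 0"
  using adm by (simp add: U_def a_def admissible_def)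

lemma holo_a: "holo_on a U"
  and pd_a: "u \<in> U \<Longrightarrow> pd k a u = of_bool (k = 2) * a\<^sub>1 u + of_bool (k = 4) * a\<^sub>2 u"
  using adm holo_on_base[of A W U] pd_base[of A W U u k]
  by (simp_all add: admissible_def U_def a_def[abs_def] a\<^sub>1_def a\<^sub>2_def)

lemma holo_inv_a: "holo_on (\<lambda>u. 1 / a u) U"
  and pd_inv_a: "u \<in> U \<Longrightarrow> pd k (\<lambda>u. 1 / a u) u = - pd k a u / (a u)\<^sup>2"
  using holo_on_divide[OF holo_on_const holo_a a_nz] pd_divide[OF holo_on_const holo_a a_nz, of u k 1]
  by simp_all

lemma holo_h: "holo_on h U"
  and pd_h: "u \<in> U \<Longrightarrow> pd 1 h u = a\<^sub>1 u" "u \<in> U \<Longrightarrow> pd 3 h u = - a\<^sub>2 u / (a u)\<^sup>2"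
proof -
  have W: "open W" and hA: "holo_on A W" and hD: "holo_on D W" using adm by (simp_all add: admissible_def)
  note b = holo_on_base[of _ W U] pd_base[of _ W U]
  have h1: "holo_on a\<^sub>1 U" and h2: "holo_on a\<^sub>2 U" and hd: "holo_on (\<lambda>u. D (base u)) U"
    using b(1)[OF holo_on_pd[OF W hA]] b(1)[OF hD] by (simp_all add: U_def a\<^sub>1_def[abs_def] a\<^sub>2_def[abs_def])
  have p1: "pd k a\<^sub>1 u = 0" and p2: "pd k a\<^sub>2 u = 0" and pD: "pd k (\<lambda>u. D (base u)) u = 0"
    if "u \<in> U" "k = 1 \<or> k = 3" for u k
    using b(2)[OF holo_on_pd[OF W hA]] b(2)[OF hD] that by (auto simp add: U_def a\<^sub>1_def[abs_def] a\<^sub>2_def[abs_def])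
  have pa: "pd k a u = 0" if "u \<in> U" "k = 1 \<or> k = 3" for u k using that by (auto simp: pd_a)
  have sq: "holo_on (\<lambda>u. (a u)\<^sup>2) U" "u \<in> U \<Longrightarrow> pd k (\<lambda>u. (a u)\<^sup>2) u = 2 * a u * pd k a u" for u k
    using holo_on_mult[OF holo_a holo_a] pd_mult[OF holo_a holo_a, of u k] by (simp_all add: power2_eq_square)
  have m1: "holo_on (\<lambda>u::cvec. u $ 1 * a\<^sub>1 u) U" and m3: "holo_on (\<lambda>u::cvec. u $ 3 * a\<^sub>2 u) U"
    by (intro holo_on_mult h1 h2 holo_on_nth)+
  have q: "holo_on (\<lambda>u::cvec. u $ 3 * a\<^sub>2 u / (a u)\<^sup>2) U"
    by (rule holo_on_divide[OF m3 sq(1)]) (simp add: a_nz)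
  show "holo_on h U" unfolding h_def[abs_def] by (intro holo_on_add holo_on_diff m1 q hd)
  have "pd k h u = of_bool (k = 1) * a\<^sub>1 u - of_bool (k = 3) * a\<^sub>2 u / (a u)\<^sup>2"
    if u: "u \<in> U" and k: "k = 1 \<or> k = 3" for u k
  proof -
    have "pd k h u = pd k (\<lambda>u. u $ 1 * a\<^sub>1 u - u $ 3 * a\<^sub>2 u / (a u)\<^sup>2) u + pd k (\<lambda>u. D (base u)) u"
      unfolding h_def[abs_def] by (rule pd_add[OF holo_on_diff[OF m1 q] hd u])
    also have "pd k (\<lambda>u. u $ 1 * a\<^sub>1 u - u $ 3 * a\<^sub>2 u / (a u)\<^sup>2) u =
        pd k (\<lambda>u. u $ 1 * a\<^sub>1 u) u - pd k (\<lambda>u. u $ 3 * a\<^sub>2 u / (a u)\<^sup>2) u" by (rule pd_diff[OF m1 q u])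
    also have "pd k (\<lambda>u. u $ 1 * a\<^sub>1 u) u = u $ 1 * pd k a\<^sub>1 u + pd k (\<lambda>u. u $ 1) u * a\<^sub>1 u"
      by (rule pd_mult[OF holo_on_nth h1 u])
    also have "pd k (\<lambda>u. u $ 3 * a\<^sub>2 u / (a u)\<^sup>2) u =
        (pd k (\<lambda>u. u $ 3 * a\<^sub>2 u) u * (a u)\<^sup>2 - u $ 3 * a\<^sub>2 u * pd k (\<lambda>u. (a u)\<^sup>2) u) / ((a u)\<^sup>2)\<^sup>2"
      by (rule pd_divide[OF m3 sq(1) _ u]) (simp add: a_nz)
    also have "pd k (\<lambda>u. u $ 3 * a\<^sub>2 u) u = u $ 3 * pd k a\<^sub>2 u + pd k (\<lambda>u. u $ 3) u * a\<^sub>2 u"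
      by (rule pd_mult[OF holo_on_nth h2 u])
    finally show ?thesis
      using a_nz[OF u] unfolding p1[OF u k] p2[OF u k] pD[OF u k] sq(2)[OF u] pa[OF u k] pd_nth
      by (simp add: power2_eq_square)
  qed
  then show "u \<in> U \<Longrightarrow> pd 1 h u = a\<^sub>1 u" "u \<in> U \<Longrightarrow> pd 3 h u = - a\<^sub>2 u / (a u)\<^sup>2"
    by simp_all
qed

text \<open>All entries of g and J are combinations of a, 1/a and h with constant coefficients, so
  this one rule yields holomorphy and derivatives of every component.\<close>

lemma
  assumes f: "\<And>u. f u = c1 * a u + c2 * (1 / a u) + c3 * h u"
  shows holo_combination: "holo_on f U"
    and pd_combination: "u \<in> U \<Longrightarrow> pd k f u = c1 * pd k a u - c2 * pd k a u / (a u)\<^sup>2 + c3 * pd k h u"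
proof -
  have f': "f = (\<lambda>u. c1 * a u + c2 * (1 / a u) + c3 * h u)" using f by blast
  have h: "holo_on (\<lambda>u. c1 * a u) U" "holo_on (\<lambda>u. c2 * (1 / a u)) U" "holo_on (\<lambda>u. c3 * h u) U"
    by (intro holo_on_cmult holo_a holo_inv_a holo_h)+
  show "holo_on f U" unfolding f' by (intro holo_on_add h)
  assume u: "u \<in> U"
  have "pd k f u = pd k (\<lambda>u. c1 * a u + c2 * (1 / a u)) u + pd k (\<lambda>u. c3 * h u) u"
    unfolding f' by (rule pd_add[OF holo_on_add[OF h(1,2)] h(3) u])
  also have "pd k (\<lambda>u. c1 * a u + c2 * (1 / a u)) u = pd k (\<lambda>u. c1 * a u) u + pd k (\<lambda>u. c2 * (1 / a u)) u"
    by (rule pd_add[OF h(1,2) u])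
  finally show "pd k f u = c1 * pd k a u - c2 * pd k a u / (a u)\<^sup>2 + c3 * pd k h u"
    unfolding pd_cmult[OF holo_a u] pd_cmult[OF holo_inv_a u] pd_cmult[OF holo_h u] pd_inv_a[OF u] by simp
qed

lemma g_nth: "g u $ i $ j = sym_prod 1 4 i j * a u + sym_prod 2 3 i j * (1 / a u) + sym_prod 2 4 i j * h u"
  by (simp add: g_def normal_metric_def a_def h_def a\<^sub>1_def a\<^sub>2_def)

lemma J_nth: "J u $ i $ j =
  (of_bool (i = 2 \<and> j = 4) + of_bool (i = 3 \<and> j = 1)) * a u
  + (- of_bool (i = 1 \<and> j = 3) - of_bool (i = 4 \<and> j = 2)) * (1 / a u)
  + (of_bool (i = 3 \<and> j = 2) - of_bool (i = 1 \<and> j = 4)) * h u"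
  by (simp add: J_def)

lemmas pd_g = pd_combination[OF g_nth] and pd_J = pd_combination[OF J_nth]

lemma holo_structure: "holo_mat U g" "holo_mat U I" "holo_mat U J" "holo_mat U K"
  using holo_combination[OF g_nth] holo_combination[OF J_nth]
  by (auto simp: holo_mat_def I_def K_def intro: holo_on_cmult)

text \<open>The factor 4 undoes two halves: the coefficients of the metric carry 1/2 from
  \<open>sym_prod\<close>, and so does the formula for the inverse.\<close>

lemma
  assumes u: "u \<in> U"
  shows invertible_g: "invertible (g u)"
    and inv_g: "matrix_inv (g u) $ i $ j =
      4 * (sym_prod 2 3 i j * a u + sym_prod 1 4 i j * (1 / a u) - sym_prod 1 3 i j * h u)"
proof -
  define G' :: cmat where
    "G' = (\<chi> i j. 4 * (sym_prod 2 3 i j * a u + sym_prod 1 4 i j * (1 / a u) - sym_prod 1 3 i j * h u))"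
  have 1: "g u ** G' = mat 1"
    using a_nz[OF u]
    by (simp add: vec_eq_iff forall_4 matrix_matrix_mult_def sum_4 g_nth G'_def sym_prod_def mat_def field_simps)
  then have 2: "G' ** g u = mat 1" by (simp add: matrix_left_right_inverse)
  show inv: "invertible (g u)" using 1 2 by (auto simp: invertible_def)
  have "matrix_inv (g u) = (G' ** g u) ** matrix_inv (g u)" by (simp add: 2)
  also have "\<dots> = G'" by (simp add: matrix_mul_assoc[symmetric] mult_matrix_inv[OF inv])
  finally show "matrix_inv (g u) $ i $ j =
      4 * (sym_prod 2 3 i j * a u + sym_prod 1 4 i j * (1 / a u) - sym_prod 1 3 i j * h u)"
    by (simp add: G'_def)
qed

text \<open>The prescribed derivatives of h in directions 1 and 3 are exactly what cancels the
  symbols mixing the index blocks {1, 2} and {3, 4}: they offset the derivatives of a and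
  1/a.\<close>

lemma christoffel_g:
  assumes u: "u \<in> U"
  shows "christoffel g u i j k =
    (if i = 1 \<and> j = 2 \<and> k = 2 then h u * a\<^sub>1 u / (a u)\<^sup>2 + pd 2 h u / a u
     else if i = 1 \<and> (j = 1 \<and> k = 2 \<or> j = 2 \<and> k = 1) then a\<^sub>1 u / a u
     else if i = 2 \<and> j = 2 \<and> k = 2 then - a\<^sub>1 u / a u
     else if i = 3 \<and> j = 4 \<and> k = 4 then a u * pd 4 h u - h u * a\<^sub>2 u
     else if i = 3 \<and> (j = 3 \<and> k = 4 \<or> j = 4 \<and> k = 3) then - a\<^sub>2 u / a u
     else if i = 4 \<and> j = 4 \<and> k = 4 then a\<^sub>2 u / a u
     else 0)"
  using a_nz[OF u] exhaust_4[of i] exhaust_4[of j] exhaust_4[of k]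
  unfolding christoffel_def sum_4 inv_g[OF u] pd_g[OF u] pd_a[OF u] sym_prod_def
  by (elim disjE) (simp_all add: pd_h[OF u] field_simps power2_eq_square)

section \<open>Parallelism of the three complex structures\<close>

lemma christoffel_eps: "u \<in> U \<Longrightarrow> christoffel g u i k l * eps l = christoffel g u i k l * eps i"
  by (auto simp: christoffel_g eps_def)

lemma parallel_I: "parallel U g I"
proof -
  have "pd k (\<lambda>y. I y $ i $ j) u = 0" for k i j u by (simp add: I_def)
  moreover have "(\<Sum>l\<in>UNIV. christoffel g u i k l * I u $ l $ j) = christoffel g u i k j * eps j" for i j k u
    by (simp add: I_def if_distrib[of "\<lambda>x. _ * x"] cong: if_cong)
  moreover have "(\<Sum>l\<in>UNIV. christoffel g u l k j * I u $ i $ l) = christoffel g u i k j * eps i" for i j k u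
    by (simp add: I_def if_distrib[of "\<lambda>x. _ * x"] cong: if_cong)
  ultimately show ?thesis
    unfolding parallel_def cov_deriv_def by (simp add: christoffel_eps)
qed

lemma christoffel_values:
  assumes u: "u \<in> U"
  shows "christoffel g u 1 2 2 = h u * a\<^sub>1 u / (a u)\<^sup>2 + pd 2 h u / a u"
    "christoffel g u 1 1 2 = a\<^sub>1 u / a u" "christoffel g u 1 2 1 = a\<^sub>1 u / a u" "christoffel g u 2 2 2 = - a\<^sub>1 u / a u"
    "christoffel g u 3 4 4 = a u * pd 4 h u - h u * a\<^sub>2 u"
    "christoffel g u 3 3 4 = - a\<^sub>2 u / a u" "christoffel g u 3 4 3 = - a\<^sub>2 u / a u" "christoffel g u 4 4 4 = a\<^sub>2 u / a u"
  unfolding christoffel_g[OF u] by simp_all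

lemma christoffel_zero:
  assumes u: "u \<in> U"
  shows "christoffel g u 1 1 1 = 0" "christoffel g u 1 3 j = 0" "christoffel g u 1 4 j = 0" "christoffel g u 1 j 3 = 0" "christoffel g u 1 j 4 = 0"
   "christoffel g u 2 1 j = 0" "christoffel g u 2 3 j = 0" "christoffel g u 2 4 j = 0" "christoffel g u 2 j 1 = 0" "christoffel g u 2 j 3 = 0" "christoffel g u 2 j 4 = 0"
   "christoffel g u 3 3 3 = 0" "christoffel g u 3 1 j = 0" "christoffel g u 3 2 j = 0" "christoffel g u 3 j 1 = 0" "christoffel g u 3 j 2 = 0"
   "christoffel g u 4 1 j = 0" "christoffel g u 4 2 j = 0"  "christoffel g u 4 3 j = 0" "christoffel g u 4 j 1 = 0" "christoffel g u 4 j 2 = 0" "christoffel g u 4 j 3 = 0"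
  unfolding christoffel_g[OF u] by simp_all

lemma cov_deriv_J:
  assumes u: "u \<in> U"
  shows "cov_deriv g J u k i j = 0"
  using a_nz[OF u] exhaust_4[of i] exhaust_4[of j] exhaust_4[of k]
  unfolding cov_deriv_def sum_4 pd_J[OF u]
  by (elim disjE; hypsubst)
     (simp_all add: J_nth christoffel_values[OF u] christoffel_zero[OF u] pd_a[OF u] pd_h[OF u],
      simp_all add: field_simps power2_eq_square)

lemma parallel_J: "parallel U g J"
  by (simp add: parallel_def cov_deriv_J)

text \<open>K = I J with I constant, and by \<open>christoffel_eps\<close> the connection commutes
  with I, so the covariant derivative of K is that of J multiplied by an eigenvalue.\<close>

lemma parallel_K: "parallel U g K"
  unfolding parallel_def
proof (intro ballI allI)
  fix u k i j assume u: "u \<in> U"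
  have 1: "pd k (\<lambda>y. K y $ i $ j) u = eps i * pd k (\<lambda>y. J y $ i $ j) u"
    using pd_cmult[of "\<lambda>y. J y $ i $ j" U u k "eps i"] holo_structure(3) u by (simp add: K_def holo_mat_def)
  have 2: "(\<Sum>l\<in>UNIV. christoffel g u i k l * K u $ l $ j) = eps i * (\<Sum>l\<in>UNIV. christoffel g u i k l * J u $ l $ j)"
    unfolding sum_distrib_left
  proof (rule sum.cong[OF refl])
    fix l
    show "christoffel g u i k l * K u $ l $ j = eps i * (christoffel g u i k l * J u $ l $ j)"
      using christoffel_eps[OF u, of i k l] by (simp add: K_def mult.assoc[symmetric])
  qed
  have 3: "(\<Sum>l\<in>UNIV. christoffel g u l k j * K u $ i $ l) = eps i * (\<Sum>l\<in>UNIV. christoffel g u l k j * J u $ i $ l)"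
    by (simp add: K_def sum_distrib_left mult_ac)
  have "cov_deriv g K u k i j = eps i * cov_deriv g J u k i j"
    unfolding cov_deriv_def 1 2 3 by (simp add: algebra_simps)
  then show "cov_deriv g K u k i j = 0" by (simp add: cov_deriv_J[OF u])
qed

section \<open>Quaternion relations, foliation and bracket condition for a normal metric\<close>

lemma act:
  "(I u *v v) = (\<chi> i. eps i * v $ i)"
  "(J u *v v) = (\<chi> i. if i = 1 then - (v $ 3 / a u) - h u * v $ 4 else if i = 2 then a u * v $ 4
    else if i = 3 then a u * v $ 1 + h u * v $ 2 else - (v $ 2 / a u))"
  "(K u *v v) = (\<chi> i. eps i * (J u *v v) $ i)"
  by (simp_all add: vec_eq_iff forall_4 matrix_vector_mult_def sum_4 I_def K_def J_def algebra_simps)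

lemma bil_g: "bil (g u) v w = a u / 2 * (v $ 1 * w $ 4 + v $ 4 * w $ 1)
    + 1 / a u / 2 * (v $ 2 * w $ 3 + v $ 3 * w $ 2) + h u / 2 * (v $ 2 * w $ 4 + v $ 4 * w $ 2)"
  unfolding g_def bil_normal_metric a_def h_def a\<^sub>1_def a\<^sub>2_def ..

lemma hyper_kaehler_normal_metric: "hyper_kaehler U g I J K"
proof -
  have met: "holo_metric U g"
    using holo_structure(1) invertible_g
    by (auto simp: holo_metric_def vec_eq_iff transpose_def g_nth sym_prod_def)
  have herm: "hermitian U g I" "hermitian U g J" "hermitian U g K"
    using a_nz by (auto simp: hermitian_def bil_g act eps_def field_simps)
  have quat: "I u ** I u = - mat 1" "J u ** J u = - mat 1" "K u ** K u = - mat 1" "I u ** J u ** K u = - mat 1"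
    if "u \<in> U" for u
  proof -
    show 1: "I u ** I u = - mat 1" "J u ** J u = - mat 1" and 2: "K u ** K u = - mat 1"
      using a_nz[OF that]
      by (simp_all add: vec_eq_iff forall_4 matrix_matrix_mult_def sum_4 I_def K_def J_def eps_def mat_def field_simps)
    have "I u ** J u = K u"
      by (simp add: vec_eq_iff forall_4 matrix_matrix_mult_def sum_4 I_def K_def)
    then show "I u ** J u ** K u = - mat 1" by (simp add: 2)
  qed
  show ?thesis
    unfolding hyper_kaehler_def
    using open_U met holo_structure herm parallel_I parallel_J parallel_K quat by auto
qed

lemma hyper_lagrangian_normal_metric: "hyper_lagrangian_foliation U g I J K B"
proof -
  have span: "B u = vec.span {axis 1 1, axis 3 1}" for u
  proof
    show "vec.span {axis 1 1, axis 3 1} \<subseteq> B u"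
      by (rule vec.span_minimal) (auto simp: B_def axis_def vec.subspace_def)
    show "B u \<subseteq> vec.span {axis 1 1, axis 3 1}"
    proof
      fix v assume "v \<in> B u"
      then have "v = v $ 1 *s axis 1 1 + v $ 3 *s axis 3 1"
        by (simp add: B_def vec_eq_iff forall_4 axis_def)
      also have "\<dots> \<in> vec.span {axis 1 1, axis 3 1}"
        by (intro vec.span_add vec.span_scale vec.span_base) auto
      finally show "v \<in> vec.span {axis 1 1, axis 3 1}" .
    qed
  qed
  have "vec.independent {axis 1 1, axis 3 1 :: cvec}"
    by (rule vec.independent_mono[OF independent_cart_basis]) (auto simp: cart_basis_def)
  then have "vec.dim {axis 1 1, axis 3 1 :: cvec} = card {axis 1 1, axis 3 1 :: cvec}"
    by (rule vec.dim_eq_card_independent)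
  also have "\<dots> = 2" by (simp add: axis_eq_axis)
  finally have dim: "vec.dim (B u) = 2" for u by (simp add: span)
  have "rank2_distribution U B"
    unfolding rank2_distribution_def
  proof
    fix p assume "p \<in> U"
    then show "\<exists>V X Y. open V \<and> p \<in> V \<and> V \<subseteq> U \<and> holo_vec V X \<and> holo_vec V Y \<and>
        (\<forall>x\<in>V. B x = vec.span {X x, Y x} \<and> vec.dim (B x) = 2)"
      using open_U span dim
      by (intro exI[of _ U] exI[of _ "\<lambda>_. axis 1 1"] exI[of _ "\<lambda>_. axis 3 1"]) (simp add: holo_vec_def)
  qed
  moreover have "integrable_distribution U B"
    unfolding integrable_distribution_def brackets_within_def local_section_def
  proof (intro allI impI ballI)
    fix V X Y x
    assume X: "open V \<and> V \<subseteq> U \<and> holo_vec V X \<and> (\<forall>x\<in>V. X x \<in> B x)"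
      and Y: "open V \<and> V \<subseteq> U \<and> holo_vec V Y \<and> (\<forall>x\<in>V. Y x \<in> B x)" and x: "x \<in> V"
    have "pd j (\<lambda>y. Z y $ i) x = 0" if "\<forall>x\<in>V. Z x \<in> B x" "i = 2 \<or> i = 4" for Z i j
      using pd_cong[of V x "\<lambda>y. Z y $ i" "\<lambda>_. 0" j] X x that by (auto simp: B_def)
    then show "lie_bracket X Y x \<in> B x"
      using X Y by (simp add: B_def lie_bracket_def)
  qed
  moreover have "lagrangian U g T B" if "T \<in> {I, J, K}" for T
    using that by (auto simp: lagrangian_def B_def bil_g act)
  ultimately show ?thesis by (simp add: hyper_lagrangian_foliation_def)
qed

text \<open>Two of the four equations of an \<alpha>-plane involve only components 2 and 4, with
  coefficients built from a, which is constant along B. Differentiating them along B shows that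
  these components of the bracket satisfy the same equations; the other two components can be
  adjusted modulo B.\<close>

lemma alpha_compatible_normal_metric: "alpha_compatible U I J K B"
  unfolding alpha_compatible_def brackets_within_def
proof (intro allI impI ballI)
  fix \<alpha> \<beta> \<gamma> V X Y x
  assume X: "local_section U B V X" and Y: "local_section U (alpha_distribution I J K \<alpha> \<beta> \<gamma>) V Y" and x: "x \<in> V"
  \<comment> \<open>On the eigenspaces of I the combination \<beta>J + \<gamma>K acts as a multiple
    of J, by p on vectors with eigenvalue \<i> and by q on those with eigenvalue -\<i>.\<close>
  define p where "p = \<beta> - \<i> * \<gamma>"
  define q where "q = \<beta> + \<i> * \<gamma>"
  have V: "open V" "V \<subseteq> U" and xU: "x \<in> U" using X x by (auto simp: local_section_def)
  have in_alpha: "v \<in> alpha_distribution I J K \<alpha> \<beta> \<gamma> u \<longleftrightarrow>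
      - \<i> * \<alpha> * v $ 1 - p * (v $ 3 / a u + h u * v $ 4) = 0 \<and> - \<i> * \<alpha> * v $ 2 + p * a u * v $ 4 = 0 \<and>
      \<i> * \<alpha> * v $ 3 + q * (a u * v $ 1 + h u * v $ 2) = 0 \<and> \<i> * \<alpha> * v $ 4 - q * (1 / a u) * v $ 2 = 0" for u v
    unfolding alpha_distribution_def
    by (simp add: vec_eq_iff forall_4 act eps_def p_def q_def algebra_simps add_divide_distrib diff_divide_distrib)
  define z where "z = lie_bracket X Y x"
  have Xz: "pd j (\<lambda>y. X y $ i) x = 0" if "i = 2 \<or> i = 4" for i j
    using pd_cong[OF V(1) x, of "\<lambda>y. X y $ i" "\<lambda>_. 0" j] X that by (auto simp: local_section_def B_def)
  have X0: "X x $ 2 = 0" "X x $ 4 = 0" using X x by (auto simp: local_section_def B_def)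
  have z: "z $ i = X x $ 1 * pd 1 (\<lambda>y. Y y $ i) x + X x $ 3 * pd 3 (\<lambda>y. Y y $ i) x" if "i = 2 \<or> i = 4" for i
    using that by (simp add: z_def lie_bracket_def sum_4 Xz X0)
  have hY: "holo_on (\<lambda>y. Y y $ i) V" for i using Y by (simp add: local_section_def holo_vec_def)
  \<comment> \<open>Differentiates an equation of the plane in a direction tangent to B, where the
    coefficient f is constant.\<close>
  have diff: "c * pd k (\<lambda>y. Y y $ i) x + d * f x * pd k (\<lambda>y. Y y $ j) x = 0"
    if k: "k = 1 \<or> k = 3" and f: "holo_on f U" "pd k f x = 0" and eq: "\<And>y. y \<in> V \<Longrightarrow> c * Y y $ i + d * f y * Y y $ j = 0"
    for c d i j k f
  proof -
    have hf: "holo_on (\<lambda>y. d * f y) V" by (rule holo_on_cmult[OF holo_on_subset[OF f(1) V(2)]])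
    have "0 = pd k (\<lambda>y. c * Y y $ i + d * f y * Y y $ j) x"
      using pd_cong[OF V(1) x, of "\<lambda>y. c * Y y $ i + d * f y * Y y $ j" "\<lambda>_. 0" k] eq by simp
    also have "\<dots> = pd k (\<lambda>y. c * Y y $ i) x + pd k (\<lambda>y. d * f y * Y y $ j) x"
      by (rule pd_add[OF holo_on_cmult[OF hY] holo_on_mult[OF hf hY] x])
    also have "pd k (\<lambda>y. d * f y * Y y $ j) x = d * f x * pd k (\<lambda>y. Y y $ j) x + pd k (\<lambda>y. d * f y) x * Y x $ j"
      by (rule pd_mult[OF hf hY x])
    also have "pd k (\<lambda>y. d * f y) x = 0" using pd_cmult[OF f(1) xU, of k d] f(2) by simp
    also have "pd k (\<lambda>y. c * Y y $ i) x = c * pd k (\<lambda>y. Y y $ i) x" by (rule pd_cmult[OF hY x])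
    finally show ?thesis by simp
  qed
  have Yeq: "- \<i> * \<alpha> * Y y $ 2 + p * a y * Y y $ 4 = 0" "\<i> * \<alpha> * Y y $ 4 + - q * (1 / a y) * Y y $ 2 = 0" if "y \<in> V" for y
    using Y that by (auto simp: local_section_def in_alpha)
  have d2: "- \<i> * \<alpha> * pd k (\<lambda>y. Y y $ 2) x + p * a x * pd k (\<lambda>y. Y y $ 4) x = 0" if k: "k = 1 \<or> k = 3" for k
    by (rule diff[OF k holo_a _ Yeq(1)]) (use k in \<open>auto simp: pd_a[OF xU]\<close>)
  have d4: "\<i> * \<alpha> * pd k (\<lambda>y. Y y $ 4) x + - q * (1 / a x) * pd k (\<lambda>y. Y y $ 2) x = 0" if k: "k = 1 \<or> k = 3" for k
    by (rule diff[OF k holo_inv_a _ Yeq(2)]) (use k in \<open>auto simp: pd_a[OF xU] pd_inv_a[OF xU]\<close>)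
  have "- \<i> * \<alpha> * z $ 2 + p * a x * z $ 4 =
      X x $ 1 * (- \<i> * \<alpha> * pd 1 (\<lambda>y. Y y $ 2) x + p * a x * pd 1 (\<lambda>y. Y y $ 4) x)
      + X x $ 3 * (- \<i> * \<alpha> * pd 3 (\<lambda>y. Y y $ 2) x + p * a x * pd 3 (\<lambda>y. Y y $ 4) x)"
    by (simp add: z algebra_simps)
  then have z2: "- \<i> * \<alpha> * z $ 2 + p * a x * z $ 4 = 0" using d2[of 1] d2[of 3] by simp
  have "\<i> * \<alpha> * z $ 4 + - q * (1 / a x) * z $ 2 =
      X x $ 1 * (\<i> * \<alpha> * pd 1 (\<lambda>y. Y y $ 4) x + - q * (1 / a x) * pd 1 (\<lambda>y. Y y $ 2) x)
      + X x $ 3 * (\<i> * \<alpha> * pd 3 (\<lambda>y. Y y $ 4) x + - q * (1 / a x) * pd 3 (\<lambda>y. Y y $ 2) x)"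
    by (simp only: z simp_thms) algebra
  then have z4: "\<i> * \<alpha> * z $ 4 + - q * (1 / a x) * z $ 2 = 0" using d4[of 1] d4[of 3] by simp
  \<comment> \<open>Components 2 and 4 are those of the bracket, component 3 is set to 0, and
    component 1 solves the first equation. For \<alpha> = 0 the quotient is 0; then
    \<open>z2\<close> and \<open>z4\<close> give p z_4 = 0 and q z_2 = 0, so the equations still
    hold.\<close>
  define w :: cvec where
    "w = (\<chi> i. if i = 1 then \<i> * p * h x * z $ 4 / \<alpha> else if i = 2 then z $ 2 else if i = 3 then 0 else z $ 4)"
  have w: "w $ 1 = \<i> * p * h x * z $ 4 / \<alpha>" "w $ 2 = z $ 2" "w $ 3 = 0" "w $ 4 = z $ 4" by (simp_all add: w_def)
  have ax: "a x \<noteq> 0" by (rule a_nz[OF xU])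
  have 1: "- \<i> * \<alpha> * w $ 1 - p * (w $ 3 / a x + h x * w $ 4) = 0"
  proof (cases "\<alpha> = 0")
    case True
    then show ?thesis using z2 ax by (auto simp: w)
  next
    case False
    then show ?thesis by (simp add: w)
  qed
  have 3: "\<i> * \<alpha> * w $ 3 + q * (a x * w $ 1 + h x * w $ 2) = 0"
  proof (cases "\<alpha> = 0")
    case True
    then show ?thesis using z4 ax by (auto simp: w)
  next
    case False
    have "p * a x * z $ 4 = \<i> * \<alpha> * z $ 2" using z2 by simp
    moreover have "a x * w $ 1 = \<i> * h x * (p * a x * z $ 4) / \<alpha>" by (simp add: w mult_ac)
    moreover have "\<i> * (h x * (\<i> * z $ 2)) = (\<i> * \<i>) * (h x * z $ 2)" by (simp only: mult_ac)
    ultimately have "a x * w $ 1 = - h x * z $ 2" using False by simp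
    then show ?thesis by (simp add: w)
  qed
  have "w \<in> alpha_distribution I J K \<alpha> \<beta> \<gamma> x"
    unfolding in_alpha using 1 3 z2 z4 by (simp add: w(2,4))
  moreover have "z - w \<in> B x" by (simp add: B_def w)
  moreover have "z = (z - w) + w" by simp
  ultimately show "lie_bracket X Y x \<in> dist_sum B (alpha_distribution I J K \<alpha> \<beta> \<gamma>) x"
    unfolding dist_sum_def z_def by blast
qed

end

theorem normal_metric_hyper_lagrangian:
  assumes "admissible W A D"
  shows "\<exists>I J K B. hyper_kaehler {u. base u \<in> W} (normal_metric A D) I J K \<and>
    hyper_lagrangian_foliation {u. base u \<in> W} (normal_metric A D) I J K B \<and>
    alpha_compatible {u. base u \<in> W} I J K B"
proof -
  interpret normal_form W A D by unfold_locales (rule assms)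
  show ?thesis
    using hyper_kaehler_normal_metric hyper_lagrangian_normal_metric alpha_compatible_normal_metric
    unfolding U_def g_def by blast
qed

theorem proposition5p3:
  shows "(\<forall>U g I J K B.
            hyper_kaehler U g I J K \<and>
            hyper_lagrangian_foliation U g I J K B \<and>
            alpha_compatible U I J K B \<longrightarrow>
            (\<forall>p\<in>U. \<exists>V \<phi> W A D.
               p \<in> V \<and> V \<subseteq> U \<and> local_coordinates V \<phi> \<and>
               admissible W A D \<and> (\<forall>x\<in>V. base (\<phi> x) \<in> W) \<and>
               (\<forall>x\<in>V. \<forall>v w. bil (g x) v w =
                  bil (normal_metric A D (\<phi> x)) (differential \<phi> x v) (differential \<phi> x w))))
       \<and> (\<forall>W A D. admissible W A D \<longrightarrow>
            (\<exists>I J K B.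
               hyper_kaehler {u. base u \<in> W} (normal_metric A D) I J K \<and>
               hyper_lagrangian_foliation {u. base u \<in> W} (normal_metric A D) I J K B \<and>
               alpha_compatible {u. base u \<in> W} I J K B))"
proof (intro conjI allI impI ballI)
  fix U g I J K B p
  assume "hyper_kaehler U g I J K \<and> hyper_lagrangian_foliation U g I J K B \<and> alpha_compatible U I J K B"
    and p: "p \<in> U"
  then have hk: "hyper_kaehler U g I J K" and hl: "hyper_lagrangian_foliation U g I J K B"
    and ac: "alpha_compatible U I J K B" by simp_all
  show "\<exists>V \<phi> W A D. p \<in> V \<and> V \<subseteq> U \<and> local_coordinates V \<phi> \<and> admissible W A D \<and>
      (\<forall>x\<in>V. base (\<phi> x) \<in> W) \<and>
      (\<forall>x\<in>V. \<forall>v w. bil (g x) v w = bil (normal_metric A D (\<phi> x)) (differential \<phi> x v) (differential \<phi> x w))"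
    by (rule normal_form_exists[OF hk hl ac p])
next
  fix W A D assume "admissible W A D"
  then show "\<exists>I J K B. hyper_kaehler {u. base u \<in> W} (normal_metric A D) I J K \<and>
      hyper_lagrangian_foliation {u. base u \<in> W} (normal_metric A D) I J K B \<and>
      alpha_compatible {u. base u \<in> W} I J K B"
    by (rule normal_metric_hyper_lagrangian)
qed

end
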